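(* Let $f$ be a non-trivial (i.e. not identically zero) real-valued real analytic function defined on a neighborhood of the origin in $\mathbb{R}^2$ with $f(0,0)=0$, $\nabla f(0,0)=0$. Choose $\kappa_1,\kappa_2\ge0$ such that the principal face $\pi(f)$ of the Newton polyhedron of $f$ lies on the line $\kappa_1t_1+\kappa_2t_2=1$. Without loss of generality, we may assume that $\kappa_2\ge\kappa_1$. Then there exists a real analytic function $\psi(x_1)$ of $x_1$ near the origin with $\psi(0)=0$ such that an adapted coordinate system $(y_1,y_2)$ for $f$ near $0$ is given by $y_1:=x_1$, $y_2:=x_2-\psi(x_1)$. The function $\psi$ can in fact be chosen as one of the roots, respectively a leading partial sum of the Puiseux series expansion of one of the roots, of the equation $f(x_1,x_2)=0$, considered as an equation in $x_2$.
   Context: Here $\mathbb{N}=\{0,1,2,\dots\}$ and $\mathbb{R}_+=[0,\infty)$. For $f$ real analytic near the origin with Taylor series $\sum_{j,k}c_{jk}x_1^jx_2^k$, the Taylor support is $\mathcal{T}(f)=\{(j,k)\in\mathbb{N}^2:c_{jk}\neq0\}$. The Newton polyhedron $\mathcal{N}(f)$ is the convex hull of the union of all quadrants $(j,k)+\mathbb{R}_+^2$, $(j,k)\in\mathcal{T}(f)$, in the plane with coordinates $(t_1,t_2)$. A face is an edge (possibly unbounded) or a vertex. The distance $d(f)$ is the number $d$ such that $(d,d)$ is the point where the bisectrix $t_1=t_2$ intersects the boundary of $\mathcal{N}(f)$. The principal face $\pi(f)$ is the face of minimal dimension containing $(d,d)$. A local analytic coordinate system $y$ at the origin is given by $x=\varphi(y)$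 with $\varphi$ an analytic local diffeomorphism near $0$ with $\varphi(0)=0$; in it $f$ is expressed as $f\circ\varphi$, and $d_y:=d(f\circ\varphi)$. The height is $h(f):=\sup d_y$, the supremum over all local analytic coordinate systems $y$ at the origin. The coordinate system $y$ is adapted to $f$ if $d_y=h(f)$. Roots: by the Weierstrass preparation theorem, near the origin $f(x_1,x_2)=U(x_1,x_2)\,x_1^{\nu_1}x_2^{\nu_2}F(x_1,x_2)$ with $U$ real analytic, $U(0,0)\ne0$, $\nu_1,\nu_2\in\mathbb{N}$, and $F(x_1,x_2)=x_2^m+g_1(x_1)x_2^{m-1}+\dots+g_m(x_1)$ with $g_j$ real analytic, $g_j(0)=0$ and $g_m\not\equiv0$. The roots $x_2=r(x_1)$ of $F=0$ are given in a small neighborhood of $0$ by Puiseux series in $x_1$ with strictly increasing positive rational exponents and non-zero complex coefficients; if $\nu_2\ge1$, there is in addition the trivial root $x_2=0$. A leading partial sum of such a series is the sum of an initial segment of its terms. *)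

theory Defs
  imports "HOL-Analysis.Analysis"
begin

section \<open>Real analytic functions near the origin\<close>

text \<open>All notions depend on germs at the origin only: a function defined on a neighborhood of the
  origin is represented by any total extension of it.\<close>

definition has_power_series2 :: "(real \<times> real \<Rightarrow> real) \<Rightarrow> (nat \<times> nat \<Rightarrow> real) \<Rightarrow> bool" where
  "has_power_series2 f c \<longleftrightarrow>
     (\<exists>r>0. \<forall>x1 x2. \<bar>x1\<bar> < r \<longrightarrow> \<bar>x2\<bar> < r \<longrightarrow>
        ((\<lambda>(j, k). c (j, k) * x1 ^ j * x2 ^ k) has_sum f (x1, x2)) UNIV)"

definition real_analytic2 :: "(real \<times> real \<Rightarrow> real) \<Rightarrow> bool" where
  "real_analytic2 f \<longleftrightarrow> (\<exists>c. has_power_series2 f c)"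

definition real_analytic1 :: "(real \<Rightarrow> real) \<Rightarrow> bool" where
  "real_analytic1 g \<longleftrightarrow> (\<exists>A. g has_fps_expansion A)"

section \<open>Newton polyhedra\<close>

text \<open>The coefficients of a convergent double power series are determined by its sum, so the
  description is proper whenever \<open>f\<close> is analytic at the origin.\<close>

definition taylor_coeff :: "(real \<times> real \<Rightarrow> real) \<Rightarrow> nat \<times> nat \<Rightarrow> real" where
  "taylor_coeff f = (THE c. has_power_series2 f c)"

definition taylor_support :: "(real \<times> real \<Rightarrow> real) \<Rightarrow> (nat \<times> nat) set" where
  "taylor_support f = {(j, k). taylor_coeff f (j, k) \<noteq> 0}"

definition newton_polyhedron :: "(real \<times> real \<Rightarrow> real) \<Rightarrow> (real \<times> real) set" where
  "newton_polyhedron f =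
     convex hull (\<Union>(j, k)\<in>taylor_support f. {(t1, t2). real j \<le> t1 \<and> real k \<le> t2})"

definition newton_distance :: "(real \<times> real \<Rightarrow> real) \<Rightarrow> real" where
  "newton_distance f = (THE d. (d, d) \<in> frontier (newton_polyhedron f))"

definition newton_face :: "(real \<times> real \<Rightarrow> real) \<Rightarrow> (real \<times> real) set \<Rightarrow> bool" where
  "newton_face f F \<longleftrightarrow>
     F edge_of newton_polyhedron f \<or> (\<exists>v. v extreme_point_of newton_polyhedron f \<and> F = {v})"

definition principal_face :: "(real \<times> real \<Rightarrow> real) \<Rightarrow> (real \<times> real) set" where
  "principal_face f =
     (let P = (newton_distance f, newton_distance f) in
        THE F. newton_face f F \<and> P \<in> F \<and>
          (\<forall>G. newton_face f G \<and> P \<in> G \<longrightarrow> aff_dim F \<le> aff_dim G))"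

section \<open>Adapted coordinates\<close>

definition real_analytic_map :: "(real \<times> real \<Rightarrow> real \<times> real) \<Rightarrow> bool" where
  "real_analytic_map \<phi> \<longleftrightarrow> real_analytic2 (fst \<circ> \<phi>) \<and> real_analytic2 (snd \<circ> \<phi>)"

text \<open>A coordinate system \<open>y\<close> is represented by the map \<open>\<phi>\<close> with \<open>x = \<phi> y\<close>, that is, by the map
  from the new coordinates to the old ones.\<close>

definition analytic_coordinates :: "(real \<times> real \<Rightarrow> real \<times> real) \<Rightarrow> bool" where
  "analytic_coordinates \<phi> \<longleftrightarrow>
     real_analytic_map \<phi> \<and> \<phi> (0, 0) = (0, 0) \<and>
     (\<exists>\<eta>. real_analytic_map \<eta> \<and>
        (\<forall>\<^sub>F y in nhds (0, 0). \<eta> (\<phi> y) = y) \<and>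
        (\<forall>\<^sub>F x in nhds (0, 0). \<phi> (\<eta> x) = x))"

definition newton_height :: "(real \<times> real \<Rightarrow> real) \<Rightarrow> ereal" where
  "newton_height f = (SUP \<phi>\<in>Collect analytic_coordinates. ereal (newton_distance (f \<circ> \<phi>)))"

definition adapted_coordinates ::
    "(real \<times> real \<Rightarrow> real) \<Rightarrow> (real \<times> real \<Rightarrow> real \<times> real) \<Rightarrow> bool" where
  "adapted_coordinates f \<phi> \<longleftrightarrow>
     analytic_coordinates \<phi> \<and> ereal (newton_distance (f \<circ> \<phi>)) = newton_height f"

section \<open>Roots and their Puiseux series\<close>

text \<open>The monic polynomial \<open>z\<^sup>m + g\<^sub>1(x1) z\<^sup>m\<^sup>-\<^sup>1 + \<dots> + g\<^sub>m(x1)\<close>, for real or complex \<open>z\<close>.\<close>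

definition weierstrass_poly ::
    "nat \<Rightarrow> (nat \<Rightarrow> real \<Rightarrow> real) \<Rightarrow> real \<Rightarrow> 'a::real_normed_field \<Rightarrow> 'a" where
  "weierstrass_poly m g x1 z = z ^ m + (\<Sum>j=1..m. of_real (g j x1) * z ^ (m - j))"

text \<open>For \<open>m = 0\<close> the polynomial is \<open>1\<close>, and the conditions on the \<open>g\<^sub>j\<close> are void.\<close>

definition weierstrass_form ::
    "(real \<times> real \<Rightarrow> real) \<Rightarrow> (real \<times> real \<Rightarrow> real) \<Rightarrow> nat \<Rightarrow> nat \<Rightarrow>
     nat \<Rightarrow> (nat \<Rightarrow> real \<Rightarrow> real) \<Rightarrow> bool" where
  "weierstrass_form f U \<nu>1 \<nu>2 m g \<longleftrightarrow>
     real_analytic2 U \<and> U (0, 0) \<noteq> 0 \<and>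
     (\<forall>j\<in>{1..m}. real_analytic1 (g j) \<and> g j 0 = 0) \<and>
     (m \<ge> 1 \<longrightarrow> \<not> (\<forall>\<^sub>F x in nhds 0. g m x = 0)) \<and>
     (\<forall>\<^sub>F (x1, x2) in nhds (0, 0).
        f (x1, x2) = U (x1, x2) * x1 ^ \<nu>1 * x2 ^ \<nu>2 * weierstrass_poly m g x1 x2)"

text \<open>The pair \<open>p\<close>, \<open>a\<close> encodes the Puiseux series with the terms \<open>a\<^sub>n x\<^sup>n\<^sup>/\<^sup>p\<close>, where \<open>n\<close> ranges over
  the indices with \<open>a\<^sub>n \<noteq> 0\<close>. It is evaluated at \<open>x > 0\<close>, where \<open>x\<^sup>1\<^sup>/\<^sup>p\<close> is the positive root.
  Equations between Puiseux series hold formally iff they hold for all small \<open>x > 0\<close>. The other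
  branches are covered as well: they are the series with coefficients \<open>\<zeta>\<^sup>n a\<^sub>n\<close>, \<open>\<zeta>\<^sup>p = 1\<close>.\<close>

definition puiseux_eval :: "nat \<Rightarrow> complex fps \<Rightarrow> real \<Rightarrow> complex" where
  "puiseux_eval p a x = eval_fps a (of_real (root p x))"

text \<open>The zero series occurs only as the trivial root: it is not a root of the Weierstrass
  polynomial, because \<open>g\<^sub>m\<close> does not vanish identically.\<close>

definition puiseux_root :: "(real \<times> real \<Rightarrow> real) \<Rightarrow> nat \<Rightarrow> complex fps \<Rightarrow> bool" where
  "puiseux_root f p a \<longleftrightarrow>
     p > 0 \<and> fps_conv_radius a > 0 \<and> fps_nth a 0 = 0 \<and>
     (\<exists>U \<nu>1 \<nu>2 m g. weierstrass_form f U \<nu>1 \<nu>2 m g \<and>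
        ((\<forall>\<^sub>F x in at_right 0. weierstrass_poly m g x (puiseux_eval p a x) = 0) \<or>
         \<nu>2 \<ge> 1 \<and> a = 0))"

text \<open>A leading partial sum is obtained by cutting off the series at some order \<open>N\<close>. It may be
  empty: for \<open>f(x1,x2) = x2\<^sup>2 - x1\<^sup>3\<close> the given coordinates are adapted, \<open>\<psi> = 0\<close>, and both roots
  are fractional.\<close>

definition root_or_leading_partial_sum ::
    "(real \<times> real \<Rightarrow> real) \<Rightarrow> (real \<Rightarrow> real) \<Rightarrow> bool" where
  "root_or_leading_partial_sum f \<psi> \<longleftrightarrow>
     (\<exists>p a. puiseux_root f p a \<and>
        ((\<forall>\<^sub>F x in at_right 0. of_real (\<psi> x) = puiseux_eval p a x) \<or>
         (\<exists>N. \<forall>\<^sub>F x in at_right 0. of_real (\<psi> x) = puiseux_eval p (fps_cutoff N a) x)))"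

end

theory Submission
  imports Defs "HOL-Complex_Analysis.Cauchy_Integral_Formula"
    "HOL-Computational_Algebra.Fundamental_Theorem_Algebra"
begin

text \<open>
  A weight is a pair \<open>w = (w1, w2)\<close> of non-negative numbers, not both zero. Its slope is
  \<open>w2 / w1\<close>, and weights of larger slope are called steeper. The weighted order of \<open>f\<close> is the
  minimum of \<open>w1 j + w2 k\<close> over the Taylor support. Supporting lines of the Newton polyhedron show
  that the distance \<open>d(f)\<close> is the maximum of the weighted order divided by \<open>w1 + w2\<close>
  (\<open>newton_distance\<close>). The proof follows the weighted orders under changes of coordinates. They
  can be read off from the limits of \<open>f(s^q y1, s^u y2) / s^N\<close> as \<open>s\<close> tends to \<open>0\<close>: such a limit
  is the sum of the terms of weight \<open>N\<close>, and a substitution acts on it through its own leading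
  part (\<open>leading_limit\<close>, \<open>leading_transfer\<close>).

  The distance cannot be increased by any change of coordinates if, for every weight \<open>(1, k)\<close>
  with \<open>k \<ge> 1\<close>, no non-zero real root of the edge polynomial has multiplicity greater than \<open>d\<close>,
  and the same holds for the weights \<open>(k, 1)\<close> with \<open>k \<ge> 2\<close> (\<open>newton_distance_le\<close>). Indeed, if new
  coordinates send the axis \<open>y2 = 0\<close> to a curve \<open>x2 = b x1^k + ...\<close>, then the new function has a term
  of weighted order \<open>N\<close> for \<open>(1, k)\<close> and of degree at most \<open>d\<close> in \<open>y2\<close>, which bounds its order for
  all steeper weights. Only the weight of a supporting line at \<open>(d, d)\<close> can violate the condition
  (\<open>edge_condition_auto\<close>), and \<open>\<kappa>2 \<ge> \<kappa>1\<close> rules out a violation at \<open>(k, 1)\<close>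
  (\<open>swapped_edge_condition\<close>).

  If the condition fails at \<open>(1, k)\<close>, for a root of multiplicity \<open>n > d\<close>, a Tschirnhaus
  transformation \<open>x2 = y2 + x1^k (b + r(x1))\<close> with analytic \<open>r\<close> raises the distance and removes all
  terms of degree \<open>n - 1\<close> in \<open>y2\<close> (\<open>tschirnhaus\<close>). If the condition fails again, then at a steeper
  weight, where the edge polynomial has degree at most \<open>n\<close> and no term of degree \<open>n - 1\<close>, so that its
  non-zero roots have multiplicity less than \<open>n\<close>. Hence finitely many steps lead to a function that
  satisfies the condition (\<open>adapted_shift_exists\<close>).

  The total shift \<open>\<psi>\<close> need not be a root. Let \<open>a\<close> be the slope of the weight of a
  supporting line at the diagonal point in the final coordinates. If the first entry of this weight
  is \<open>0\<close>, then \<open>y2\<close> divides the final function, and \<open>\<psi>\<close> is a root. Otherwise only the terms of \<open>\<psi>\<close> of exponent less than \<open>a\<close> matter for the distance. The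
  polynomial formed by them is a leading partial sum of a root: after the blow-up along this
  polynomial the function vanishes at the origin, and Puiseux's theorem yields a convergent root
  there (\<open>puiseux_root_exists\<close>, \<open>root_from_blow_up\<close>). Weierstrass preparation and Puiseux's theorem
  are obtained from norm estimates for double power series over the real or complex numbers; the
  induction in Puiseux's theorem rests on the same Tschirnhaus transformation.
\<close>

section \<open>Convergent double power series\<close>

text \<open>Over a general normed field, because the roots are found over the complex numbers while the
  Newton polyhedra belong to real functions.\<close>

definition has_dps ::
    "('a \<times> 'a \<Rightarrow> 'a) \<Rightarrow> (nat \<times> nat \<Rightarrow> 'a::{real_normed_field,banach}) \<Rightarrow> bool" where
  "has_dps f c \<longleftrightarrow>
     (\<exists>r>0. \<forall>x z. norm x < r \<longrightarrow> norm z < r \<longrightarrow>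
        ((\<lambda>(j, k). c (j, k) * x ^ j * z ^ k) has_sum f (x, z)) UNIV)"

lemma has_power_series2_iff_has_dps: "has_power_series2 f c \<longleftrightarrow> has_dps f c"
  by (simp add: has_power_series2_def has_dps_def)

text \<open>The weighted \<open>l1\<close>-norm at radius \<open>r\<close>, carried as an upper bound: it is submultiplicative, so
  bounds for products and powers come without separate convergence arguments.\<close>

definition dps_norm_le :: "real \<Rightarrow> (nat \<times> nat \<Rightarrow> 'a::real_normed_vector) \<Rightarrow> real \<Rightarrow> bool" where
  "dps_norm_le r c B \<longleftrightarrow> 0 \<le> r \<and>
     (\<lambda>(j, k). norm (c (j, k)) * r ^ (j + k)) summable_on UNIV \<and>
     (\<Sum>\<^sub>\<infinity>(j, k). norm (c (j, k)) * r ^ (j + k)) \<le> B"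

definition dps_eval :: "(nat \<times> nat \<Rightarrow> 'a::{real_normed_field,banach}) \<Rightarrow> 'a \<Rightarrow> 'a \<Rightarrow> 'a" where
  "dps_eval c x z = (\<Sum>\<^sub>\<infinity>(j, k). c (j, k) * x ^ j * z ^ k)"

lemma dps_norm_leI:
  assumes "0 \<le> r" "\<And>F. finite F \<Longrightarrow> (\<Sum>(j, k)\<in>F. norm (c (j, k)) * r ^ (j + k)) \<le> B"
  shows "dps_norm_le r c B"
proof -
  have 1: "(\<lambda>(j, k). norm (c (j, k)) * r ^ (j + k)) summable_on UNIV"
    by (rule nonneg_bdd_above_summable_on) (use assms in \<open>auto intro!: bdd_aboveI2[where M = B]\<close>)
  moreover have "(\<Sum>\<^sub>\<infinity>(j, k). norm (c (j, k)) * r ^ (j + k)) \<le> B"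
    by (rule infsum_le_finite_sums[OF 1]) (use assms in auto)
  ultimately show ?thesis using assms(1) by (simp add: dps_norm_le_def)
qed

lemma dps_norm_le_nonneg: "dps_norm_le r c B \<Longrightarrow> 0 \<le> B"
  unfolding dps_norm_le_def
  by (elim conjE, erule order_trans[rotated], rule infsum_nonneg) auto

lemma dps_norm_le_mono: "dps_norm_le r c B \<Longrightarrow> B \<le> B' \<Longrightarrow> dps_norm_le r c B'"
  by (auto simp: dps_norm_le_def)

lemma dps_norm_le_sum:
  assumes "dps_norm_le r c B" "finite F"
  shows "(\<Sum>(j, k)\<in>F. norm (c (j, k)) * r ^ (j + k)) \<le> B"
proof -
  have "(\<Sum>(j, k)\<in>F. norm (c (j, k)) * r ^ (j + k)) \<le> (\<Sum>\<^sub>\<infinity>(j, k). norm (c (j, k)) * r ^ (j + k))"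
    using assms by (intro finite_sum_le_infsum) (auto simp: dps_norm_le_def)
  with assms(1) show ?thesis by (simp add: dps_norm_le_def)
qed

lemma dps_norm_le_comparison:
  assumes "dps_norm_le r c B" "0 \<le> r'"
    and "\<And>j k. norm (c' (j, k)) * r' ^ (j + k) \<le> t * (norm (c (j, k)) * r ^ (j + k))"
    and "0 \<le> t"
  shows "dps_norm_le r' c' (t * B)"
proof (rule dps_norm_leI[OF assms(2)])
  fix F :: "(nat \<times> nat) set" assume F: "finite F"
  have "(\<Sum>(j, k)\<in>F. norm (c' (j, k)) * r' ^ (j + k))
      \<le> (\<Sum>(j, k)\<in>F. t * (norm (c (j, k)) * r ^ (j + k)))"
    by (rule sum_mono) (use assms(3) in auto)
  also have "\<dots> = t * (\<Sum>(j, k)\<in>F. norm (c (j, k)) * r ^ (j + k))"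
    by (simp add: sum_distrib_left case_prod_unfold)
  also have "\<dots> \<le> t * B"
    using dps_norm_le_sum[OF assms(1) F] assms(4) by (rule mult_left_mono)
  finally show "(\<Sum>(j, k)\<in>F. norm (c' (j, k)) * r' ^ (j + k)) \<le> t * B" .
qed

lemma dps_norm_le_radius:
  assumes "dps_norm_le r c B" "0 \<le> r'" "r' \<le> r"
  shows "dps_norm_le r' c B"
proof -
  have "norm (c (j, k)) * r' ^ (j + k) \<le> 1 * (norm (c (j, k)) * r ^ (j + k))" for j k
    using assms by (auto intro!: mult_left_mono power_mono)
  from dps_norm_le_comparison[OF assms(1,2) this] show ?thesis by simp
qed

text \<open>Every term has positive degree, so shrinking the radius by \<open>t\<close> gains at least one factor \<open>t\<close>. This
  makes the inner functions of a composition small.\<close>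

lemma dps_norm_le_scale:
  assumes "dps_norm_le r c B" "c (0, 0) = 0" "0 \<le> t" "t \<le> 1"
  shows "dps_norm_le (t * r) c (t * B)"
proof (rule dps_norm_le_comparison[OF assms(1) _ _ assms(3)])
  show "0 \<le> t * r" using assms by (simp add: dps_norm_le_def)
  fix j k
  show "norm (c (j, k)) * (t * r) ^ (j + k) \<le> t * (norm (c (j, k)) * r ^ (j + k))"
  proof (cases "j + k")
    case 0
    then show ?thesis using assms by simp
  next
    case (Suc n)
    have "t ^ (j + k) \<le> t"
      using assms(3,4) by (simp add: Suc mult_left_le power_le_one)
    then have "norm (c (j, k)) * r ^ (j + k) * t ^ (j + k) \<le> norm (c (j, k)) * r ^ (j + k) * t"
      using assms(1) by (intro mult_left_mono) (auto simp: dps_norm_le_def)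
    then show ?thesis by (simp add: power_mult_distrib mult_ac)
  qed
qed

lemma dps_term_le:
  assumes "norm x \<le> r" "norm z \<le> r"
  shows "norm (c * x ^ j * z ^ k :: 'a::real_normed_field) \<le> norm c * r ^ (j + k)"
proof -
  have "norm x ^ j * norm z ^ k \<le> r ^ j * r ^ k"
    using assms order_trans[OF norm_ge_zero assms(1)] by (intro mult_mono power_mono) auto
  then show ?thesis
    by (simp add: norm_mult norm_power power_add mult.assoc mult_left_mono)
qed

lemma dps_abs_summable:
  fixes c :: "nat \<times> nat \<Rightarrow> 'a::{real_normed_field,banach}"
  assumes "dps_norm_le r c B" "norm x \<le> r" "norm z \<le> r"
  shows "(\<lambda>n. norm (case n of (j, k) \<Rightarrow> c (j, k) * x ^ j * z ^ k)) summable_on UNIV"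
proof (rule Infinite_Sum.abs_summable_on_comparison_test')
  show "(\<lambda>(j, k). norm (c (j, k)) * r ^ (j + k)) summable_on UNIV"
    using assms(1) by (simp add: dps_norm_le_def)
qed (use assms dps_term_le in \<open>auto\<close>)

lemma dps_eval_has_sum:
  assumes "dps_norm_le r c B" "norm x \<le> r" "norm z \<le> r"
  shows "((\<lambda>(j, k). c (j, k) * x ^ j * z ^ k) has_sum dps_eval c x z) UNIV"
  unfolding dps_eval_def
  by (rule has_sum_infsum) (rule abs_summable_summable[OF dps_abs_summable[OF assms]])

lemma norm_dps_eval_le:
  assumes "dps_norm_le r c B" "norm x \<le> r" "norm z \<le> r"
  shows "norm (dps_eval c x z) \<le> B"
proof -
  have "norm (dps_eval c x z) \<le> (\<Sum>\<^sub>\<infinity>n. norm (case n of (j, k) \<Rightarrow> c (j, k) * x ^ j * z ^ k))"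
    unfolding dps_eval_def by (rule norm_infsum_bound[OF dps_abs_summable[OF assms]])
  also have "\<dots> \<le> (\<Sum>\<^sub>\<infinity>(j, k). norm (c (j, k)) * r ^ (j + k))"
    by (rule infsum_mono[OF dps_abs_summable[OF assms]])
       (use assms(1) dps_term_le[OF assms(2,3)] in \<open>auto simp: dps_norm_le_def\<close>)
  finally have "norm (dps_eval c x z) \<le> (\<Sum>\<^sub>\<infinity>(j, k). norm (c (j, k)) * r ^ (j + k))" .
  with assms(1) show ?thesis by (simp add: dps_norm_le_def)
qed

lemma has_dpsI:
  assumes "dps_norm_le r c B" "0 < r"
    and "\<And>x z. norm x < r \<Longrightarrow> norm z < r \<Longrightarrow> f (x, z) = dps_eval c x z"
  shows "has_dps f c"
  unfolding has_dps_def
proof (intro exI[of _ r] conjI allI impI)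
  fix x z :: 'a assume *: "norm x < r" "norm z < r"
  show "((\<lambda>(j, k). c (j, k) * x ^ j * z ^ k) has_sum f (x, z)) UNIV"
    unfolding assms(3)[OF *] by (rule dps_eval_has_sum[OF assms(1)]) (use * in auto)
qed fact

text \<open>Outside a finite set, a single term is the difference of two partial sums that are close to the
  limit.\<close>

lemma summable_on_imp_bounded:
  fixes f :: "'i \<Rightarrow> 'a::real_normed_vector"
  assumes "f summable_on A"
  obtains M where "\<And>i. i \<in> A \<Longrightarrow> norm (f i) \<le> M"
proof -
  obtain S where S: "(f has_sum S) A" using assms by (auto simp: summable_on_def)
  then have "\<forall>\<^sub>F F in finite_subsets_at_top A. dist (sum f F) S < 1"
    unfolding has_sum_def by (rule tendstoD) simp
  then obtain F0 where F0: "finite F0" "F0 \<subseteq> A"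
    and d: "\<And>F. finite F \<Longrightarrow> F0 \<subseteq> F \<Longrightarrow> F \<subseteq> A \<Longrightarrow> dist (sum f F) S < 1"
    unfolding eventually_finite_subsets_at_top by (elim exE conjE) simp
  have "norm (f i) \<le> 2 + (\<Sum>i\<in>F0. norm (f i))" if i: "i \<in> A" for i
  proof (cases "i \<in> F0")
    case True
    then have "norm (f i) \<le> (\<Sum>i\<in>F0. norm (f i))"
      using F0 by (intro member_le_sum) auto
    then show ?thesis by simp
  next
    case False
    have "dist (sum f (insert i F0)) S < 1" "dist (sum f F0) S < 1"
      using F0 i by (auto intro!: d)
    moreover have "f i = (sum f (insert i F0) - S) - (sum f F0 - S)"
      using False F0 by simp
    ultimately have "norm (f i) < 2"
      using norm_triangle_ineq4[of "sum f (insert i F0) - S" "sum f F0 - S"]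
      by (simp add: dist_norm)
    then show ?thesis using sum_nonneg[of F0 "\<lambda>i. norm (f i)"] by simp
  qed
  then show ?thesis using that by blast
qed

lemma abs_summable_times:
  fixes \<alpha> :: "'i \<Rightarrow> 'a::{real_normed_div_algebra,banach}" and \<beta> :: "'j \<Rightarrow> 'a"
  assumes "(\<lambda>i. norm (\<alpha> i)) summable_on A" "(\<lambda>i. norm (\<beta> i)) summable_on B"
  shows "(\<lambda>p. norm (case p of (i, j) \<Rightarrow> \<alpha> i * \<beta> j)) summable_on A \<times> B"
proof -
  have "(\<lambda>(i, j). norm (\<alpha> i) * norm (\<beta> j)) summable_on A \<times> B"
  proof (rule summable_on_SigmaI)
    fix i
    show "((\<lambda>y. case (i, y) of (i, j) \<Rightarrow> norm (\<alpha> i) * norm (\<beta> j)) has_sum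
        (norm (\<alpha> i) * infsum (\<lambda>j. norm (\<beta> j)) B)) B"
      using has_sum_cmult_right[OF has_sum_infsum[OF assms(2)]] by simp
    show "(\<lambda>i. norm (\<alpha> i) * infsum (\<lambda>j. norm (\<beta> j)) B) summable_on A"
      by (rule summable_on_cmult_left[OF assms(1)])
  qed auto
  then show ?thesis by (simp add: case_prod_unfold norm_mult)
qed

lemma geometric_summable_on:
  assumes "0 \<le> (q::real)" "q < 1"
  shows "(\<lambda>(j, k). q ^ (j + k) :: real) summable_on (UNIV :: (nat \<times> nat) set)"
proof -
  have 1: "(\<lambda>j. norm (q ^ j)) summable_on (UNIV :: nat set)"
    using assms by (intro norm_summable_imp_summable_on) (auto intro!: summable_geometric)
  show ?thesis
    using abs_summable_summable[OF abs_summable_times[OF 1 1]] by (simp add: power_add)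
qed

lemma dps_norm_le_geometric:
  assumes "\<And>j k. norm (c (j, k)) \<le> M * R ^ (j + k)" "0 \<le> r" "0 \<le> R" "r * R < 1"
  shows "\<exists>B. dps_norm_le r c B"
proof -
  have M: "M \<ge> 0" using order_trans[OF norm_ge_zero assms(1)[of 0 0]] by simp
  have "(\<lambda>n. norm ((\<lambda>(j, k). norm (c (j, k)) * r ^ (j + k)) n)) summable_on UNIV"
  proof (rule Infinite_Sum.abs_summable_on_comparison_test')
    show "(\<lambda>n. M * (\<lambda>(j, k). (r * R) ^ (j + k)) n) summable_on UNIV"
      by (intro summable_on_cmult_right geometric_summable_on) (use assms in auto)
    fix n :: "nat \<times> nat"
    obtain j k where n: "n = (j, k)" by force
    have "norm (c (j, k)) * r ^ (j + k) \<le> M * R ^ (j + k) * r ^ (j + k)"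
      using assms by (intro mult_right_mono) auto
    then show "norm ((\<lambda>(j, k). norm (c (j, k)) * r ^ (j + k)) n) \<le> M * (\<lambda>(j, k). (r * R) ^ (j + k)) n"
      using assms by (simp add: n power_mult_distrib mult_ac)
  qed
  then have "(\<lambda>(j, k). norm (c (j, k)) * r ^ (j + k)) summable_on UNIV"
    by (rule abs_summable_summable)
  then show ?thesis using assms(2) by (auto simp: dps_norm_le_def)
qed

text \<open>The terms are bounded at one point with equal positive coordinates; a geometric series gives
  absolute convergence at half of that radius.\<close>

lemma has_dpsE:
  assumes "has_dps f c"
  obtains r B where "0 < r" "dps_norm_le r c B"
    "\<And>x z. norm x \<le> r \<Longrightarrow> norm z \<le> r \<Longrightarrow> f (x, z) = dps_eval c x z"
proof -
  obtain r where r: "r > 0" and f: "\<And>x z. norm x < r \<Longrightarrow> norm z < r \<Longrightarrow>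
        ((\<lambda>(j, k). c (j, k) * x ^ j * z ^ k) has_sum f (x, z)) UNIV"
    using assms unfolding has_dps_def by blast
  define \<rho> where "\<rho> = r / 2"
  have \<rho>: "0 < \<rho>" "\<rho> < r" using r by (auto simp: \<rho>_def)
  have sm: "(\<lambda>(j, k). c (j, k) * of_real \<rho> ^ j * of_real \<rho> ^ k) summable_on UNIV"
    using f[of "of_real \<rho>" "of_real \<rho>"] \<rho> by (auto simp: summable_on_def)
  obtain M where M: "\<And>n. n \<in> UNIV \<Longrightarrow> norm (case n of (j, k) \<Rightarrow> c (j, k) * of_real \<rho> ^ j * of_real \<rho> ^ k) \<le> M"
    by (rule summable_on_imp_bounded[OF sm]) (rule that)
  have "norm (c (j, k)) \<le> M * (1 / \<rho>) ^ (j + k)" for j k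
    using M[of "(j, k)"] \<rho> by (simp add: norm_mult norm_power power_add field_simps)
  then obtain B where B: "dps_norm_le (\<rho> / 2) c B"
    using dps_norm_le_geometric[of c M "1 / \<rho>" "\<rho> / 2"] \<rho> by auto
  show ?thesis
  proof (rule that[OF _ B])
    fix x z :: 'a assume *: "norm x \<le> \<rho> / 2" "norm z \<le> \<rho> / 2"
    then have "norm x < r" "norm z < r" using \<rho> by auto
    then show "f (x, z) = dps_eval c x z"
      by (rule has_sum_unique[OF f dps_eval_has_sum[OF B *]])
  qed (use \<rho> in auto)
qed

definition cauchy2 :: "(nat \<times> nat \<Rightarrow> 'a) \<Rightarrow> (nat \<times> nat \<Rightarrow> 'a) \<Rightarrow> nat \<times> nat \<Rightarrow> 'a::comm_semiring_1" where
  "cauchy2 a b = (\<lambda>(n, m). \<Sum>(i, l)\<in>{..n} \<times> {..m}. a (i, l) * b (n - i, m - l))"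

text \<open>The product of the two sums is a sum over pairs of exponents, which is regrouped by the total
  exponent.\<close>

lemma has_sum_cauchy2:
  fixes \<alpha> \<beta> :: "nat \<times> nat \<Rightarrow> 'a::{real_normed_field,banach}"
  assumes "(\<lambda>i. norm (\<alpha> i)) summable_on UNIV" "(\<lambda>i. norm (\<beta> i)) summable_on UNIV"
  shows "(cauchy2 \<alpha> \<beta> has_sum (infsum \<alpha> UNIV * infsum \<beta> UNIV)) UNIV"
proof -
  have sm: "(\<lambda>(p, q). \<alpha> p * \<beta> q) summable_on UNIV \<times> UNIV"
    by (rule abs_summable_summable[OF abs_summable_times[OF assms]])
  have 1: "((\<lambda>(p, q). \<alpha> p * \<beta> q) has_sum (infsum \<alpha> UNIV * infsum \<beta> UNIV)) (UNIV \<times> UNIV)"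
  proof (rule has_sum_SigmaI[OF _ _ sm])
    fix p
    show "((\<lambda>y. case (p, y) of (p, q) \<Rightarrow> \<alpha> p * \<beta> q) has_sum (\<alpha> p * infsum \<beta> UNIV)) UNIV"
      using has_sum_cmult_right[OF has_sum_infsum[OF abs_summable_summable[OF assms(2)]]] by simp
    show "((\<lambda>p. \<alpha> p * infsum \<beta> UNIV) has_sum infsum \<alpha> UNIV * infsum \<beta> UNIV) UNIV"
      by (rule has_sum_cmult_left[OF has_sum_infsum[OF abs_summable_summable[OF assms(1)]]])
  qed
  define S :: "((nat \<times> nat) \<times> (nat \<times> nat)) set"
    where "S = Sigma UNIV (\<lambda>(n, m). {..n} \<times> {..m})"
  have "bij_betw (\<lambda>((n, m), (i, l)). ((i, l), (n - i, m - l))) S (UNIV \<times> UNIV)"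
    by (rule bij_betwI[where g = "\<lambda>((i, l), (i', l')). ((i + i', l + l'), (i, l))"])
       (auto simp: S_def)
  from has_sum_reindex_bij_betw[OF this, of "\<lambda>(p, q). \<alpha> p * \<beta> q"] 1
  have "((\<lambda>((n, m), (i, l)). \<alpha> (i, l) * \<beta> (n - i, m - l)) has_sum
      (infsum \<alpha> UNIV * infsum \<beta> UNIV)) S"
    by (simp add: case_prod_unfold)
  then show ?thesis
    unfolding S_def
    by (rule has_sum_SigmaD) (auto simp: cauchy2_def case_prod_unfold intro!: has_sum_finiteI)
qed

lemma cauchy2_monom:
  "cauchy2 (\<lambda>(j, k). a (j, k) * x ^ j * z ^ k) (\<lambda>(j, k). b (j, k) * x ^ j * z ^ k)
     = (\<lambda>(j, k). cauchy2 a b (j, k) * x ^ j * z ^ k)"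
proof -
  have "a (i, l) * x ^ i * z ^ l * (b (n - i, m - l) * x ^ (n - i) * z ^ (m - l))
      = a (i, l) * b (n - i, m - l) * x ^ n * z ^ m" if "i \<le> n" "l \<le> m" for i l n m
  proof -
    have "x ^ i * x ^ (n - i) = x ^ n" "z ^ l * z ^ (m - l) = z ^ m"
      using that by (simp_all flip: power_add)
    moreover have "a (i, l) * x ^ i * z ^ l * (b (n - i, m - l) * x ^ (n - i) * z ^ (m - l))
        = a (i, l) * b (n - i, m - l) * (x ^ i * x ^ (n - i)) * (z ^ l * z ^ (m - l))"
      by (simp add: mult_ac)
    ultimately show ?thesis by simp
  qed
  then show ?thesis
    by (auto simp: cauchy2_def fun_eq_iff sum_distrib_right intro!: sum.cong)
qed

lemma dps_eval_cauchy2: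
  assumes "dps_norm_le r a A" "dps_norm_le r b B" "norm x \<le> r" "norm z \<le> r"
  shows "dps_eval (cauchy2 a b) x z = dps_eval a x z * dps_eval b x z"
  using has_sum_cauchy2[OF dps_abs_summable[OF assms(1,3,4)] dps_abs_summable[OF assms(2,3,4)]]
  unfolding cauchy2_monom dps_eval_def by (rule infsumI)

lemma dps_norm_le_cauchy2:
  fixes a b :: "nat \<times> nat \<Rightarrow> 'a::{real_normed_field,banach}"
  assumes "dps_norm_le r a A" "dps_norm_le r b B"
  shows "dps_norm_le r (cauchy2 a b) (A * B)"
proof (rule dps_norm_leI)
  show r: "0 \<le> r" using assms by (simp add: dps_norm_le_def)
  define a' b' where "a' = (\<lambda>n. norm (a n))" and "b' = (\<lambda>n. norm (b n))"
  have A: "dps_norm_le r a' A" and B: "dps_norm_le r b' B"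
    using assms by (auto simp: dps_norm_le_def a'_def b'_def)
  have ev: "dps_eval a' r r \<le> A" "dps_eval b' r r \<le> B" "0 \<le> dps_eval a' r r" "0 \<le> dps_eval b' r r"
    using A B r by (auto simp: dps_norm_le_def dps_eval_def a'_def b'_def mult.assoc power_add
        case_prod_unfold intro!: infsum_nonneg)
  have n: "norm r \<le> r" using r by simp
  note hs = has_sum_cauchy2[OF dps_abs_summable[OF A n n] dps_abs_summable[OF B n n], unfolded cauchy2_monom, folded dps_eval_def]
  fix F :: "(nat \<times> nat) set" assume F: "finite F"
  have "(\<Sum>(j, k)\<in>F. norm (cauchy2 a b (j, k)) * r ^ (j + k))
     \<le> (\<Sum>(j, k)\<in>F. cauchy2 a' b' (j, k) * r ^ j * r ^ k)"
  proof (rule sum_mono, clarify)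
    fix j k
    have "norm (cauchy2 a b (j, k)) \<le> cauchy2 a' b' (j, k)"
      unfolding cauchy2_def a'_def b'_def prod.case
      by (rule order_trans[OF norm_sum]) (simp add: norm_mult case_prod_unfold)
    then show "norm (cauchy2 a b (j, k)) * r ^ (j + k) \<le> cauchy2 a' b' (j, k) * r ^ j * r ^ k"
      using r by (simp add: power_add mult.assoc mult_right_mono)
  qed
  also have "\<dots> \<le> dps_eval a' r r * dps_eval b' r r"
    using hs F r by (intro finite_sum_le_has_sum[OF hs])
      (auto simp: cauchy2_def a'_def b'_def case_prod_unfold
        intro!: mult_nonneg_nonneg zero_le_power sum_nonneg)
  also have "\<dots> \<le> A * B"
    using ev by (intro mult_mono) auto
  finally show "(\<Sum>(j, k)\<in>F. norm (cauchy2 a b (j, k)) * r ^ (j + k)) \<le> A * B" .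
qed

lemma has_dps_mult:
  assumes "has_dps f a" "has_dps g b"
  shows "has_dps (\<lambda>y. f y * g y) (cauchy2 a b)"
proof -
  obtain r A where f: "0 < r" "dps_norm_le r a A"
      "\<And>x z. norm x \<le> r \<Longrightarrow> norm z \<le> r \<Longrightarrow> f (x, z) = dps_eval a x z"
    by (rule has_dpsE[OF assms(1)]) (rule that)
  obtain s B where g: "0 < s" "dps_norm_le s b B"
      "\<And>x z. norm x \<le> s \<Longrightarrow> norm z \<le> s \<Longrightarrow> g (x, z) = dps_eval b x z"
    by (rule has_dpsE[OF assms(2)]) (rule that)
  define t where "t = min r s"
  have t: "0 < t" "t \<le> r" "t \<le> s" using f g by (auto simp: t_def)
  have A: "dps_norm_le t a A" and B: "dps_norm_le t b B"
    using t f g by (auto intro: dps_norm_le_radius)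
  show ?thesis
    by (rule has_dpsI[OF dps_norm_le_cauchy2[OF A B] t(1)])
       (use f(3) g(3) t in \<open>auto simp: dps_eval_cauchy2[OF A B]\<close>)
qed

text \<open>Compositions and blow-ups are sums of families of power series. Summability of the norm bounds
  makes the double family absolutely summable, and the two summations can be interchanged.\<close>

lemma dps_family:
  fixes E :: "'i \<Rightarrow> nat \<times> nat \<Rightarrow> 'a::{real_normed_field,banach}"
  assumes E: "\<And>i. dps_norm_le r (E i) (B i)" and B: "B summable_on UNIV" and r: "0 < r"
  shows "dps_norm_le r (\<lambda>n. \<Sum>\<^sub>\<infinity>i. E i n) (infsum B UNIV)"
    and "\<And>x z. norm x \<le> r \<Longrightarrow> norm z \<le> r \<Longrightarrow>
       ((\<lambda>i. dps_eval (E i) x z) has_sum dps_eval (\<lambda>n. \<Sum>\<^sub>\<infinity>i. E i n) x z) UNIV"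
proof -
  define S where "S i = (\<Sum>\<^sub>\<infinity>(j, k). norm (E i (j, k)) * r ^ (j + k))" for i
  have S: "0 \<le> S i" "S i \<le> B i"
    "((\<lambda>(j, k). norm (E i (j, k)) * r ^ (j + k)) has_sum S i) UNIV" for i
    using E[of i] r by (auto simp: dps_norm_le_def S_def intro!: infsum_nonneg)
  have Ssum: "S summable_on UNIV"
    using Infinite_Sum.abs_summable_on_comparison_test'[OF B, of S] S by auto
  define g where "g = (\<lambda>(i, (j, k)). norm (E i (j, k)) * r ^ (j + k))"
  have g: "g summable_on UNIV \<times> UNIV"
    unfolding g_def by (rule summable_on_SigmaI[OF _ Ssum]) (use S r in auto)
  have gS: "(g has_sum infsum S UNIV) (UNIV \<times> UNIV)"
    by (rule has_sum_SigmaI[OF _ has_sum_infsum[OF Ssum] g]) (use S in \<open>auto simp: g_def\<close>)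
  have gsw: "((\<lambda>(n, i). g (i, n)) has_sum infsum S UNIV) (UNIV \<times> UNIV)"
    using gS by (subst (asm) has_sum_swap)
  have row: "(\<lambda>i. norm (E i n)) summable_on UNIV" for n
  proof -
    obtain j k where n: "n = (j, k)" by force
    have "(\<lambda>i. norm (E i (j, k)) * r ^ (j + k)) summable_on UNIV"
      using summable_on_SigmaD1[of "\<lambda>n i. g (i, n)" UNIV "\<lambda>_. UNIV" "(j, k)"]
        has_sum_imp_summable[OF gsw] by (simp add: g_def)
    then have "(\<lambda>i. norm (E i (j, k)) * r ^ (j + k) * inverse (r ^ (j + k))) summable_on UNIV"
      by (rule summable_on_cmult_left)
    then show ?thesis using r by (simp add: n mult.assoc)
  qed
  have col: "((\<lambda>(j, k). (\<Sum>\<^sub>\<infinity>i. norm (E i (j, k))) * r ^ (j + k)) has_sum infsum S UNIV) UNIV"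
  proof (rule has_sum_SigmaD[OF gsw])
    fix n :: "nat \<times> nat"
    obtain j k where n: "n = (j, k)" by force
    show "((\<lambda>i. case (n, i) of (n, i) \<Rightarrow> g (i, n)) has_sum
        (case n of (j, k) \<Rightarrow> (\<Sum>\<^sub>\<infinity>i. norm (E i (j, k))) * r ^ (j + k))) UNIV"
      using has_sum_cmult_left[OF has_sum_infsum[OF row]] by (simp add: n g_def)
  qed
  show "dps_norm_le r (\<lambda>n. \<Sum>\<^sub>\<infinity>i. E i n) (infsum B UNIV)"
  proof (rule dps_norm_leI)
    fix F :: "(nat \<times> nat) set" assume F: "finite F"
    have "(\<Sum>(j, k)\<in>F. norm (\<Sum>\<^sub>\<infinity>i. E i (j, k)) * r ^ (j + k))
       \<le> (\<Sum>(j, k)\<in>F. (\<Sum>\<^sub>\<infinity>i. norm (E i (j, k))) * r ^ (j + k))"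
      using r norm_infsum_bound[OF row] by (intro sum_mono) (auto intro!: mult_right_mono)
    also have "\<dots> \<le> infsum S UNIV"
      by (rule finite_sum_le_has_sum[OF col F]) (use r in \<open>auto intro!: mult_nonneg_nonneg infsum_nonneg\<close>)
    also have "\<dots> \<le> infsum B UNIV"
      by (rule infsum_mono[OF Ssum B]) (use S in auto)
    finally show "(\<Sum>(j, k)\<in>F. norm (\<Sum>\<^sub>\<infinity>i. E i (j, k)) * r ^ (j + k)) \<le> infsum B UNIV" .
  qed (use r in auto)
  fix x z :: 'a assume xz: "norm x \<le> r" "norm z \<le> r"
  define h where "h = (\<lambda>(i, (j, k)). E i (j, k) * x ^ j * z ^ k)"
  have "(\<lambda>p. norm (h p)) summable_on UNIV \<times> UNIV"
    by (rule Infinite_Sum.abs_summable_on_comparison_test'[OF g]) (use dps_term_le[OF xz] in \<open>auto simp: h_def g_def\<close>)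
  then have "h summable_on UNIV \<times> UNIV" by (rule abs_summable_summable)
  then obtain T where T: "(h has_sum T) (UNIV \<times> UNIV)" by (auto simp: summable_on_def)
  have 1: "((\<lambda>i. dps_eval (E i) x z) has_sum T) UNIV"
    by (rule has_sum_SigmaD[OF T]) (use dps_eval_has_sum[OF E xz] in \<open>auto simp: h_def\<close>)
  have 2: "((\<lambda>(n, i). h (i, n)) has_sum T) (UNIV \<times> UNIV)"
    using T by (subst (asm) has_sum_swap)
  have "((\<lambda>(j, k). (\<Sum>\<^sub>\<infinity>i. E i (j, k)) * x ^ j * z ^ k) has_sum T) UNIV"
  proof (rule has_sum_SigmaD[OF 2])
    fix n :: "nat \<times> nat"
    obtain j k where n: "n = (j, k)" by force
    show "((\<lambda>i. case (n, i) of (n, i) \<Rightarrow> h (i, n)) has_sum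
        (case n of (j, k) \<Rightarrow> (\<Sum>\<^sub>\<infinity>i. E i (j, k)) * x ^ j * z ^ k)) UNIV"
      using has_sum_cmult_left[OF has_sum_cmult_left[OF has_sum_infsum[OF abs_summable_summable[OF row]]]]
      by (simp add: n h_def)
  qed
  then have "dps_eval (\<lambda>n. \<Sum>\<^sub>\<infinity>i. E i n) x z = T"
    unfolding dps_eval_def by (rule infsumI)
  with 1 show "((\<lambda>i. dps_eval (E i) x z) has_sum dps_eval (\<lambda>n. \<Sum>\<^sub>\<infinity>i. E i n) x z) UNIV"
    by simp
qed

text \<open>Square neighborhoods fit the two-variable power series better than balls of the product metric.\<close>

lemma eventually_nhds_00:
  fixes P :: "'a::real_normed_vector \<times> 'b::real_normed_vector \<Rightarrow> bool"
  shows "(\<forall>\<^sub>F y in nhds (0, 0). P y) \<longleftrightarrow>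
    (\<exists>r>0. \<forall>x z. norm x < r \<longrightarrow> norm z < r \<longrightarrow> P (x, z))"
proof
  assume "\<forall>\<^sub>F y in nhds (0, 0). P y"
  then obtain d where d: "d > 0" "\<And>y. dist y (0, 0) < d \<Longrightarrow> P y"
    unfolding eventually_nhds_metric by blast
  have "P (x, z)" if "norm x < d / 2" "norm z < d / 2" for x z
  proof (rule d(2))
    have "norm (x, z) \<le> norm x + norm z" by (rule norm_Pair_le)
    then show "dist (x, z) (0, 0) < d" using that by (simp add: dist_norm)
  qed
  then show "\<exists>r>0. \<forall>x z. norm x < r \<longrightarrow> norm z < r \<longrightarrow> P (x, z)"
    using d(1) by (intro exI[of _ "d / 2"]) auto
next
  assume "\<exists>r>0. \<forall>x z. norm x < r \<longrightarrow> norm z < r \<longrightarrow> P (x, z)"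
  then obtain r where r: "r > 0" "\<And>x z. norm x < r \<Longrightarrow> norm z < r \<Longrightarrow> P (x, z)" by blast
  have "P y" if "dist y (0, 0) < r" for y
  proof -
    obtain x z where y: "y = (x, z)" by force
    have "norm x \<le> norm (x, z)" "norm z \<le> norm (x, z)"
      using norm_fst_le[of x z] norm_snd_le[of z x] by auto
    with that show ?thesis using r(2)[of x z] by (simp add: y dist_norm)
  qed
  then show "\<forall>\<^sub>F y in nhds (0, 0). P y"
    unfolding eventually_nhds_metric using r(1) by blast
qed

lemma has_dps_cong:
  assumes "\<forall>\<^sub>F y in nhds (0, 0). f y = g y" "has_dps f c"
  shows "has_dps g c"
proof -
  obtain r where r: "r > 0" "\<And>x z. norm x < r \<Longrightarrow> norm z < r \<Longrightarrow> f (x, z) = g (x, z)"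
    using assms(1) unfolding eventually_nhds_00 by blast
  obtain s B where s: "0 < s" "dps_norm_le s c B"
      "\<And>x z. norm x \<le> s \<Longrightarrow> norm z \<le> s \<Longrightarrow> f (x, z) = dps_eval c x z"
    by (rule has_dpsE[OF assms(2)]) (rule that)
  have "dps_norm_le (min r s) c B"
    by (rule dps_norm_le_radius[OF s(2)]) (use r s in auto)
  then show ?thesis
    by (rule has_dpsI) (use r s in \<open>auto simp flip: r(2) s(3)\<close>)
qed

lemma dps_eval_0: "dps_eval c 0 0 = c (0, 0)"
proof -
  have "((\<lambda>(j, k). c (j, k) * 0 ^ j * 0 ^ k) has_sum c (0, 0)) UNIV"
    by (rule has_sum_finite_neutralI[of "{(0, 0)}"]) (auto simp: zero_power)
  then show ?thesis unfolding dps_eval_def by (rule infsumI)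
qed

lemma has_dps_at_0: "has_dps f c \<Longrightarrow> f (0, 0) = c (0, 0)"
  by (elim has_dpsE) (simp add: dps_eval_0)

lemma dps_coeff_le:
  assumes "dps_norm_le r c B" "0 < r"
  shows "norm (c (j, k)) \<le> B * (1 / r) ^ (j + k)"
  using dps_norm_le_sum[OF assms(1), of "{(j, k)}"] assms(2)
  by (simp add: field_simps)

lemma has_dps_geometricI:
  assumes "\<And>j k. norm (c (j, k)) \<le> M * R ^ (j + k)" "0 \<le> R"
    and "0 < r" "\<And>x z. norm x < r \<Longrightarrow> norm z < r \<Longrightarrow> f (x, z) = dps_eval c x z"
  shows "has_dps f c"
proof -
  define t where "t = min r (1 / (2 * (R + 1)))"
  have t: "0 < t" "t \<le> r" "t * R < 1"
  proof -
    have "t * R \<le> 1 / (2 * (R + 1)) * R"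
      using assms(2) by (intro mult_right_mono) (auto simp: t_def)
    also have "\<dots> < 1" using assms(2) by (simp add: divide_simps)
    finally show "t * R < 1" .
  qed (use assms in \<open>auto simp: t_def\<close>)
  then obtain B where "dps_norm_le t c B"
    using dps_norm_le_geometric[OF assms(1), of t] assms(2) by auto
  then show ?thesis
    by (rule has_dpsI) (use t assms(4) in auto)
qed

lemma has_dps_add:
  assumes "has_dps f a" "has_dps g b"
  shows "has_dps (\<lambda>y. f y + g y) (\<lambda>n. a n + b n)"
proof -
  obtain r A where f: "r > 0" "\<And>x z. norm x < r \<Longrightarrow> norm z < r \<Longrightarrow>
        ((\<lambda>(j, k). a (j, k) * x ^ j * z ^ k) has_sum f (x, z)) UNIV"
    using assms(1) unfolding has_dps_def by blast
  obtain s where g: "s > 0" "\<And>x z. norm x < s \<Longrightarrow> norm z < s \<Longrightarrow>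
        ((\<lambda>(j, k). b (j, k) * x ^ j * z ^ k) has_sum g (x, z)) UNIV"
    using assms(2) unfolding has_dps_def by blast
  show ?thesis
    unfolding has_dps_def
  proof (intro exI[of _ "min r s"] conjI allI impI)
    fix x z :: 'a assume "norm x < min r s" "norm z < min r s"
    then have "((\<lambda>n. (case n of (j, k) \<Rightarrow> a (j, k) * x ^ j * z ^ k) +
         (case n of (j, k) \<Rightarrow> b (j, k) * x ^ j * z ^ k)) has_sum f (x, z) + g (x, z)) UNIV"
      by (intro has_sum_add f g) auto
    then show "((\<lambda>(j, k). (a (j, k) + b (j, k)) * x ^ j * z ^ k) has_sum f (x, z) + g (x, z)) UNIV"
      by (simp add: case_prod_unfold algebra_simps)
  qed (use f g in auto)
qed

lemma eball_real: "0 < R \<Longrightarrow> \<exists>r>0. ereal r < R"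
  using ereal_dense2[of 0 R] by (auto simp: zero_ereal_def)

lemma has_dps_fst:
  fixes g :: "'a::{real_normed_field,banach} \<Rightarrow> 'a"
  assumes "g has_fps_expansion A"
  shows "has_dps (\<lambda>y. g (fst y)) (\<lambda>(j, k). if k = 0 then fps_nth A j else 0)"
proof -
  have "fps_conv_radius A > 0" and ev: "\<forall>\<^sub>F x in nhds 0. eval_fps A x = g x"
    using assms by (auto simp: has_fps_expansion_def)
  then obtain r where r: "r > 0" "ereal r < fps_conv_radius A"
    using eball_real by blast
  obtain s where s: "s > 0" "\<And>x. dist x 0 < s \<Longrightarrow> eval_fps A x = g x"
    using ev unfolding eventually_nhds_metric by blast
  show ?thesis
    unfolding has_dps_def
  proof (intro exI[of _ "min r s"] conjI allI impI)
    fix x z :: 'a assume x: "norm x < min r s"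
    then have "ereal (norm x) < ereal r" by simp
    then have "ereal (norm x) < fps_conv_radius A" using r(2) by (rule less_trans)
    then have "summable (\<lambda>n. norm (fps_nth A n * x ^ n))" "(\<lambda>n. fps_nth A n * x ^ n) sums eval_fps A x"
      by (auto intro: norm_summable_fps sums_eval_fps)
    then have "((\<lambda>n. fps_nth A n * x ^ n) has_sum eval_fps A x) UNIV"
      by (rule norm_summable_imp_has_sum)
    moreover have "eval_fps A x = g x" using s x by (auto simp: dist_norm)
    moreover have "bij_betw (\<lambda>n. (n, 0)) UNIV (UNIV \<times> {0 :: nat})"
      by (rule bij_betwI[where g = fst]) auto
    ultimately have "((\<lambda>(j, k). fps_nth A j * x ^ j) has_sum g x) (UNIV \<times> {0 :: nat})"
      by (subst has_sum_reindex_bij_betw[symmetric]) auto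
    also have "?this \<longleftrightarrow> ((\<lambda>(j, k). (case (j, k) of (j, k) \<Rightarrow> if k = 0 then fps_nth A j else 0)
        * x ^ j * z ^ k) has_sum g (fst (x, z))) UNIV"
      unfolding fst_conv by (rule has_sum_cong_neutral) (auto split: if_splits)
    finally show "((\<lambda>(j, k). (case (j, k) of (j, k) \<Rightarrow> if k = 0 then fps_nth A j else 0)
        * x ^ j * z ^ k) has_sum g (fst (x, z))) UNIV" .
  qed (use r s in auto)
qed

lemma has_dps_swap:
  assumes "has_dps f c"
  shows "has_dps (\<lambda>(x, z). f (z, x)) (\<lambda>(j, k). c (k, j))"
proof -
  obtain r where f: "r > 0" "\<And>x z. norm x < r \<Longrightarrow> norm z < r \<Longrightarrow>
        ((\<lambda>(j, k). c (j, k) * x ^ j * z ^ k) has_sum f (x, z)) UNIV"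
    using assms unfolding has_dps_def by blast
  show ?thesis
    unfolding has_dps_def
  proof (intro exI[of _ r] conjI allI impI)
    fix x z :: 'a assume *: "norm x < r" "norm z < r"
    have "((\<lambda>(j, k). c (j, k) * z ^ j * x ^ k) has_sum f (z, x)) (UNIV \<times> UNIV)"
      using f(2)[of z x] * by simp
    then have "((\<lambda>(k, j). c (j, k) * z ^ j * x ^ k) has_sum f (z, x)) (UNIV \<times> UNIV)"
      by (subst (asm) has_sum_swap) simp
    then show "((\<lambda>(j, k). (case (j, k) of (j, k) \<Rightarrow> c (k, j)) * x ^ j * z ^ k)
        has_sum (case (x, z) of (x, z) \<Rightarrow> f (z, x))) UNIV"
      by (simp add: mult_ac)
  qed (use f in auto)
qed

lemma has_dps_snd:
  assumes "g has_fps_expansion A"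
  shows "has_dps (\<lambda>y. g (snd y)) (\<lambda>(j, k). if j = 0 then fps_nth A k else 0)"
proof -
  have 1: "(\<lambda>(x, z). g (fst (z, x))) = (\<lambda>y. g (snd y))"
    and 2: "(\<lambda>(j, k). case (k, j) of (j, k) \<Rightarrow> if k = 0 then fps_nth A j else 0)
      = (\<lambda>(j, k). if j = 0 then fps_nth A k else 0)"
    by auto
  from has_dps_swap[OF has_dps_fst[OF assms]] show ?thesis unfolding 1 2 .
qed

lemma has_dps_const: "has_dps (\<lambda>_. a) (\<lambda>(j, k). if k = 0 then fps_nth (fps_const a) j else 0)"
  using has_dps_fst[OF has_fps_expansion_const] .

lemma has_dps_X: "has_dps fst (\<lambda>(j, k). if k = 0 then fps_nth fps_X j else 0)"
  using has_dps_fst[OF has_fps_expansion_fps_X] by simp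

lemma has_dps_Z: "has_dps snd (\<lambda>(j, k). if j = 0 then fps_nth fps_X k else 0)"
  using has_dps_snd[OF has_fps_expansion_fps_X] by simp

section \<open>Analytic germs in one and two variables\<close>

definition analytic2 :: "('a \<times> 'a \<Rightarrow> 'a::{real_normed_field,banach}) \<Rightarrow> bool" where
  "analytic2 f \<longleftrightarrow> (\<exists>c. has_dps f c)"

definition analytic1 :: "('a \<Rightarrow> 'a::{real_normed_field,banach}) \<Rightarrow> bool" where
  "analytic1 g \<longleftrightarrow> (\<exists>A. g has_fps_expansion A)"

named_theorems analytic_intros

lemma analytic2_const [analytic_intros]: "analytic2 (\<lambda>_. a)"
  using has_dps_const unfolding analytic2_def by blast

lemma analytic2_fst [analytic_intros]: "analytic2 fst" and analytic2_snd [analytic_intros]: "analytic2 snd"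
  using has_dps_X has_dps_Z unfolding analytic2_def by blast+

lemma analytic2_fst' [analytic_intros]: "analytic1 g \<Longrightarrow> analytic2 (\<lambda>y. g (fst y))"
  and analytic2_snd' [analytic_intros]: "analytic1 g \<Longrightarrow> analytic2 (\<lambda>y. g (snd y))"
  using has_dps_fst has_dps_snd unfolding analytic2_def analytic1_def by blast+

lemma analytic2_add [analytic_intros]: "analytic2 f \<Longrightarrow> analytic2 g \<Longrightarrow> analytic2 (\<lambda>y. f y + g y)"
  using has_dps_add unfolding analytic2_def by blast

lemma analytic2_mult [analytic_intros]: "analytic2 f \<Longrightarrow> analytic2 g \<Longrightarrow> analytic2 (\<lambda>y. f y * g y)"
  using has_dps_mult unfolding analytic2_def by blast

lemma analytic2_uminus [analytic_intros]: "analytic2 f \<Longrightarrow> analytic2 (\<lambda>y. - f y)"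
  using analytic2_mult[OF analytic2_const[of "-1"], of f] by simp

lemma analytic2_diff [analytic_intros]: "analytic2 f \<Longrightarrow> analytic2 g \<Longrightarrow> analytic2 (\<lambda>y. f y - g y)"
  using analytic2_add[OF _ analytic2_uminus, of f g] by simp

lemma analytic2_power [analytic_intros]: "analytic2 f \<Longrightarrow> analytic2 (\<lambda>y. f y ^ n)"
  by (induction n) (auto intro: analytic_intros)

lemma analytic2_sum [analytic_intros]: "(\<And>i. i \<in> I \<Longrightarrow> analytic2 (f i)) \<Longrightarrow> analytic2 (\<lambda>y. \<Sum>i\<in>I. f i y)"
  by (induction I rule: infinite_finite_induct) (auto intro: analytic_intros)

primrec cauchy_power :: "(nat \<times> nat \<Rightarrow> 'a) \<Rightarrow> nat \<Rightarrow> nat \<times> nat \<Rightarrow> 'a::comm_semiring_1" where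
  "cauchy_power a 0 = (\<lambda>n. if n = (0, 0) then 1 else 0)"
| "cauchy_power a (Suc n) = cauchy2 a (cauchy_power a n)"

lemma dps_cauchy_power:
  fixes a :: "nat \<times> nat \<Rightarrow> 'a::{real_normed_field,banach}"
  assumes "dps_norm_le r a A"
  shows "dps_norm_le r (cauchy_power a n) (A ^ n)"
    and "norm x \<le> r \<Longrightarrow> norm z \<le> r \<Longrightarrow> dps_eval (cauchy_power a n) x z = dps_eval a x z ^ n"
proof -
  have r: "0 \<le> r" using assms by (simp add: dps_norm_le_def)
  show 1: "dps_norm_le r (cauchy_power a n) (A ^ n)" for n
  proof (induction n)
    case 0
    have "(\<Sum>(j, k)\<in>F. norm (cauchy_power a 0 (j, k)) * r ^ (j + k)) \<le> 1" if "finite F" for F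
    proof -
      have "(\<Sum>(j, k)\<in>F. norm (cauchy_power a 0 (j, k)) * r ^ (j + k))
         = (\<Sum>n\<in>F. if n = (0, 0) then 1 else 0)"
        by (rule sum.cong) (auto split: if_splits)
      also have "\<dots> \<le> 1" using that by simp
      finally show ?thesis .
    qed
    then show ?case using dps_norm_leI[OF r, of "cauchy_power a 0" 1] by simp
  qed (use dps_norm_le_cauchy2[OF assms] in auto)
  have 0: "dps_eval (\<lambda>n. if n = (0, 0) then 1 else 0) x z = 1" for x z :: 'a
  proof -
    have "((\<lambda>(j, k). (if (j, k) = (0, 0) then 1 else 0) * x ^ j * z ^ k) has_sum 1) UNIV"
      by (rule has_sum_finite_neutralI[of "{(0, 0)}"]) (auto split: if_splits)
    then show ?thesis unfolding dps_eval_def by (rule infsumI)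
  qed
  show "norm x \<le> r \<Longrightarrow> norm z \<le> r \<Longrightarrow> dps_eval (cauchy_power a n) x z = dps_eval a x z ^ n"
    by (induction n) (use dps_eval_cauchy2[OF assms 1] in \<open>auto simp: 0\<close>)
qed

lemma dps_scalar:
  fixes c :: "nat \<times> nat \<Rightarrow> 'a::{real_normed_field,banach}"
  assumes "dps_norm_le r c B"
  shows "dps_norm_le r (\<lambda>n. a * c n) (norm a * B)"
    and "dps_eval (\<lambda>n. a * c n) x z = a * dps_eval c x z"
proof -
  show "dps_norm_le r (\<lambda>n. a * c n) (norm a * B)"
    by (rule dps_norm_le_comparison[OF assms]) (use assms in \<open>auto simp: dps_norm_le_def norm_mult\<close>)
  show "dps_eval (\<lambda>n. a * c n) x z = a * dps_eval c x z"
    unfolding dps_eval_def by (subst infsum_cmult_right'[symmetric]) (simp add: case_prod_unfold mult.assoc)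
qed

text \<open>The inner functions vanish at the origin, so on a small polydisc their norms are at most the
  radius \<open>r\<close> of the outer series, and the family of the terms \<open>c_jk \<phi>^j \<psi>^k\<close> is dominated by the outer
  series at \<open>r\<close>.\<close>

lemma analytic2_compose:
  fixes f :: "'a \<times> 'a \<Rightarrow> 'a::{real_normed_field,banach}"
  assumes "analytic2 f" "analytic2 \<phi>" "analytic2 \<psi>" "\<phi> (0, 0) = 0" "\<psi> (0, 0) = 0"
  shows "analytic2 (\<lambda>y. f (\<phi> y, \<psi> y))"
proof -
  obtain c a b where c: "has_dps f c" and a: "has_dps \<phi> a" and b: "has_dps \<psi> b"
    using assms unfolding analytic2_def by blast
  have a0: "a (0, 0) = 0" and b0: "b (0, 0) = 0"
    using has_dps_at_0[OF a] has_dps_at_0[OF b] assms by auto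
  obtain r C where f: "0 < r" "dps_norm_le r c C"
      "\<And>x z. norm x \<le> r \<Longrightarrow> norm z \<le> r \<Longrightarrow> f (x, z) = dps_eval c x z"
    by (rule has_dpsE[OF c]) (rule that)
  obtain s1 A1 where g1: "0 < s1" "dps_norm_le s1 a A1"
      "\<And>x z. norm x \<le> s1 \<Longrightarrow> norm z \<le> s1 \<Longrightarrow> \<phi> (x, z) = dps_eval a x z"
    by (rule has_dpsE[OF a]) (rule that)
  obtain s2 A2 where g2: "0 < s2" "dps_norm_le s2 b A2"
      "\<And>x z. norm x \<le> s2 \<Longrightarrow> norm z \<le> s2 \<Longrightarrow> \<psi> (x, z) = dps_eval b x z"
    by (rule has_dpsE[OF b]) (rule that)
  define s where "s = min s1 s2"
  define A where "A = max (max A1 A2) 1"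
  have s: "s > 0" "dps_norm_le s a A" "dps_norm_le s b A"
    using g1(1) g2(1) dps_norm_le_mono[OF dps_norm_le_radius[OF g1(2), of s], of A]
      dps_norm_le_mono[OF dps_norm_le_radius[OF g2(2), of s], of A] by (auto simp: s_def A_def)
  define t where "t = min 1 (r / A)"
  have A: "A \<ge> 1" by (simp add: A_def)
  have "t * A \<le> (r / A) * A" using A by (intro mult_right_mono) (auto simp: t_def)
  then have t: "0 < t" "t \<le> 1" "t * A \<le> r" using f A by (auto simp: t_def)
  define \<rho> where "\<rho> = t * s"
  have \<rho>: "0 < \<rho>" "\<rho> \<le> s" using t s by (auto simp: \<rho>_def mult_le_cancel_right1)
  have na: "dps_norm_le \<rho> a r" and nb: "dps_norm_le \<rho> b r"
    using dps_norm_le_mono[OF dps_norm_le_scale[OF s(2) a0, of t] t(3)]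
      dps_norm_le_mono[OF dps_norm_le_scale[OF s(3) b0, of t] t(3)] t by (simp_all add: \<rho>_def)
  define E where "E = (\<lambda>(j, k) n. c (j, k) * cauchy2 (cauchy_power a j) (cauchy_power b k) n)"
  define B where "B = (\<lambda>(j, k). norm (c (j, k)) * r ^ (j + k))"
  have nE: "dps_norm_le \<rho> (E p) (B p)" for p
    using dps_scalar(1)[OF dps_norm_le_cauchy2[OF dps_cauchy_power(1)[OF na] dps_cauchy_power(1)[OF nb]]]
    by (cases p) (simp add: E_def B_def power_add)
  have Bs: "B summable_on UNIV" using f(2) by (simp add: B_def dps_norm_le_def)
  note fam = dps_family[OF nE Bs \<rho>(1)]
  have "has_dps (\<lambda>y. f (\<phi> y, \<psi> y)) (\<lambda>n. \<Sum>\<^sub>\<infinity>i. E i n)"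
  proof (rule has_dpsI[OF fam(1) \<rho>(1)])
    fix x z :: 'a assume "norm x < \<rho>" "norm z < \<rho>"
    then have xz: "norm x \<le> \<rho>" "norm z \<le> \<rho>" by auto
    have p: "\<phi> (x, z) = dps_eval a x z" "\<psi> (x, z) = dps_eval b x z"
      using xz \<rho> by (auto simp: s_def intro!: g1 g2)
    have pr: "norm (\<phi> (x, z)) \<le> r" "norm (\<psi> (x, z)) \<le> r"
      unfolding p using norm_dps_eval_le[OF na xz] norm_dps_eval_le[OF nb xz] by auto
    have "dps_eval (E (j, k)) x z = c (j, k) * \<phi> (x, z) ^ j * \<psi> (x, z) ^ k" for j k
      unfolding E_def prod.case p
      using dps_scalar(2)[OF dps_norm_le_cauchy2[OF dps_cauchy_power(1)[OF na] dps_cauchy_power(1)[OF nb]]]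
        dps_eval_cauchy2[OF dps_cauchy_power(1)[OF na] dps_cauchy_power(1)[OF nb] xz]
        dps_cauchy_power(2)[OF na xz] dps_cauchy_power(2)[OF nb xz]
      by (simp add: mult.assoc)
    then have "(\<lambda>i. dps_eval (E i) x z) = (\<lambda>(j, k). c (j, k) * \<phi> (x, z) ^ j * \<psi> (x, z) ^ k)"
      by (auto simp: fun_eq_iff)
    with fam(2)[OF xz] have "((\<lambda>(j, k). c (j, k) * \<phi> (x, z) ^ j * \<psi> (x, z) ^ k) has_sum
        dps_eval (\<lambda>n. \<Sum>\<^sub>\<infinity>i. E i n) x z) UNIV" by simp
    with dps_eval_has_sum[OF f(2) pr]
    show "f (\<phi> (x, z), \<psi> (x, z)) = dps_eval (\<lambda>n. \<Sum>\<^sub>\<infinity>i. E i n) x z"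
      unfolding f(3)[OF pr] by (rule has_sum_unique)
  qed
  then show ?thesis unfolding analytic2_def by blast
qed

text \<open>Composition of \<open>1 / (1 + x)\<close> with \<open>f / f(0, 0) - 1\<close>.\<close>

lemma analytic2_inverse:
  assumes "analytic2 f" "f (0, 0) \<noteq> 0"
  shows "analytic2 (\<lambda>y. inverse (f y))"
proof -
  define a where "a = f (0, 0)"
  define g :: "'a \<Rightarrow> 'a" where "g = (\<lambda>x. inverse (1 + x))"
  have "g has_fps_expansion inverse (1 + fps_X)"
    unfolding g_def by (intro fps_expansion_intros) auto
  then have g: "analytic2 (\<lambda>y. g (fst y))" unfolding analytic1_def by (intro analytic_intros) (auto simp: analytic1_def)
  have "analytic2 (\<lambda>y. g (fst (inverse a * f y - 1, 0 :: 'a)))"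
    by (rule analytic2_compose[OF g]) (use assms in \<open>auto intro!: analytic_intros simp: a_def\<close>)
  then have "analytic2 (\<lambda>y. inverse a * g (fst (inverse a * f y - 1, 0 :: 'a)))"
    by (intro analytic_intros)
  moreover have "(\<lambda>y. inverse a * g (fst (inverse a * f y - 1, 0 :: 'a))) = (\<lambda>y. inverse (f y))"
    using assms(2) by (auto simp: g_def a_def fun_eq_iff field_simps)
  ultimately show ?thesis by simp
qed

definition dps_slice :: "(nat \<times> nat \<Rightarrow> 'a) \<Rightarrow> nat \<Rightarrow> 'a fps" where
  "dps_slice c k = Abs_fps (\<lambda>j. c (j, k))"

text \<open>Summation over the first exponent turns a double power series into a power series in \<open>z\<close> whose
  coefficients are analytic in \<open>x\<close> and satisfy a Cauchy estimate that is uniform in \<open>x\<close>.\<close>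

lemma has_dps_slices:
  fixes f :: "'a \<times> 'a \<Rightarrow> 'a::{real_normed_field,banach}"
  assumes "has_dps f c"
  obtains r B where "r > 0"
    and "\<And>k x. norm x < r \<Longrightarrow> (\<lambda>j. c (j, k) * x ^ j) sums eval_fps (dps_slice c k) x"
    and "\<And>x z. norm x < r \<Longrightarrow> norm z < r \<Longrightarrow>
      ((\<lambda>k. eval_fps (dps_slice c k) x * z ^ k) has_sum f (x, z)) UNIV"
    and "\<And>x k. norm x < r \<Longrightarrow> norm (eval_fps (dps_slice c k) x) \<le> B * (1 / r) ^ k"
proof -
  obtain r B where f: "0 < r" "dps_norm_le r c B"
      "\<And>x z. norm x \<le> r \<Longrightarrow> norm z \<le> r \<Longrightarrow> f (x, z) = dps_eval c x z"
    by (rule has_dpsE[OF assms]) (rule that)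
  have row: "(\<lambda>j. norm (c (j, k)) * r ^ j) summable_on UNIV"
    and rowle: "(\<Sum>\<^sub>\<infinity>j. norm (c (j, k)) * r ^ j) \<le> B * (1 / r) ^ k" for k
  proof -
    have fin: "(\<Sum>j\<in>F. norm (c (j, k)) * r ^ j) \<le> B * (1 / r) ^ k" if "finite F" for F
    proof -
      have "(\<Sum>j\<in>F. norm (c (j, k)) * r ^ j) * r ^ k
          = (\<Sum>(j, k)\<in>(\<lambda>j. (j, k)) ` F. norm (c (j, k)) * r ^ (j + k))"
        by (subst sum.reindex) (auto simp: inj_on_def sum_distrib_left sum_distrib_right power_add mult_ac)
      also have "\<dots> \<le> B" using that by (intro dps_norm_le_sum[OF f(2)]) auto
      finally show ?thesis using f(1) by (simp add: field_simps)
    qed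
    show 1: "(\<lambda>j. norm (c (j, k)) * r ^ j) summable_on UNIV"
      by (rule nonneg_bdd_above_summable_on) (use fin f in \<open>auto intro!: bdd_aboveI2[where M = "B * (1 / r) ^ k"]\<close>)
    show "(\<Sum>\<^sub>\<infinity>j. norm (c (j, k)) * r ^ j) \<le> B * (1 / r) ^ k"
      by (rule infsum_le_finite_sums[OF 1]) (use fin in auto)
  qed
  have ns: "(\<lambda>j. norm (c (j, k) * x ^ j)) summable_on UNIV" if "norm x \<le> r" for x k
    by (rule Infinite_Sum.abs_summable_on_comparison_test'[OF row[of k]])
       (use that in \<open>auto simp: norm_mult norm_power intro!: mult_left_mono power_mono\<close>)
  have hs: "((\<lambda>j. c (j, k) * x ^ j) has_sum eval_fps (dps_slice c k) x) UNIV" if x: "norm x \<le> r" for x k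
  proof -
    obtain S where S: "((\<lambda>j. c (j, k) * x ^ j) has_sum S) UNIV"
      using abs_summable_summable[OF ns[OF x]] by (auto simp: summable_on_def)
    have "eval_fps (dps_slice c k) x = S"
      using has_sum_imp_sums[OF S] by (simp add: eval_fps_def dps_slice_def sums_iff)
    with S show ?thesis by simp
  qed
  show ?thesis
  proof (rule that[of r B])
    fix x z :: 'a and k assume x: "norm x < r"
    show "(\<lambda>j. c (j, k) * x ^ j) sums eval_fps (dps_slice c k) x"
      using hs[of x k] x by (intro has_sum_imp_sums) auto
    have "norm (eval_fps (dps_slice c k) x) \<le> (\<Sum>\<^sub>\<infinity>j. norm (c (j, k) * x ^ j))"
      by (rule norm_has_sum_bound[OF has_sum_infsum[OF ns] hs]) (use x in auto)
    also have "\<dots> \<le> (\<Sum>\<^sub>\<infinity>j. norm (c (j, k)) * r ^ j)"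
      by (rule infsum_mono[OF ns row])
         (use x in \<open>auto simp: norm_mult norm_power intro!: mult_left_mono power_mono\<close>)
    finally show "norm (eval_fps (dps_slice c k) x) \<le> B * (1 / r) ^ k"
      using rowle[of k] by simp
    assume z: "norm z < r"
    have "((\<lambda>(j, k). c (j, k) * x ^ j * z ^ k) has_sum f (x, z)) (UNIV \<times> UNIV)"
      using dps_eval_has_sum[OF f(2), of x z] f(3)[of x z] x z by simp
    then have "((\<lambda>(k, j). c (j, k) * x ^ j * z ^ k) has_sum f (x, z)) (UNIV \<times> UNIV)"
      by (subst (asm) has_sum_swap) simp
    then show "((\<lambda>k. eval_fps (dps_slice c k) x * z ^ k) has_sum f (x, z)) UNIV"
      by (rule has_sum_SigmaD) (use hs[of x] x in \<open>auto intro!: has_sum_cmult_left\<close>)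
  qed (use f in auto)
qed

lemma has_fps_expansion_slice:
  fixes f :: "'a \<times> 'a \<Rightarrow> 'a::{real_normed_field,banach}"
  assumes "has_dps f c"
  shows "eval_fps (dps_slice c k) has_fps_expansion dps_slice c k"
    and "(\<lambda>x. f (x, 0)) has_fps_expansion dps_slice c 0"
proof -
  obtain r where r: "r > 0"
    and 1: "\<And>k x. norm x < r \<Longrightarrow> (\<lambda>j. c (j, k) * x ^ j) sums eval_fps (dps_slice c k) x"
    and 2: "\<And>x z. norm x < r \<Longrightarrow> norm z < r \<Longrightarrow>
      ((\<lambda>k. eval_fps (dps_slice c k) x * z ^ k) has_sum f (x, z)) UNIV"
    by (rule has_dps_slices[OF assms]) (rule that)
  have ev: "\<forall>\<^sub>F x in nhds 0. norm (x :: 'a) < r"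
    using r by (auto simp: eventually_nhds_metric dist_norm intro!: exI[of _ r])
  show "eval_fps (dps_slice c k) has_fps_expansion dps_slice c k" for k
    by (rule has_fps_expansionI, rule eventually_mono[OF ev]) (use 1[of _ k] in \<open>simp add: dps_slice_def\<close>)
  have "f (x, 0) = eval_fps (dps_slice c 0) x" if "norm x < r" for x
  proof -
    have "((\<lambda>k. eval_fps (dps_slice c k) x * 0 ^ k) has_sum eval_fps (dps_slice c 0) x) UNIV"
      by (rule has_sum_finite_neutralI[of "{0}"]) (auto simp: zero_power)
    with 2[of x 0] that r show ?thesis
      by (intro has_sum_unique[of "\<lambda>k. eval_fps (dps_slice c k) x * 0 ^ k" UNIV "f (x, 0)"]) auto
  qed
  then show "(\<lambda>x. f (x, 0)) has_fps_expansion dps_slice c 0"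
    by (intro has_fps_expansionI eventually_mono[OF ev]) (use 1[of _ 0] in \<open>simp add: dps_slice_def\<close>)
qed

lemma analytic1_slice: "analytic2 f \<Longrightarrow> analytic1 (\<lambda>x. f (x, 0))"
  using has_fps_expansion_slice(2) unfolding analytic1_def analytic2_def by blast

text \<open>The zeros accumulate at \<open>0\<close>. The series is multiplied by \<open>x\<close> because the theorem on isolated zeros
  asks for a zero at the centre. Real points suffice, which later carries identities between real
  functions over to their complexifications.\<close>

lemma powser_eq_0_on_reals:
  fixes a :: "nat \<Rightarrow> 'a::{real_normed_field,banach}"
  assumes r: "r > 0" and s0: "\<And>s. 0 < s \<Longrightarrow> s < r \<Longrightarrow> (\<lambda>n. a n * of_real s ^ n) sums 0"
  shows "a m = 0"
proof (rule ccontr)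
  assume m: "a m \<noteq> 0"
  define b where "b n = (case n of 0 \<Rightarrow> 0 | Suc n \<Rightarrow> a n)" for n
  define f where "f x = (\<Sum>n. b n * x ^ n)" for x
  have sm: "summable (\<lambda>n. a n * x ^ n)" if "norm x < r / 2" for x
    by (rule powser_inside[OF sums_summable[OF s0[of "r / 2"]]]) (use r that in auto)
  have bs: "(\<lambda>n. b n * x ^ n) sums (x * (\<Sum>n. a n * x ^ n))" if "norm x < r / 2" for x
  proof -
    have "(\<lambda>n. b (Suc n) * x ^ Suc n) sums (x * (\<Sum>n. a n * x ^ n))"
      using sums_mult[OF summable_sums[OF sm[OF that]], of x] by (simp add: b_def mult_ac)
    then show ?thesis by (subst (asm) sums_Suc_iff) (simp add: b_def)
  qed
  obtain s where s: "0 < s" "\<And>z. z \<in> cball 0 s - {0} \<Longrightarrow> f z \<noteq> 0"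
  proof (rule powser_0_nonzero[of "r / 2" 0 b f "Suc m"])
    show "(\<lambda>n. b n * (x - 0) ^ n) sums f x" if "norm (x - 0) < r / 2" for x
      using bs[of x] that by (simp add: f_def sums_iff)
    show "f 0 = 0" using bs[of 0] r by (simp add: f_def sums_iff)
  qed (use m r in \<open>auto simp: b_def\<close>)
  define t where "t = min s (r / 4)"
  have t: "0 < t" "t \<le> s" "t < r / 2" using s r by (auto simp: t_def)
  have "f (of_real t) = 0"
    using bs[of "of_real t"] s0[of t] t r by (simp add: f_def sums_iff)
  moreover have "of_real t \<in> cball (0 :: 'a) s - {0}" using t by simp
  ultimately show False using s(2) by blast
qed

lemma has_dps_eq_0:
  fixes f :: "'a \<times> 'a \<Rightarrow> 'a::{real_normed_field,banach}"
  assumes "has_dps f c" "r > 0"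
    and 0: "\<And>s t. 0 < s \<Longrightarrow> s < r \<Longrightarrow> 0 < t \<Longrightarrow> t < r \<Longrightarrow> f (of_real s, of_real t) = 0"
  shows "c n = 0"
proof -
  obtain j k where n: "n = (j, k)" by force
  obtain r' where r': "r' > 0"
    and 1: "\<And>k x. norm x < r' \<Longrightarrow> (\<lambda>j. c (j, k) * x ^ j) sums eval_fps (dps_slice c k) x"
    and 2: "\<And>x z. norm x < r' \<Longrightarrow> norm z < r' \<Longrightarrow>
      ((\<lambda>k. eval_fps (dps_slice c k) x * z ^ k) has_sum f (x, z)) UNIV"
    by (rule has_dps_slices[OF assms(1)]) (rule that)
  define \<rho> where "\<rho> = min r r'"
  have \<rho>: "\<rho> > 0" "\<rho> \<le> r" "\<rho> \<le> r'" using assms(2) r' by (auto simp: \<rho>_def)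
  have sl: "eval_fps (dps_slice c k) (of_real s) = 0" if "0 < s" "s < \<rho>" for s k
  proof (rule powser_eq_0_on_reals[OF \<rho>(1)])
    fix t assume "0 < t" "t < \<rho>"
    then show "(\<lambda>k. eval_fps (dps_slice c k) (of_real s) * of_real t ^ k) sums 0"
      using has_sum_imp_sums[OF 2[of "of_real s" "of_real t"]] 0[of s t] that \<rho> by simp
  qed
  have "c (j, k) = 0"
  proof (rule powser_eq_0_on_reals[OF \<rho>(1), of "\<lambda>j. c (j, k)"])
    fix s assume "0 < s" "s < \<rho>"
    then show "(\<lambda>j. c (j, k) * of_real s ^ j) sums 0"
      using 1[of "of_real s" k] sl[of s k] \<rho> by simp
  qed
  then show ?thesis by (simp add: n)
qed

lemma has_dps_unique_reals:
  fixes f g :: "'a \<times> 'a \<Rightarrow> 'a::{real_normed_field,banach}"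
  assumes "has_dps f a" "has_dps g b" "r > 0"
    and "\<And>s t. 0 < s \<Longrightarrow> s < r \<Longrightarrow> 0 < t \<Longrightarrow> t < r \<Longrightarrow>
       f (of_real s, of_real t) = g (of_real s, of_real t)"
  shows "a = b"
proof
  fix n
  have "has_dps (\<lambda>y. - 1 * g y) (\<lambda>n. - b n)"
  proof -
    obtain s where g: "s > 0" "\<And>x z. norm x < s \<Longrightarrow> norm z < s \<Longrightarrow>
        ((\<lambda>(j, k). b (j, k) * x ^ j * z ^ k) has_sum g (x, z)) UNIV"
      using assms(2) unfolding has_dps_def by blast
    show ?thesis unfolding has_dps_def
    proof (intro exI[of _ s] conjI allI impI)
      fix x z :: 'a assume "norm x < s" "norm z < s"
      from has_sum_uminusI[OF g(2)[OF this]]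
      show "((\<lambda>(j, k). - b (j, k) * x ^ j * z ^ k) has_sum - 1 * g (x, z)) UNIV"
        by (simp add: case_prod_unfold)
    qed (use g in auto)
  qed
  from has_dps_eq_0[OF has_dps_add[OF assms(1) this] assms(3), of n] show "a n = b n"
    using assms(4) by simp
qed

lemma has_dps_unique:
  assumes "has_dps f a" "has_dps g b" "\<forall>\<^sub>F y in nhds (0, 0). f y = g y"
  shows "a = b"
proof -
  obtain r where "r > 0" "\<And>x z. norm x < r \<Longrightarrow> norm z < r \<Longrightarrow> f (x, z) = g (x, z)"
    using assms(3) unfolding eventually_nhds_00 by blast
  then show ?thesis by (intro has_dps_unique_reals[OF assms(1,2)]) auto
qed

lemma has_dps_unique': "has_dps f a \<Longrightarrow> has_dps f b \<Longrightarrow> a = b"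
  by (rule has_dps_unique) auto

lemma analytic2_tendsto:
  assumes "analytic2 f"
  shows "(f \<longlongrightarrow> f (0, 0)) (nhds (0, 0))"
proof -
  define g where "g y = f y - f (0, 0)" for y
  have "analytic2 g" unfolding g_def using assms by (intro analytic_intros)
  then obtain c where c: "has_dps g c" unfolding analytic2_def by blast
  obtain r B where r: "0 < r" "dps_norm_le r c B"
      "\<And>x z. norm x \<le> r \<Longrightarrow> norm z \<le> r \<Longrightarrow> g (x, z) = dps_eval c x z"
    by (rule has_dpsE[OF c]) (rule that)
  have c0: "c (0, 0) = 0" using has_dps_at_0[OF c] by (simp add: g_def)
  have B: "0 \<le> B" using r(2) by (rule dps_norm_le_nonneg)
  show ?thesis
  proof (rule tendstoI)
    fix e :: real assume e: "e > 0"
    define t where "t = min 1 (e / (2 * (B + 1)))"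
    have t: "0 < t" "t \<le> 1" using e B by (auto simp: t_def)
    have "t * B \<le> e / (2 * (B + 1)) * B" using B by (intro mult_right_mono) (auto simp: t_def)
    also have "\<dots> = e * (B / (2 * (B + 1)))" by simp
    also have "\<dots> < e * 1" using e B by (intro mult_strict_left_mono) (auto simp: field_simps)
    also have "\<dots> = e" by simp
    finally have tB: "t * B < e" .
    note n = dps_norm_le_scale[of r c B t, OF r(2) c0 less_imp_le[OF t(1)] t(2)]
    show "\<forall>\<^sub>F y in nhds (0, 0). dist (f y) (f (0, 0)) < e"
      unfolding eventually_nhds_00
    proof (intro exI[of _ "t * r"] conjI allI impI)
      fix x z :: 'a assume xz: "norm x < t * r" "norm z < t * r"
      have "t * r \<le> r" using t r by (simp add: mult_le_cancel_right1)
      then have "g (x, z) = dps_eval c x z" using xz r(3) by auto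
      then have "norm (g (x, z)) \<le> t * B"
        using norm_dps_eval_le[OF n, of x z] xz by simp
      then show "dist (f (x, z)) (f (0, 0)) < e" using tB by (simp add: g_def dist_norm)
    qed (use t r in auto)
  qed
qed

lemma analytic2_eventually_nonzero:
  assumes "analytic2 f" "f (0, 0) \<noteq> 0"
  shows "\<forall>\<^sub>F y in nhds (0, 0). f y \<noteq> 0"
  using tendsto_imp_eventually_ne[OF analytic2_tendsto[OF assms(1)] assms(2)] .

lemma fps_expansion_unique:
  fixes f g :: "'a::{real_normed_field,banach} \<Rightarrow> 'a"
  assumes "f has_fps_expansion A" "g has_fps_expansion B" "r > 0"
    and "\<And>s. 0 < s \<Longrightarrow> s < r \<Longrightarrow> f (of_real s) = g (of_real s)"
  shows "A = B"
proof -
  have "(\<lambda>x. f x - g x) has_fps_expansion (A - B)"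
    by (intro fps_expansion_intros assms)
  then have R: "fps_conv_radius (A - B) > 0"
    and "\<forall>\<^sub>F x in nhds 0. eval_fps (A - B) x = f x - g x"
    by (auto simp: has_fps_expansion_def)
  then obtain s where s: "s > 0" "\<And>x. dist x 0 < s \<Longrightarrow> eval_fps (A - B) x = f x - g x"
    unfolding eventually_nhds_metric by blast
  obtain t where t: "t > 0" "ereal t < fps_conv_radius (A - B)"
    using eball_real[OF R] by blast
  have "fps_nth (A - B) n = 0" for n
  proof (rule powser_eq_0_on_reals[of "min r (min s t)"])
    fix x assume x: "0 < x" "x < min r (min s t)"
    then have "ereal x < ereal t" by simp
    then have "ereal (norm (of_real x :: 'a)) < fps_conv_radius (A - B)"
      using x less_trans[OF _ t(2), of "ereal x"] by simp
    from sums_eval_fps[OF this] show "(\<lambda>n. fps_nth (A - B) n * of_real x ^ n) sums 0"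
      using s(2)[of "of_real x"] assms(4)[of x] x by simp
  qed (use assms s t in auto)
  then show ?thesis by (simp add: fps_eq_iff)
qed

lemma fps_expansion_unique_eventually:
  fixes f g :: "'a::{real_normed_field,banach} \<Rightarrow> 'a"
  assumes "f has_fps_expansion A" "g has_fps_expansion B" "\<forall>\<^sub>F x in nhds 0. f x = g x"
  shows "A = B"
proof -
  obtain r where "r > 0" "\<And>x. dist x 0 < r \<Longrightarrow> f x = g x"
    using assms(3) unfolding eventually_nhds_metric by blast
  then show ?thesis by (intro fps_expansion_unique[OF assms(1,2)]) auto
qed

lemma has_fps_expansion_row:
  assumes "has_dps f c"
  shows "(\<lambda>z. f (0, z)) has_fps_expansion Abs_fps (\<lambda>k. c (0, k))"
  using has_fps_expansion_slice(2)[OF has_dps_swap[OF assms]] by (simp add: dps_slice_def)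

lemma has_fps_expansion_poly: "poly p has_fps_expansion fps_of_poly p"
  unfolding has_fps_expansion_def by simp

lemma dps_row_eq_poly:
  assumes "has_dps f c" "\<forall>\<^sub>F z in nhds 0. f (0, z) = poly p z"
  shows "c (0, k) = coeff p k"
  using fps_expansion_unique_eventually[OF has_fps_expansion_row[OF assms(1)] has_fps_expansion_poly assms(2)]
  by (metis fps_nth_Abs_fps fps_of_poly_nth)

lemma dps_row_eq:
  assumes "has_dps f c" "has_dps g e" "\<forall>\<^sub>F z in nhds 0. f (0, z) = g (0, z)"
  shows "c (0, k) = e (0, k)"
  using fps_expansion_unique_eventually[OF has_fps_expansion_row[OF assms(1)]
      has_fps_expansion_row[OF assms(2)] assms(3)]
  by (metis fps_nth_Abs_fps)

section \<open>Weighted blow-ups and Taylor shifts\<close>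

text \<open>The part of weight \<open>N\<close> for the weight \<open>(q, u)\<close>, with the first variable set to \<open>1\<close>.\<close>

definition edge_poly :: "(nat \<times> nat \<Rightarrow> 'a::comm_semiring_1) \<Rightarrow> nat \<Rightarrow> nat \<Rightarrow> nat \<Rightarrow> 'a poly" where
  "edge_poly c q u N = (\<Sum>(j, k)\<in>{(j, k). q * j + u * k = N}. monom (c (j, k)) k)"

lemma finite_edge:
  assumes "0 < q" "0 < u"
  shows "finite {(j, k). q * j + u * k = (N::nat)}"
proof (rule finite_subset)
  have "j \<le> q * j" "k \<le> u * k" for j k using assms by auto
  then show "{(j, k). q * j + u * k = N} \<subseteq> {..N} \<times> {..N}"
    by (auto intro: order_trans[OF _ le_add1] order_trans[OF _ le_add2])
qed auto

lemma poly_edge_poly: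
  "poly (edge_poly c q u N) w = (\<Sum>(j, k)\<in>{(j, k). q * j + u * k = N}. c (j, k) * w ^ k)"
  by (simp add: edge_poly_def poly_sum case_prod_unfold poly_monom)

lemma coeff_edge_poly:
  assumes "0 < q" "0 < u"
  shows "q * j + u * k = N \<Longrightarrow> coeff (edge_poly c q u N) k = c (j, k)"
    and "(\<And>j. q * j + u * k \<noteq> N) \<Longrightarrow> coeff (edge_poly c q u N) k = 0"
proof -
  have *: "coeff (edge_poly c q u N) k = (\<Sum>(j', k')\<in>{(j, k). q * j + u * k = N}. if k' = k then c (j', k') else 0)"
    by (auto simp: edge_poly_def coeff_sum intro!: sum.cong)
  show "coeff (edge_poly c q u N) k = c (j, k)" if "q * j + u * k = N"
  proof -
    have "(\<Sum>(j', k')\<in>{(j, k). q * j + u * k = N}. if k' = k then c (j', k') else 0)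
        = (\<Sum>(j', k')\<in>{(j, k)}. if k' = k then c (j', k') else 0)"
      by (rule sum.mono_neutral_right[OF finite_edge[OF assms]]) (use that assms in \<open>auto split: if_splits\<close>)
    with * show ?thesis by simp
  qed
  show "coeff (edge_poly c q u N) k = 0" if "\<And>j. q * j + u * k \<noteq> N"
    unfolding * by (rule sum.neutral) (use that in auto)
qed

text \<open>After division by \<open>s^N\<close> a monomial becomes \<open>s^(q j + u k - N) (b + w)^k\<close>. On a polydisc of radius
  \<open>\<rho>\<close> with \<open>\<rho> (|b| + 1) \<le> r\<close> these terms are dominated by the terms of \<open>F\<close> at radius \<open>r\<close>, up to the
  constant \<open>1 / \<rho>^N\<close>. For \<open>s = 0\<close> only the terms of weight \<open>N\<close> survive.\<close>

lemma blow_up: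
  fixes F :: "'a \<times> 'a \<Rightarrow> 'a::{real_normed_field,banach}"
  assumes "has_dps F c" "0 < q" "0 < u" "\<And>j k. c (j, k) \<noteq> 0 \<Longrightarrow> N \<le> q * j + u * k"
  obtains H D \<rho> where "has_dps H D" "0 < \<rho>"
    "\<And>s w. norm s < \<rho> \<Longrightarrow> norm w < \<rho> \<Longrightarrow> F (s ^ q, s ^ u * (b + w)) = s ^ N * H (s, w)"
    "\<And>w. norm w < \<rho> \<Longrightarrow> H (0, w) = poly (edge_poly c q u N) (b + w)"
proof -
  obtain r C where f: "0 < r" "dps_norm_le r c C"
      "\<And>x z. norm x \<le> r \<Longrightarrow> norm z \<le> r \<Longrightarrow> F (x, z) = dps_eval c x z"
    by (rule has_dpsE[OF assms(1)]) (rule that)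
  define \<rho> where "\<rho> = min 1 (r / (norm b + 1))"
  have nb: "norm b + 1 \<ge> 1" by simp
  have "\<rho> * (norm b + 1) \<le> r / (norm b + 1) * (norm b + 1)"
    by (intro mult_right_mono) (auto simp: \<rho>_def)
  then have \<rho>: "0 < \<rho>" "\<rho> \<le> 1" "\<rho> * (norm b + 1) \<le> r"
    using f(1) nb by (auto simp: \<rho>_def add_nonneg_pos)
  have "\<rho> * 1 \<le> \<rho> * (norm b + 1)" using \<rho>(1) nb by (intro mult_left_mono) auto
  then have \<rho>r: "\<rho> \<le> r" using \<rho>(3) by simp
  define X :: "nat \<times> nat \<Rightarrow> 'a" where "X = (\<lambda>n. if n = (1, 0) then 1 else 0)"
  define W :: "nat \<times> nat \<Rightarrow> 'a" where "W = (\<lambda>n. if n = (0, 0) then b else if n = (0, 1) then 1 else 0)"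
  have nX: "dps_norm_le \<rho> X \<rho>"
  proof (rule dps_norm_leI)
    fix A :: "(nat \<times> nat) set" assume A: "finite A"
    have "(\<Sum>(j, k)\<in>A. norm (X (j, k)) * \<rho> ^ (j + k)) = (\<Sum>n\<in>A. if n = (1, 0) then \<rho> else 0)"
      by (rule sum.cong) (auto simp: X_def split: if_splits)
    also have "\<dots> \<le> \<rho>" using A \<rho> by simp
    finally show "(\<Sum>(j, k)\<in>A. norm (X (j, k)) * \<rho> ^ (j + k)) \<le> \<rho>" .
  qed (use \<rho> in auto)
  have nW: "dps_norm_le \<rho> W (norm b + 1)"
  proof (rule dps_norm_leI)
    fix A :: "(nat \<times> nat) set" assume A: "finite A"
    have "(\<Sum>(j, k)\<in>A. norm (W (j, k)) * \<rho> ^ (j + k))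
        = (\<Sum>n\<in>A. (if n = (0, 0) then norm b else 0) + (if n = (0, 1) then \<rho> else 0))"
      by (rule sum.cong) (auto simp: W_def split: if_splits)
    also have "\<dots> \<le> norm b + \<rho>" using A \<rho> by (simp add: sum.distrib)
    finally show "(\<Sum>(j, k)\<in>A. norm (W (j, k)) * \<rho> ^ (j + k)) \<le> norm b + 1" using \<rho> by simp
  qed (use \<rho> in auto)
  have eX: "dps_eval X x z = x" for x z
  proof -
    have "((\<lambda>(j, k). X (j, k) * x ^ j * z ^ k) has_sum x) UNIV"
      by (rule has_sum_finite_neutralI[of "{(1, 0)}"]) (auto simp: X_def split: if_splits)
    then show ?thesis unfolding dps_eval_def by (rule infsumI)
  qed
  have eW: "dps_eval W x z = b + z" for x z
  proof -
    have "((\<lambda>(j, k). W (j, k) * x ^ j * z ^ k) has_sum (b + z)) UNIV"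
      by (rule has_sum_finite_neutralI[of "{(0, 0), (0, 1)}"]) (auto simp: W_def split: if_splits)
    then show ?thesis unfolding dps_eval_def by (rule infsumI)
  qed
  define E where "E = (\<lambda>(j, k) n. c (j, k) * cauchy2 (cauchy_power X (q * j + u * k - N)) (cauchy_power W k) n)"
  define B where "B = (\<lambda>(j, k). (1 / \<rho> ^ N) * (norm (c (j, k)) * r ^ (j + k)))"
  note nXW = dps_norm_le_cauchy2[OF dps_cauchy_power(1)[OF nX] dps_cauchy_power(1)[OF nW]]
  have nE: "dps_norm_le \<rho> (E p) (B p)" for p
  proof -
    obtain j k where p: "p = (j, k)" by force
    have 1: "dps_norm_le \<rho> (E (j, k)) (norm (c (j, k)) * (\<rho> ^ (q * j + u * k - N) * (norm b + 1) ^ k))"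
      unfolding E_def prod.case by (rule dps_scalar(1)[OF nXW])
    have "norm (c (j, k)) * (\<rho> ^ (q * j + u * k - N) * (norm b + 1) ^ k) \<le> B (j, k)"
    proof (cases "c (j, k) = 0")
      case False
      then have N: "N \<le> q * j + u * k" by (rule assms(4))
      have jk: "j + k \<le> q * j + u * k" using assms(2,3) by (intro add_mono) auto
      have "\<rho> ^ (q * j + u * k - N) * \<rho> ^ N = \<rho> ^ (q * j + u * k)"
        using N by (simp flip: power_add)
      also have "\<dots> \<le> \<rho> ^ (j + k)" using \<rho> jk by (intro power_decreasing) auto
      finally have "\<rho> ^ (q * j + u * k - N) \<le> \<rho> ^ (j + k) / \<rho> ^ N"
        using \<rho> by (simp add: field_simps)
      then have "\<rho> ^ (q * j + u * k - N) * (norm b + 1) ^ k \<le> \<rho> ^ (j + k) / \<rho> ^ N * (norm b + 1) ^ k"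
        using nb by (intro mult_right_mono) auto
      also have "\<dots> = (1 / \<rho> ^ N) * (\<rho> ^ j * (\<rho> * (norm b + 1)) ^ k)"
        by (simp add: power_add power_mult_distrib)
      also have "\<dots> \<le> (1 / \<rho> ^ N) * (r ^ j * r ^ k)"
        using \<rho> \<rho>r nb f(1) by (intro mult_left_mono mult_mono power_mono) auto
      finally have "norm (c (j, k)) * (\<rho> ^ (q * j + u * k - N) * (norm b + 1) ^ k)
          \<le> norm (c (j, k)) * ((1 / \<rho> ^ N) * (r ^ j * r ^ k))"
        by (rule mult_left_mono) simp
      then show ?thesis by (simp add: B_def power_add mult_ac)
    qed (use \<rho> f in \<open>auto simp: B_def\<close>)
    with 1 show ?thesis unfolding p by (rule dps_norm_le_mono)
  qed
  have "(\<lambda>(j, k). norm (c (j, k)) * r ^ (j + k)) summable_on UNIV"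
    using f(2) by (simp add: dps_norm_le_def)
  from summable_on_cmult_right[OF this, of "1 / \<rho> ^ N"] have Bs: "B summable_on UNIV"
    by (simp add: B_def case_prod_unfold)
  note fam = dps_family[OF nE Bs \<rho>(1)]
  define D where "D n = (\<Sum>\<^sub>\<infinity>p. E p n)" for n
  define H where "H = (\<lambda>(s, w). dps_eval D s w)"
  have eE: "dps_eval (E (j, k)) s w = c (j, k) * s ^ (q * j + u * k - N) * (b + w) ^ k"
    if sw: "norm s \<le> \<rho>" "norm w \<le> \<rho>" for j k s w
    unfolding E_def prod.case
    by (simp add: dps_scalar(2)[OF nXW] dps_cauchy_power(2)[OF nX sw] dps_cauchy_power(2)[OF nW sw]
      dps_eval_cauchy2[OF dps_cauchy_power(1)[OF nX] dps_cauchy_power(1)[OF nW] sw] eX eW mult.assoc)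
  have hsH: "((\<lambda>(j, k). c (j, k) * s ^ (q * j + u * k - N) * (b + w) ^ k) has_sum H (s, w)) UNIV"
    if sw: "norm s < \<rho>" "norm w < \<rho>" for s w
  proof -
    have sw': "norm s \<le> \<rho>" "norm w \<le> \<rho>" using sw by auto
    have "(\<lambda>p. dps_eval (E p) s w) = (\<lambda>(j, k). c (j, k) * s ^ (q * j + u * k - N) * (b + w) ^ k)"
      using eE[OF sw'] by (auto simp: fun_eq_iff)
    with fam(2)[OF sw'] show ?thesis by (simp add: H_def D_def[abs_def])
  qed
  show ?thesis
  proof (rule that[of H D \<rho>])
    show "has_dps H D"
      using fam(1) by (intro has_dpsI[OF _ \<rho>(1)]) (auto simp: H_def D_def[abs_def])
    fix w :: 'a assume w: "norm w < \<rho>"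
    have "((\<lambda>(j, k). c (j, k) * 0 ^ (q * j + u * k - N) * (b + w) ^ k) has_sum
        poly (edge_poly c q u N) (b + w)) UNIV"
    proof (rule has_sum_finite_neutralI[OF finite_edge[OF assms(2,3), of N]])
      fix p assume "p \<in> UNIV - {(j, k). q * j + u * k = N}"
      then obtain j k where p: "p = (j, k)" "q * j + u * k \<noteq> N" by force
      show "(case p of (j, k) \<Rightarrow> c (j, k) * 0 ^ (q * j + u * k - N) * (b + w) ^ k) = 0"
        using assms(4)[of j k] p by (cases "c (j, k) = 0") (auto simp: zero_power)
    qed (auto simp: poly_edge_poly intro!: sum.cong)
    with hsH[of 0 w] w \<rho> show "H (0, w) = poly (edge_poly c q u N) (b + w)"
      by (auto intro: has_sum_unique)
    fix s :: 'a assume s: "norm s < \<rho>"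
    have pow: "norm s ^ n \<le> \<rho>" if "0 < n" for n
    proof -
      have "norm s ^ n \<le> norm s ^ 1" using that s \<rho> by (intro power_decreasing) auto
      then show ?thesis using s by simp
    qed
    have n1: "norm (s ^ q) \<le> r" using pow[OF assms(2)] \<rho>r by (simp add: norm_power)
    have "norm (s ^ u * (b + w)) \<le> \<rho> * (norm b + 1)"
      unfolding norm_mult norm_power
      using pow[OF assms(3)] \<rho> norm_triangle_ineq[of b w] w by (intro mult_mono) auto
    then have n2: "norm (s ^ u * (b + w)) \<le> r" using \<rho> by simp
    have "((\<lambda>p. s ^ N * (case p of (j, k) \<Rightarrow> c (j, k) * s ^ (q * j + u * k - N) * (b + w) ^ k))
        has_sum s ^ N * H (s, w)) UNIV"
      by (rule has_sum_cmult_right[OF hsH[OF s w]])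
    moreover have termeq: "s ^ N * (c (j, k) * s ^ (q * j + u * k - N) * (b + w) ^ k)
        = c (j, k) * (s ^ q) ^ j * (s ^ u * (b + w)) ^ k" for j k
    proof (cases "c (j, k) = 0")
      case False
      then have "s ^ N * s ^ (q * j + u * k - N) = s ^ (q * j + u * k)"
        using assms(4) by (simp flip: power_add)
      moreover have "s ^ N * (c (j, k) * s ^ (q * j + u * k - N) * (b + w) ^ k)
          = c (j, k) * (s ^ N * s ^ (q * j + u * k - N)) * (b + w) ^ k"
        by (simp only: mult_ac)
      ultimately have "s ^ N * (c (j, k) * s ^ (q * j + u * k - N) * (b + w) ^ k)
          = c (j, k) * s ^ (q * j + u * k) * (b + w) ^ k" by (simp only:)
      then show ?thesis by (simp add: power_add power_mult power_mult_distrib mult.assoc)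
    qed auto
    ultimately have "((\<lambda>(j, k). c (j, k) * (s ^ q) ^ j * (s ^ u * (b + w)) ^ k)
        has_sum s ^ N * H (s, w)) UNIV"
      by (simp only: case_prod_unfold)
    with dps_eval_has_sum[OF f(2) n1 n2]
    show "F (s ^ q, s ^ u * (b + w)) = s ^ N * H (s, w)"
      unfolding f(3)[OF n1 n2] by (rule has_sum_unique)
  qed (rule \<rho>)
qed

text \<open>Moving a root to the origin turns its multiplicity into the order of vanishing there.\<close>

lemma order_pcompose_shift:
  fixes p :: "'a::field poly"
  assumes "p \<noteq> 0"
  shows "k < order b p \<Longrightarrow> coeff (pcompose p [:b, 1:]) k = 0"
    and "coeff (pcompose p [:b, 1:]) (order b p) \<noteq> 0"
proof -
  define n where "n = order b p"
  obtain r where r: "p = [:- b, 1:] ^ n * r" "\<not> [:- b, 1:] dvd r"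
    using order_decomp[OF assms, of b] unfolding n_def by blast
  have "poly r b \<noteq> 0" using r(2) by (simp add: poly_eq_0_iff_dvd)
  have pow: "pcompose (p ^ m) q = pcompose p q ^ m" for p q :: "'a poly" and m
    by (induction m) (simp_all add: pcompose_mult pcompose_1)
  have "pcompose [:- b, 1:] [:b, 1:] = [:0, 1:]" by (simp add: pcompose_pCons)
  then have "pcompose p [:b, 1:] = [:0, 1:] ^ n * pcompose r [:b, 1:]"
    by (simp add: r(1) pcompose_mult pow)
  also have "[:0, 1:] ^ n = (monom 1 n :: 'a poly)" by (simp add: monom_altdef)
  finally have *: "coeff (pcompose p [:b, 1:]) k = (if n \<le> k then coeff (pcompose r [:b, 1:]) (k - n) else 0)" for k
    by (simp add: coeff_monom_mult)
  show "k < order b p \<Longrightarrow> coeff (pcompose p [:b, 1:]) k = 0" by (simp add: * flip: n_def)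
  have "coeff (pcompose r [:b, 1:]) 0 = poly r b"
    by (simp flip: poly_0_coeff_0 add: poly_pcompose)
  with \<open>poly r b \<noteq> 0\<close> show "coeff (pcompose p [:b, 1:]) (order b p) \<noteq> 0"
    by (simp add: * flip: n_def)
qed

lemma dps_divide_monomial:
  fixes f :: "'a \<times> 'a \<Rightarrow> 'a::{real_normed_field,banach}"
  assumes "has_dps f c" "\<And>j k. c (j, k) \<noteq> 0 \<Longrightarrow> \<nu>1 \<le> j \<and> \<nu>2 \<le> k"
  obtains F where "has_dps F (\<lambda>(j, k). c (j + \<nu>1, k + \<nu>2))"
    "\<forall>\<^sub>F (x, z) in nhds (0, 0). f (x, z) = x ^ \<nu>1 * z ^ \<nu>2 * F (x, z)"
proof -
  define c' where "c' = (\<lambda>(j, k). c (j + \<nu>1, k + \<nu>2))"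
  define F where "F = (\<lambda>(x, z). dps_eval c' x z)"
  obtain r B where r: "0 < r" "dps_norm_le r c B"
      "\<And>x z. norm x \<le> r \<Longrightarrow> norm z \<le> r \<Longrightarrow> f (x, z) = dps_eval c x z"
    by (rule has_dpsE[OF assms(1)]) (rule that)
  have F: "has_dps F c'"
  proof (rule has_dps_geometricI[of c' "B * (1 / r) ^ (\<nu>1 + \<nu>2)" "1 / r" 1])
    fix j k
    show "norm (c' (j, k)) \<le> B * (1 / r) ^ (\<nu>1 + \<nu>2) * (1 / r) ^ (j + k)"
      using dps_coeff_le[OF r(2,1), of "j + \<nu>1" "k + \<nu>2"]
      by (simp add: c'_def power_add mult_ac)
  qed (use r in \<open>auto simp: F_def\<close>)
  then obtain s where s: "0 < s" "\<And>x z. norm x < s \<Longrightarrow> norm z < s \<Longrightarrow>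
        ((\<lambda>(j, k). c' (j, k) * x ^ j * z ^ k) has_sum F (x, z)) UNIV"
    unfolding has_dps_def by blast
  have eq: "f (x, z) = x ^ \<nu>1 * z ^ \<nu>2 * F (x, z)" if xz: "norm x < min r s" "norm z < min r s" for x z
  proof -
    have "((\<lambda>p. x ^ \<nu>1 * z ^ \<nu>2 * (case p of (j, k) \<Rightarrow> c' (j, k) * x ^ j * z ^ k))
        has_sum (x ^ \<nu>1 * z ^ \<nu>2 * F (x, z))) UNIV"
      by (rule has_sum_cmult_right[OF s(2)]) (use xz in auto)
    moreover have "x ^ \<nu>1 * z ^ \<nu>2 * (case p of (j, k) \<Rightarrow> c' (j, k) * x ^ j * z ^ k)
        = (case (case p of (j, k) \<Rightarrow> (j + \<nu>1, k + \<nu>2)) of (j, k) \<Rightarrow> c (j, k) * x ^ j * z ^ k)" for p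
      by (auto simp: c'_def power_add mult_ac split: prod.splits)
    moreover have "bij_betw (\<lambda>(j, k). (j + \<nu>1, k + \<nu>2)) UNIV ({\<nu>1..} \<times> {\<nu>2..})"
      by (rule bij_betwI[where g = "\<lambda>(j, k). (j - \<nu>1, k - \<nu>2)"]) auto
    ultimately have "((\<lambda>(j, k). c (j, k) * x ^ j * z ^ k) has_sum (x ^ \<nu>1 * z ^ \<nu>2 * F (x, z))) ({\<nu>1..} \<times> {\<nu>2..})"
      by (subst has_sum_reindex_bij_betw[symmetric]) auto
    also have "?this \<longleftrightarrow> ((\<lambda>(j, k). c (j, k) * x ^ j * z ^ k) has_sum (x ^ \<nu>1 * z ^ \<nu>2 * F (x, z))) UNIV"
    proof (rule has_sum_cong_neutral)
      fix p assume "p \<in> UNIV - {\<nu>1..} \<times> {\<nu>2..}"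
      then show "(case p of (j, k) \<Rightarrow> c (j, k) * x ^ j * z ^ k) = 0"
        using assms(2)[of "fst p" "snd p"] by (cases p) auto
    qed auto
    finally show ?thesis
      using dps_eval_has_sum[OF r(2), of x z] r(3)[of x z] xz by (auto intro: has_sum_unique)
  qed
  show ?thesis
  proof (rule that[OF F[unfolded c'_def]])
    show "\<forall>\<^sub>F (x, z) in nhds (0, 0). f (x, z) = x ^ \<nu>1 * z ^ \<nu>2 * F (x, z)"
      unfolding eventually_nhds_00 using eq r s by (intro exI[of _ "min r s"]) auto
  qed
qed

text \<open>These are the coefficients of the divided derivative of order \<open>m\<close> in the second variable.\<close>

lemma hasse_derivative:
  fixes f :: "'a \<times> 'a \<Rightarrow> 'a::{real_normed_field,banach}"
  assumes "has_dps f c"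
  obtains g where "has_dps g (\<lambda>(i, l). of_nat ((l + m) choose m) * c (i, l + m))"
proof -
  obtain r B where r: "0 < r" "dps_norm_le r c B"
      "\<And>x z. norm x \<le> r \<Longrightarrow> norm z \<le> r \<Longrightarrow> f (x, z) = dps_eval c x z"
    by (rule has_dpsE[OF assms(1)]) (rule that)
  have B: "0 \<le> B" using r(2) by (rule dps_norm_le_nonneg)
  define e :: "nat \<times> nat \<Rightarrow> 'a" where "e = (\<lambda>(i, l). of_nat ((l + m) choose m) * c (i, l + m))"
  have "has_dps (\<lambda>(x, z). dps_eval e x z) e"
  proof (rule has_dps_geometricI[of e "B * (2 / r) ^ m" "2 / r" 1])
    fix i l
    have "real ((l + m) choose m) \<le> 2 ^ (l + m)"
      using binomial_le_pow2[of "l + m" m] by (metis of_nat_le_iff of_nat_numeral of_nat_power)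
    also have "\<dots> \<le> 2 ^ (i + (l + m))" by simp
    finally have "real ((l + m) choose m) * norm (c (i, l + m)) \<le> 2 ^ (i + (l + m)) * (B * (1 / r) ^ (i + (l + m)))"
      using dps_coeff_le[OF r(2,1)] by (intro mult_mono) auto
    also have "\<dots> = B * (2 / r) ^ m * (2 / r) ^ (i + l)"
      using r(1) by (simp add: power_divide power_add field_simps)
    finally show "norm (e (i, l)) \<le> B * (2 / r) ^ m * (2 / r) ^ (i + l)"
      by (simp add: e_def norm_mult)
  qed (use r in auto)
  then show ?thesis using that by (simp add: e_def)
qed

text \<open>The binomial expansion gives a double sum that converges absolutely because its sum of norms is
  the series of the norms at \<open>|w| + |v|\<close>; it is resummed by the power of \<open>w\<close>.\<close>

lemma taylor_shift:
  fixes A :: "nat \<Rightarrow> 'a::{real_normed_field,banach}"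
  assumes A: "\<And>l. norm (A l) \<le> B * R ^ l" and R: "0 \<le> R" "R * (norm w + norm v) < 1"
    and S: "((\<lambda>l. A l * (w + v) ^ l) has_sum S) UNIV"
  shows "((\<lambda>m. (\<Sum>\<^sub>\<infinity>l. of_nat ((l + m) choose m) * A (l + m) * v ^ l) * w ^ m) has_sum S) UNIV"
proof -
  define g where "g = (\<lambda>(l, m). A l * (of_nat (l choose m) * w ^ m * v ^ (l - m)))"
  define I :: "(nat \<times> nat) set" where "I = Sigma UNIV (\<lambda>l. {..l})"
  have B: "0 \<le> B" using order_trans[OF norm_ge_zero A[of 0]] by simp
  have gs: "(\<lambda>p. norm (g p)) summable_on I"
    unfolding I_def
  proof (rule summable_on_SigmaI)
    fix l
    have "(\<Sum>m\<le>l. norm (g (l, m))) = norm (A l) * (norm w + norm v) ^ l"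
      by (simp add: g_def norm_mult norm_power binomial_ring sum_distrib_left)
    then show "((\<lambda>m. norm (g (l, m))) has_sum (norm (A l) * (norm w + norm v) ^ l)) {..l}"
      by (intro has_sum_finiteI) auto
    have "(\<lambda>l. norm (norm (A l) * (norm w + norm v) ^ l)) summable_on UNIV"
    proof (rule Infinite_Sum.abs_summable_on_comparison_test'[of "\<lambda>l. B * (R * (norm w + norm v)) ^ l"])
      have "summable (\<lambda>l. (R * (norm w + norm v)) ^ l)"
        using R by (intro summable_geometric) auto
      then show "(\<lambda>l. B * (R * (norm w + norm v)) ^ l) summable_on UNIV"
        using R by (intro summable_on_cmult_right) (auto simp: summable_on_UNIV_nonneg_real_iff)
      fix l
      have "norm (A l) * (norm w + norm v) ^ l \<le> B * R ^ l * (norm w + norm v) ^ l"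
        using A by (intro mult_right_mono) auto
      then show "norm (norm (A l) * (norm w + norm v) ^ l) \<le> B * (R * (norm w + norm v)) ^ l"
        by (simp add: power_mult_distrib mult_ac)
    qed
    then show "(\<lambda>l. norm (A l) * (norm w + norm v) ^ l) summable_on UNIV" by simp
  qed auto
  then obtain S' where S': "(g has_sum S') I"
    using abs_summable_summable by (auto simp: summable_on_def)
  have "((\<lambda>l. A l * (w + v) ^ l) has_sum S') UNIV"
    by (rule has_sum_SigmaD[OF S'[unfolded I_def]])
       (auto simp: g_def binomial_ring sum_distrib_left intro!: has_sum_finiteI)
  then have "S' = S" using S by (rule has_sum_unique)
  define h where "h = (\<lambda>(m, l). g (l + m, m))"
  have bij: "bij_betw (\<lambda>(m, l). (l + m, m)) (UNIV \<times> UNIV) I"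
    by (rule bij_betwI[where g = "\<lambda>(l, m). (m, l - m)"]) (auto simp: I_def)
  have h: "(h has_sum S) (UNIV \<times> UNIV)"
    using S' unfolding \<open>S' = S\<close> has_sum_reindex_bij_betw[OF bij, symmetric]
    by (simp add: h_def case_prod_unfold)
  have hn: "(\<lambda>p. norm (h p)) summable_on (UNIV \<times> UNIV)"
    using gs unfolding summable_on_reindex_bij_betw[OF bij, symmetric]
    by (simp add: h_def case_prod_unfold)
  show ?thesis
  proof (rule has_sum_SigmaD[OF h])
    fix m
    have "(\<lambda>l. norm (h (m, l))) summable_on UNIV"
      using summable_on_SigmaD1[of "\<lambda>m l. norm (h (m, l))" UNIV "\<lambda>_. UNIV" m] hn
      by (simp add: case_prod_unfold)
    then have "(\<lambda>l. h (m, l)) summable_on UNIV" by (rule abs_summable_summable)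
    then have "((\<lambda>l. h (m, l)) has_sum (\<Sum>\<^sub>\<infinity>l. h (m, l))) UNIV" by (rule has_sum_infsum)
    moreover have "h (m, l) = of_nat ((l + m) choose m) * A (l + m) * v ^ l * w ^ m" for l
      by (simp add: h_def g_def mult_ac)
    ultimately show "((\<lambda>l. h (m, l)) has_sum
        (\<Sum>\<^sub>\<infinity>l. of_nat ((l + m) choose m) * A (l + m) * v ^ l) * w ^ m) UNIV"
      by (simp add: infsum_cmult_left')
  qed
qed

section \<open>Weierstrass preparation\<close>

text \<open>Suppose that \<open>F(0, z) = z^m\<close>. A quotient \<open>q = 1 + x q_1(z) + x^2 q_2(z) + ...\<close> for which \<open>q F\<close> has
  degree \<open>m\<close> and leading coefficient \<open>1\<close> in \<open>z\<close> is determined recursively: the coefficient of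
  \<open>x^(j+1) z^(k+m)\<close> in \<open>q F\<close> is the \<open>k\<close>-th coefficient of \<open>q_(j+1)\<close> plus contributions of
  \<open>q_0, ..., q_j\<close>.\<close>

function weierstrass_quotient :: "(nat \<times> nat \<Rightarrow> 'a::comm_ring_1) \<Rightarrow> nat \<Rightarrow> nat \<Rightarrow> nat \<Rightarrow> 'a" where
  "weierstrass_quotient c m 0 k = (if k = 0 then 1 else 0)"
| "weierstrass_quotient c m (Suc j) k =
     - (\<Sum>i\<le>j. \<Sum>l\<le>k + m. weierstrass_quotient c m i l * c (Suc j - i, k + m - l))"
  by pat_completeness auto
termination
  by (relation "Wellfounded.measure (\<lambda>(c, m, j, k). j)") auto

lemma shifted_convolution_le:
  fixes a b :: "nat \<Rightarrow> real"
  assumes "\<And>l. 0 \<le> a l" "\<And>l. 0 \<le> b l"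
  shows "(\<Sum>k<K. \<Sum>l\<le>k + m. a l * b (k + m - l)) \<le> (\<Sum>l<K + m. a l) * (\<Sum>l<K + m. b l)"
proof -
  define S where "S = Sigma {..<K} (\<lambda>k. {..k + m})"
  have inj: "inj_on (\<lambda>(k, l). (l, k + m - l)) S"
    by (auto simp: inj_on_def S_def)
  have "(\<Sum>k<K. \<Sum>l\<le>k + m. a l * b (k + m - l)) = (\<Sum>(k, l)\<in>S. a l * b (k + m - l))"
    unfolding S_def by (subst sum.Sigma) auto
  also have "\<dots> = (\<Sum>(l, l')\<in>(\<lambda>(k, l). (l, k + m - l)) ` S. a l * b l')"
    by (subst sum.reindex[OF inj]) (auto simp: case_prod_unfold)
  also have "\<dots> \<le> (\<Sum>(l, l')\<in>{..<K + m} \<times> {..<K + m}. a l * b l')"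
    by (rule sum_mono2) (auto simp: S_def assms)
  also have "\<dots> = (\<Sum>l<K + m. a l) * (\<Sum>l<K + m. b l)"
    by (simp add: sum_product sum.cartesian_product)
  finally show ?thesis .
qed

lemma sum_geometric_le:
  fixes L :: real
  shows "L * (\<Sum>i\<le>j. (1 + L) ^ i) = (1 + L) ^ Suc j - 1"
  by (induction j) (auto simp: algebra_simps)

text \<open>The shift of the exponent by \<open>m\<close> costs a factor \<open>1 / r^m\<close> and the other factor of the product at
  most \<open>B\<close>, so that each norm is at most \<open>L = B / r^m\<close> times the sum of the previous ones (scaled by
  powers of \<open>r\<close>). Such a sequence is bounded by the powers of \<open>1 + L\<close>.\<close>

lemma weierstrass_quotient_bound:
  fixes c :: "nat \<times> nat \<Rightarrow> 'a::{real_normed_field,banach}" and m :: nat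
  assumes c: "dps_norm_le r c B" and r: "0 < r"
  defines "L \<equiv> B / r ^ m"
  shows "(\<Sum>k<K. norm (weierstrass_quotient c m j k) * r ^ k) \<le> ((1 + L) / r) ^ j"
proof (induction j arbitrary: K rule: less_induct)
  case (less j)
  have B: "0 \<le> B" using c by (rule dps_norm_le_nonneg)
  have L: "0 \<le> L" using B r by (simp add: L_def)
  show ?case
  proof (cases j)
    case 0
    have "(\<Sum>k<K. norm (weierstrass_quotient c m 0 k) * r ^ k) = (\<Sum>k<K. if k = 0 then 1 else 0)"
      by (rule sum.cong) auto
    also have "\<dots> \<le> 1" by simp
    finally show ?thesis by (simp add: 0)
  next
    case (Suc j')
    define q where "q = weierstrass_quotient c m"
    have row: "(\<Sum>k<K'. norm (c (i, k)) * r ^ k) \<le> B / r ^ i" for i K'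
    proof -
      have "(\<Sum>k<K'. norm (c (i, k)) * r ^ k) * r ^ i
          = (\<Sum>(j, k)\<in>(\<lambda>k. (i, k)) ` {..<K'}. norm (c (j, k)) * r ^ (j + k))"
        by (subst sum.reindex) (auto simp: inj_on_def sum_distrib_left sum_distrib_right power_add mult_ac)
      also have "\<dots> \<le> B" by (intro dps_norm_le_sum[OF c]) auto
      finally show ?thesis using r by (simp add: field_simps)
    qed
    have conv: "(\<Sum>k<K. \<Sum>l\<le>k + m. norm (q i l) * norm (c (Suc j' - i, k + m - l)) * r ^ k)
        \<le> ((1 + L) / r) ^ i * (B / r ^ (Suc j' - i)) / r ^ m" if i: "i \<le> j'" for i
    proof -
      have "norm (q i l) * norm (c (Suc j' - i, k + m - l)) * r ^ k
          = (norm (q i l) * r ^ l) * (norm (c (Suc j' - i, k + m - l)) * r ^ (k + m - l)) / r ^ m"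
        if "l \<le> k + m" for k l
      proof -
        have "r ^ l * r ^ (k + m - l) = r ^ k * r ^ m"
          using that by (simp flip: power_add)
        then have "r ^ k = r ^ l * r ^ (k + m - l) / r ^ m" using r by (simp add: field_simps)
        then show ?thesis by (simp only: times_divide_eq_right mult_ac)
      qed
      then have "(\<Sum>k<K. \<Sum>l\<le>k + m. norm (q i l) * norm (c (Suc j' - i, k + m - l)) * r ^ k)
        = (\<Sum>k<K. \<Sum>l\<le>k + m. (norm (q i l) * r ^ l) * (norm (c (Suc j' - i, k + m - l)) * r ^ (k + m - l))) / r ^ m"
        by (simp add: sum_divide_distrib)
      also have "\<dots> \<le> ((\<Sum>l<K + m. norm (q i l) * r ^ l) * (\<Sum>l<K + m. norm (c (Suc j' - i, l)) * r ^ l)) / r ^ m"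
        using r by (intro divide_right_mono
            shifted_convolution_le[of "\<lambda>l. norm (q i l) * r ^ l" "\<lambda>l. norm (c (Suc j' - i, l)) * r ^ l"]) auto
      also have "\<dots> \<le> (((1 + L) / r) ^ i * (B / r ^ (Suc j' - i))) / r ^ m"
        using r L B less.IH[of i "K + m"] i row Suc unfolding q_def
        by (intro divide_right_mono mult_mono) (auto intro!: sum_nonneg)
      finally show ?thesis by simp
    qed
    have "(\<Sum>k<K. norm (q (Suc j') k) * r ^ k)
       \<le> (\<Sum>k<K. \<Sum>i\<le>j'. \<Sum>l\<le>k + m. norm (q i l) * norm (c (Suc j' - i, k + m - l)) * r ^ k)"
    proof (rule sum_mono)
      fix k
      have "norm (q (Suc j') k) \<le> (\<Sum>i\<le>j'. \<Sum>l\<le>k + m. norm (q i l) * norm (c (Suc j' - i, k + m - l)))"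
        unfolding q_def weierstrass_quotient.simps norm_minus_cancel
        by (intro order_trans[OF norm_sum] sum_mono) (simp add: norm_mult)
      then have "norm (q (Suc j') k) * r ^ k
          \<le> (\<Sum>i\<le>j'. \<Sum>l\<le>k + m. norm (q i l) * norm (c (Suc j' - i, k + m - l))) * r ^ k"
        using r by (intro mult_right_mono) auto
      then show "norm (q (Suc j') k) * r ^ k
          \<le> (\<Sum>i\<le>j'. \<Sum>l\<le>k + m. norm (q i l) * norm (c (Suc j' - i, k + m - l)) * r ^ k)"
        by (simp add: sum_distrib_right)
    qed
    also have "\<dots> = (\<Sum>i\<le>j'. \<Sum>k<K. \<Sum>l\<le>k + m. norm (q i l) * norm (c (Suc j' - i, k + m - l)) * r ^ k)"
      by (rule sum.swap)
    also have "\<dots> \<le> (\<Sum>i\<le>j'. ((1 + L) / r) ^ i * (B / r ^ (Suc j' - i)) / r ^ m)"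
      by (intro sum_mono conv) auto
    also have "\<dots> = (\<Sum>i\<le>j'. L * (1 + L) ^ i / r ^ Suc j')"
    proof (rule sum.cong[OF refl])
      fix i assume "i \<in> {..j'}"
      then have "r ^ i * r ^ (Suc j' - i) = r ^ Suc j'" by (simp flip: power_add)
      then have "((1 + L) / r) ^ i * (B / r ^ (Suc j' - i)) = (1 + L) ^ i * B / r ^ Suc j'"
        by (simp only: power_divide times_divide_times_eq)
      then show "((1 + L) / r) ^ i * (B / r ^ (Suc j' - i)) / r ^ m = L * (1 + L) ^ i / r ^ Suc j'"
        by (simp add: L_def mult_ac)
    qed
    also have "\<dots> = ((1 + L) ^ Suc j' - 1) / r ^ Suc j'"
      by (simp only: sum_geometric_le[symmetric] sum_distrib_left sum_divide_distrib)
    also have "\<dots> \<le> ((1 + L) / r) ^ Suc j'"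
      unfolding power_divide using r by (intro divide_right_mono) auto
    finally show ?thesis by (simp add: q_def Suc)
  qed
qed

text \<open>Dividing by the unit \<open>F(0, z) / z^m\<close> achieves \<open>F(0, z) = z^m\<close>; the recursive quotient then
  converges and is a unit, and the product is the Weierstrass polynomial.\<close>

lemma weierstrass_preparation:
  fixes F :: "'a \<times> 'a \<Rightarrow> 'a::{real_normed_field,banach}"
  assumes F: "has_dps F c" and c: "\<And>k. k < m \<Longrightarrow> c (0, k) = 0" "c (0, m) \<noteq> 0"
  obtains U g where "analytic2 U" "U (0, 0) \<noteq> 0" "\<And>k. k < m \<Longrightarrow> analytic1 (g k)"
    "\<And>k. k < m \<Longrightarrow> g k 0 = 0"
    "\<forall>\<^sub>F (x, z) in nhds (0, 0). F (x, z) = U (x, z) * (z ^ m + (\<Sum>k<m. g k x * z ^ k))"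
proof -
  define A where "A = Abs_fps (\<lambda>k. c (0, k))"
  define u where "u = eval_fps (fps_shift m A)"
  have A: "(\<lambda>z. F (0, z)) has_fps_expansion A"
    unfolding A_def by (rule has_fps_expansion_row[OF F])
  have Am: "A = fps_X ^ m * fps_shift m A"
    by (rule fps_ext) (use c in \<open>auto simp: fps_X_power_mult_nth A_def\<close>)
  have u: "u has_fps_expansion fps_shift m A"
    unfolding u_def using A by (intro eval_fps_has_fps_expansion) (auto simp: has_fps_expansion_def)
  have u0: "u 0 \<noteq> 0" using c by (simp add: u_def eval_fps_at_0 A_def)
  define v where "v y = inverse (u (snd y))" for y :: "'a \<times> 'a"
  have au: "analytic2 (\<lambda>y. u (snd y))" using u by (auto intro!: analytic_intros simp: analytic1_def)
  have v: "analytic2 v" "v (0, 0) \<noteq> 0"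
    unfolding v_def using analytic2_inverse[OF au] u0 by auto
  have "analytic2 (\<lambda>y. F y * v y)" using F v by (intro analytic_intros) (auto simp: analytic2_def)
  then obtain c' where F': "has_dps (\<lambda>y. F y * v y) c'" by (auto simp: analytic2_def)
  have unz: "\<forall>\<^sub>F z in nhds 0. u z \<noteq> 0"
  proof -
    obtain s where "s > 0" "\<And>x z. norm x < s \<Longrightarrow> norm z < s \<Longrightarrow> u (snd (x :: 'a, z)) \<noteq> 0"
      using analytic2_eventually_nonzero[OF au] u0 unfolding eventually_nhds_00 by auto
    from this(1) this(2)[of 0] show ?thesis
      unfolding eventually_nhds_metric by (intro exI[of _ s]) (auto simp: dist_norm)
  qed
  have "\<forall>\<^sub>F z in nhds 0. F (0, z) = z ^ m * u z"
  proof -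
    have "(\<lambda>z. z ^ m * u z) has_fps_expansion fps_X ^ m * fps_shift m A"
      by (intro fps_expansion_intros u)
    then have "\<forall>\<^sub>F z in nhds 0. eval_fps A z = z ^ m * u z"
      unfolding Am[symmetric] by (simp add: has_fps_expansion_def)
    moreover have "\<forall>\<^sub>F z in nhds 0. eval_fps A z = F (0, z)"
      using A by (simp add: has_fps_expansion_def)
    ultimately show ?thesis by eventually_elim simp
  qed
  with unz have "\<forall>\<^sub>F z in nhds 0. F (0, z) * v (0, z) = poly (monom 1 m) z"
    by eventually_elim (simp add: v_def poly_monom)
  from dps_row_eq_poly[OF F' this]
  have c': "c' (0, k) = (if k = m then 1 else 0)" for k by simp
  obtain r B where r: "0 < r" "dps_norm_le r c' B"
    by (rule has_dpsE[OF F']) (rule that)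
  define q where "q = weierstrass_quotient c' m"
  define q2 where "q2 = (\<lambda>(j, k). q j k)"
  define L where "L = B / r ^ m"
  have L: "0 \<le> L" using dps_norm_le_nonneg[OF r(2)] r(1) by (simp add: L_def)
  define Q where "Q = (\<lambda>(x, z). dps_eval q2 x z)"
  have Q: "has_dps Q q2"
  proof (rule has_dps_geometricI[of q2 1 "(1 + L) / r" 1])
    fix j k
    have "norm (q j k) * r ^ k \<le> (\<Sum>k<Suc k. norm (q j k) * r ^ k)"
      using r by (intro member_le_sum) auto
    also have "\<dots> \<le> ((1 + L) / r) ^ j"
      unfolding q_def L_def by (rule weierstrass_quotient_bound[OF r(2,1)])
    finally have "norm (q j k) \<le> ((1 + L) / r) ^ j * (1 / r) ^ k"
      using r by (simp add: field_simps)
    also have "\<dots> \<le> ((1 + L) / r) ^ j * ((1 + L) / r) ^ k"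
      using r L by (intro mult_left_mono power_mono divide_right_mono) auto
    finally show "norm (q2 (j, k)) \<le> 1 * ((1 + L) / r) ^ (j + k)"
      by (simp add: q2_def power_add)
  qed (use r L in \<open>auto simp: Q_def\<close>)
  define R where "R y = Q y * (F y * v y)" for y
  define e where "e = cauchy2 q2 c'"
  have R: "has_dps R e" unfolding R_def e_def by (rule has_dps_mult[OF Q F'])
  have e: "e (n, k) = (\<Sum>i\<le>n. \<Sum>l\<le>k. q i l * c' (n - i, k - l))" for n k
    by (simp add: e_def cauchy2_def q2_def sum.cartesian_product case_prod_unfold)
  have top: "(\<Sum>l\<le>k. q n l * c' (0, k - l)) = (if m \<le> k then q n (k - m) else 0)" for n k
  proof -
    have "(\<Sum>l\<le>k. q n l * c' (0, k - l)) = (\<Sum>l\<le>k. if k = m + l then q n l else 0)"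
      by (rule sum.cong) (auto simp: c')
    also have "\<dots> = (\<Sum>l\<in>{l. l \<le> k \<and> k = m + l}. q n l)"
      by (subst sum.inter_filter[symmetric]) (auto simp: atMost_def)
    also have "{l. l \<le> k \<and> k = m + l} = (if m \<le> k then {k - m} else {})" by auto
    finally show ?thesis by simp
  qed
  have e0: "e (0, k) = (if k = m then 1 else 0)" for k
  proof -
    have "e (0, k) = (\<Sum>l\<le>k. q 0 l * c' (0, k - l))" by (simp add: e)
    also have "\<dots> = (if k = m then 1 else 0)" unfolding top by (auto simp: q_def)
    finally show ?thesis .
  qed
  have eS: "e (Suc n, k) = 0" if mk: "m \<le> k" for n k
  proof -
    obtain k' where k: "k = k' + m" using le_Suc_ex[OF mk] by (auto simp: add.commute)
    have "e (Suc n, k) = (\<Sum>i\<le>n. \<Sum>l\<le>k. q i l * c' (Suc n - i, k - l)) + (\<Sum>l\<le>k. q (Suc n) l * c' (0, k - l))"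
      by (simp add: e)
    also have "\<dots> = - q (Suc n) k' + q (Suc n) k'"
      by (subst top) (simp add: k q_def)
    finally show ?thesis by simp
  qed
  have ek: "e (n, k) = 0" if "m < k" for n k
    using e0[of k] eS[of k] that by (cases n) auto
  have em: "e (n, m) = (if n = 0 then 1 else 0)" for n
    using e0[of m] eS[of m] by (cases n) auto
  define g where "g k = eval_fps (dps_slice e k)" for k
  have g: "g k has_fps_expansion dps_slice e k" for k
    unfolding g_def by (rule has_fps_expansion_slice(1)[OF R])
  obtain s where s: "s > 0"
    and sl: "\<And>x z. norm x < s \<Longrightarrow> norm z < s \<Longrightarrow> ((\<lambda>k. g k x * z ^ k) has_sum R (x, z)) UNIV"
    by (rule has_dps_slices[OF R, folded g_def]) (rule that)
  have gm: "g m x = 1" "k > m \<Longrightarrow> g k x = 0" for x k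
  proof -
    have "dps_slice e m = 1" by (rule fps_ext) (simp add: dps_slice_def em)
    then show "g m x = 1" by (simp add: g_def)
    assume "k > m"
    then have "dps_slice e k = 0" by (intro fps_ext) (simp add: dps_slice_def ek)
    then show "g k x = 0" by (simp add: g_def)
  qed
  have Rpoly: "R (x, z) = z ^ m + (\<Sum>k<m. g k x * z ^ k)" if "norm x < s" "norm z < s" for x z
  proof -
    have "((\<lambda>k. g k x * z ^ k) has_sum (\<Sum>k\<le>m. g k x * z ^ k)) UNIV"
      by (rule has_sum_finite_neutralI[of "{..m}"]) (auto simp: gm)
    then have "R (x, z) = (\<Sum>k\<le>m. g k x * z ^ k)"
      by (rule has_sum_unique[OF sl[OF that]])
    then show ?thesis by (simp add: gm lessThan_Suc_atMost[symmetric])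
  qed
  have Q0: "Q (0, 0) = 1" using has_dps_at_0[OF Q] by (simp add: q2_def q_def)
  define U where "U y = inverse (Q y * v y)" for y
  have aQv: "analytic2 (\<lambda>y. Q y * v y)" using Q v by (intro analytic_intros) (auto simp: analytic2_def)
  have Qv: "Q (0, 0) * v (0, 0) \<noteq> 0" using Q0 v by simp
  show ?thesis
  proof (rule that[of U g])
    show "analytic2 U" unfolding U_def by (rule analytic2_inverse[OF aQv Qv])
    show "U (0, 0) \<noteq> 0" using Qv by (simp add: U_def)
    show "analytic1 (g k)" for k using g by (auto simp: analytic1_def)
    show "g k 0 = 0" if "k < m" for k
      using that by (simp add: g_def eval_fps_at_0 dps_slice_def e0)
    have "\<forall>\<^sub>F (x, z) in nhds (0, 0). R (x, z) = z ^ m + (\<Sum>k<m. g k x * z ^ k)"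
      unfolding eventually_nhds_00 using s Rpoly by (intro exI[of _ s]) auto
    then show "\<forall>\<^sub>F (x, z) in nhds (0, 0). F (x, z) = U (x, z) * (z ^ m + (\<Sum>k<m. g k x * z ^ k))"
      using analytic2_eventually_nonzero[OF aQv Qv]
      by eventually_elim (auto simp: U_def R_def field_simps)
  qed
qed

lemma eventually_analytic1_tendsto:
  assumes "analytic1 r" "r 0 = 0" "\<forall>\<^sub>F (x, z) in nhds (0, 0). P x z"
  shows "\<forall>\<^sub>F x in nhds 0. P x (r x)"
proof -
  obtain A where "r has_fps_expansion A" using assms(1) by (auto simp: analytic1_def)
  from has_fps_expansion_imp_continuous[OF this, of UNIV]
  have "(r \<longlongrightarrow> r 0) (at 0)" by (simp add: continuous_within)
  then have r: "(r \<longlongrightarrow> 0) (nhds 0)"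
    unfolding assms(2) using assms(2) tendsto_at_iff_tendsto_nhds[of r 0] by simp
  have "((\<lambda>x. (x, r x)) \<longlongrightarrow> (0, 0)) (nhds 0)"
    by (intro tendsto_Pair r filterlim_ident)
  from eventually_compose_filterlim[OF assms(3) this] show ?thesis by simp
qed

lemma eventually_analytic2_pair:
  assumes "analytic2 \<phi>" "analytic2 \<psi>" "\<phi> (0, 0) = 0" "\<psi> (0, 0) = 0" "\<forall>\<^sub>F (x, z) in nhds (0, 0). P x z"
  shows "\<forall>\<^sub>F y in nhds (0, 0). P (\<phi> y) (\<psi> y)"
proof -
  have "((\<lambda>y. (\<phi> y, \<psi> y)) \<longlongrightarrow> (0, 0)) (nhds (0, 0))"
    using analytic2_tendsto[OF assms(1)] analytic2_tendsto[OF assms(2)] assms by (intro tendsto_Pair) auto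
  from eventually_compose_filterlim[OF assms(5) this] show ?thesis by simp
qed

text \<open>The preparation theorem for \<open>m = 1\<close>.\<close>

lemma implicit_function:
  fixes F :: "'a \<times> 'a \<Rightarrow> 'a::{real_normed_field,banach}"
  assumes F: "has_dps F c" and c: "c (0, 0) = 0" "c (0, 1) \<noteq> 0"
  obtains r where "analytic1 r" "r 0 = 0" "\<forall>\<^sub>F x in nhds 0. F (x, r x) = 0"
proof -
  obtain U g where g: "analytic1 (g (0 :: nat))" "g 0 0 = 0"
    and ev: "\<forall>\<^sub>F (x, z) in nhds (0, 0). F (x, z) = U (x, z) * (z ^ 1 + (\<Sum>k<1. g k x * z ^ k))"
  proof (rule weierstrass_preparation[OF F, of 1])
    fix U :: "'a \<times> 'a \<Rightarrow> 'a" and g :: "nat \<Rightarrow> 'a \<Rightarrow> 'a"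
    assume 1: "\<And>k. k < 1 \<Longrightarrow> analytic1 (g k)" "\<And>k. k < 1 \<Longrightarrow> g k 0 = 0"
      and 2: "\<forall>\<^sub>F (x, z) in nhds (0, 0). F (x, z) = U (x, z) * (z ^ 1 + (\<Sum>k<1. g k x * z ^ k))"
    show thesis using 1 by (intro that[OF _ _ 2]) simp_all
  qed (use c in simp_all)
  obtain G where G: "g 0 has_fps_expansion G" using g by (auto simp: analytic1_def)
  have "(\<lambda>x. - g 0 x) has_fps_expansion - G" using G by (rule has_fps_expansion_minus)
  then have r: "analytic1 (\<lambda>x. - g 0 x)" by (auto simp: analytic1_def)
  show ?thesis
  proof (rule that[OF r])
    show "\<forall>\<^sub>F x in nhds 0. F (x, - g 0 x) = 0"
      using eventually_analytic1_tendsto[OF r _ ev] g by simp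
  qed (use g in simp)
qed

text \<open>By Taylor's formula the coefficient of \<open>z^(n-1)\<close> of the shifted function is the divided derivative
  of order \<open>n - 1\<close> evaluated along the graph of \<open>r\<close>. This derivative has a simple zero in \<open>z\<close> at the
  origin, so \<open>r\<close> can be chosen as its analytic zero.\<close>

lemma tschirnhaus:
  fixes F :: "'a \<times> 'a \<Rightarrow> 'a::{real_normed_field,banach}"
  assumes F: "has_dps F c" and n: "0 < n" and c: "\<And>k. k < n \<Longrightarrow> c (0, k) = 0" "c (0, n) \<noteq> 0"
  obtains r c2 where "analytic1 r" "r 0 = 0" "has_dps (\<lambda>(x, z). F (x, z + r x)) c2"
    "\<And>j. c2 (j, n - 1) = 0" "\<And>k. c2 (0, k) = c (0, k)"
proof -
  define m where "m = n - 1"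
  have nm: "n = Suc m" using n by (simp add: m_def)
  define e where "e = (\<lambda>(i, l). of_nat ((l + m) choose m) * c (i, l + m))"
  obtain G where G: "has_dps G e"
    using hasse_derivative[OF F, of m] unfolding e_def by blast
  have "e (0, 0) = 0" "e (0, 1) \<noteq> 0" using c nm of_nat_neq_0[of m, where ?'a = 'a] by (auto simp: e_def simp del: of_nat_Suc)
  then obtain r where r: "analytic1 r" "r 0 = 0" "\<forall>\<^sub>F x in nhds 0. G (x, r x) = 0"
    by (rule implicit_function[OF G]) (rule that)
  have aF: "analytic2 F" using F by (auto simp: analytic2_def)
  have "analytic2 (\<lambda>y. F (fst y, snd y + r (fst y)))"
    by (rule analytic2_compose[OF aF]) (use r in \<open>auto intro!: analytic_intros\<close>)
  then obtain c2 where F2: "has_dps (\<lambda>(x, z). F (x, z + r x)) c2"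
    by (auto simp: analytic2_def case_prod_unfold)
  obtain s B where s: "s > 0"
    and s1: "\<And>k x. norm x < s \<Longrightarrow> (\<lambda>j. c (j, k) * x ^ j) sums eval_fps (dps_slice c k) x"
    and s2: "\<And>x z. norm x < s \<Longrightarrow> norm z < s \<Longrightarrow> ((\<lambda>k. eval_fps (dps_slice c k) x * z ^ k) has_sum F (x, z)) UNIV"
    and s3: "\<And>x k. norm x < s \<Longrightarrow> norm (eval_fps (dps_slice c k) x) \<le> B * (1 / s) ^ k"
    by (rule has_dps_slices[OF F]) (rule that)
  obtain t where t: "t > 0"
    and t1: "\<And>k x. norm x < t \<Longrightarrow> (\<lambda>j. e (j, k) * x ^ j) sums eval_fps (dps_slice e k) x"
    and t2: "\<And>x z. norm x < t \<Longrightarrow> norm z < t \<Longrightarrow> ((\<lambda>k. eval_fps (dps_slice e k) x * z ^ k) has_sum G (x, z)) UNIV"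
    by (rule has_dps_slices[OF G]) (rule that)
  obtain t' where t': "t' > 0"
    and t2': "\<And>x z. norm x < t' \<Longrightarrow> norm z < t' \<Longrightarrow> ((\<lambda>k. eval_fps (dps_slice c2 k) x * z ^ k) has_sum F (x, z + r x)) UNIV"
    by (rule has_dps_slices[OF F2]) (rule that, auto)
  have "\<forall>\<^sub>F (x, z) in nhds (0, 0). norm (x :: 'a) < min s (min t t') \<and> norm (z :: 'a) < min (s / 2) t"
    unfolding eventually_nhds_00 using s t t'
    by (intro exI[of _ "min (min (s / 2) s) (min t t')"]) auto
  from eventually_analytic1_tendsto[OF r(1,2) this] r(3)
  have "\<forall>\<^sub>F x in nhds 0. eval_fps (dps_slice c2 m) x = 0"
  proof eventually_elim
    case (elim x)
    define C where "C k = eval_fps (dps_slice c k) x" for k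
    define \<rho> where "\<rho> = min (s / 2 - norm (r x)) (min t' (s / 2))"
    have \<rho>: "\<rho> > 0" using elim t' s by (auto simp: \<rho>_def)
    have E: "eval_fps (dps_slice e l) x = of_nat ((l + m) choose m) * C (l + m)" for l
    proof -
      have "(\<lambda>j. of_nat ((l + m) choose m) * (c (j, l + m) * x ^ j)) sums (of_nat ((l + m) choose m) * C (l + m))"
        unfolding C_def by (intro sums_mult s1) (use elim in auto)
      moreover have "(\<lambda>j. of_nat ((l + m) choose m) * (c (j, l + m) * x ^ j)) sums eval_fps (dps_slice e l) x"
        using t1[of x l] elim by (simp add: e_def mult.assoc)
      ultimately show ?thesis by (rule sums_unique2[symmetric])
    qed
    have hs0: "((\<lambda>l. of_nat ((l + m) choose m) * C (l + m) * r x ^ l) has_sum 0) UNIV"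
      using t2[of x "r x"] elim unfolding E by simp
    have hs: "((\<lambda>k. (eval_fps (dps_slice c2 k) x - (\<Sum>\<^sub>\<infinity>l. of_nat ((l + k) choose k) * C (l + k) * r x ^ l)) * w ^ k) has_sum 0) UNIV"
      if w: "norm w < \<rho>" for w
    proof -
      have nw: "norm (w + r x) < s" using norm_triangle_ineq[of w "r x"] w elim by (auto simp: \<rho>_def)
      have 1: "((\<lambda>k. C k * (w + r x) ^ k) has_sum F (x, w + r x)) UNIV"
        unfolding C_def by (rule s2) (use elim nw in auto)
      have 2: "((\<lambda>k. (\<Sum>\<^sub>\<infinity>l. of_nat ((l + k) choose k) * C (l + k) * r x ^ l) * w ^ k) has_sum F (x, w + r x)) UNIV"
      proof (rule taylor_shift[OF _ _ _ 1])
        show "norm (C l) \<le> B * (1 / s) ^ l" for l unfolding C_def by (rule s3) (use elim in auto)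
        show "1 / s * (norm w + norm (r x)) < 1" using w s by (simp add: \<rho>_def)
      qed (use s in auto)
      have 3: "((\<lambda>k. eval_fps (dps_slice c2 k) x * w ^ k) has_sum F (x, w + r x)) UNIV"
        by (rule t2') (use elim w in \<open>auto simp: \<rho>_def\<close>)
      show ?thesis using has_sum_add[OF 3 has_sum_uminusI[OF 2]] by (simp add: algebra_simps)
    qed
    have "eval_fps (dps_slice c2 m) x - (\<Sum>\<^sub>\<infinity>l. of_nat ((l + m) choose m) * C (l + m) * r x ^ l) = 0"
      by (rule powser_eq_0_on_reals[OF \<rho>]) (rule has_sum_imp_sums[OF hs], simp)
    moreover have "(\<Sum>\<^sub>\<infinity>l. of_nat ((l + m) choose m) * C (l + m) * r x ^ l) = 0"
      using hs0 by (rule infsumI)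
    ultimately show ?case by simp
  qed
  from fps_expansion_unique_eventually[OF has_fps_expansion_slice(1)[OF F2] has_fps_expansion_0 this]
  have "dps_slice c2 m = 0" .
  then have "c2 (j, m) = 0" for j by (metis dps_slice_def fps_nth_Abs_fps fps_zero_nth)
  moreover have "c2 (0, k) = c (0, k)" for k
    by (rule dps_row_eq[OF F2 F]) (simp add: r(2))
  ultimately show ?thesis using that[OF r(1,2) F2] by (simp add: m_def)
qed

section \<open>Puiseux's theorem\<close>

lemma analytic1_iff: "analytic1 g \<longleftrightarrow> analytic2 (\<lambda>y. g (fst y))"
  using analytic2_fst'[of g] analytic1_slice[of "\<lambda>y. g (fst y)"] by auto

lemma analytic1_compose2:
  assumes "analytic2 F" "analytic1 \<phi>" "analytic1 \<psi>" "\<phi> 0 = 0" "\<psi> 0 = 0"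
  shows "analytic1 (\<lambda>t. F (\<phi> t, \<psi> t))"
  unfolding analytic1_iff
  by (rule analytic2_compose[OF assms(1)]) (use assms in \<open>auto intro!: analytic_intros\<close>)

lemma analytic1_compose:
  assumes "analytic1 g" "analytic1 \<phi>" "\<phi> 0 = 0"
  shows "analytic1 (\<lambda>t. g (\<phi> t))"
  using analytic1_compose2[OF analytic2_fst'[OF assms(1)] assms(2) assms(2) assms(3) assms(3)] by simp

lemma analytic1_const [analytic_intros]: "analytic1 (\<lambda>_. a)"
  and analytic1_id [analytic_intros]: "analytic1 (\<lambda>x. x)"
  and analytic1_add [analytic_intros]: "analytic1 f \<Longrightarrow> analytic1 g \<Longrightarrow> analytic1 (\<lambda>x. f x + g x)"
  and analytic1_diff [analytic_intros]: "analytic1 f \<Longrightarrow> analytic1 g \<Longrightarrow> analytic1 (\<lambda>x. f x - g x)"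
  and analytic1_mult [analytic_intros]: "analytic1 f \<Longrightarrow> analytic1 g \<Longrightarrow> analytic1 (\<lambda>x. f x * g x)"
  and analytic1_uminus [analytic_intros]: "analytic1 f \<Longrightarrow> analytic1 (\<lambda>x. - f x)"
  and analytic1_power [analytic_intros]: "analytic1 f \<Longrightarrow> analytic1 (\<lambda>x. f x ^ n)"
  unfolding analytic1_iff
  by (rule analytic2_const, rule analytic2_fst, erule (1) analytic2_add, erule (1) analytic2_diff,
      erule (1) analytic2_mult, erule analytic2_uminus, erule analytic2_power)

lemma analytic1_tendsto:
  assumes "analytic1 r" shows "(r \<longlongrightarrow> r 0) (nhds 0)"
proof -
  obtain A where "r has_fps_expansion A" using assms(1) by (auto simp: analytic1_def)
  from has_fps_expansion_imp_continuous[OF this, of UNIV]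
  have "(r \<longlongrightarrow> r 0) (at 0)" by (simp add: continuous_within)
  then show ?thesis using tendsto_at_iff_tendsto_nhds[of r 0] by simp
qed

lemma eventually_analytic1_norm_less:
  assumes "analytic1 r" "r 0 = 0" "0 < \<rho>"
  shows "\<forall>\<^sub>F x in nhds 0. norm (r x) < \<rho>"
  using order_tendstoD(2)[OF tendsto_norm_zero[of r "nhds 0"], of \<rho>] analytic1_tendsto[OF assms(1)] assms by simp

text \<open>A multiple of \<open>(z - b)^n\<close> has a subleading coefficient proportional to \<open>n b\<close> and, for \<open>b = 0\<close>, no
  lower terms at all. After a Tschirnhaus transformation this makes multiplicities drop.\<close>

lemma order_less_degree:
  fixes p :: "'a::field_char_0 poly"
  assumes "degree p = n" "0 < n" "coeff p (n - 1) = 0" "b \<noteq> 0 \<or> (\<exists>k<n. coeff p k \<noteq> 0)"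
  shows "order b p < n"
proof (rule ccontr)
  assume "\<not> order b p < n"
  have p0: "p \<noteq> 0" using assms by auto
  then have ord: "order b p = n" using order_degree[OF p0, of b] \<open>\<not> order b p < n\<close> assms(1) by simp
  obtain r where r: "p = [:- b, 1:] ^ n * r"
    using order_decomp[OF p0, of b] unfolding ord by blast
  then have "r \<noteq> 0" using p0 by auto
  then have "degree p = n + degree r" unfolding r by (simp add: degree_mult_eq degree_linear_power)
  then obtain a where a: "r = [:a:]" using assms(1) degree_eq_zeroE[of r] by auto
  have c: "coeff p k = of_nat (n choose k) * (- b) ^ (n - k) * a" if "k \<le> n" for k
    using that by (simp add: r a coeff_linear_poly_power mult_ac)
  have a0: "a \<noteq> 0" using \<open>r \<noteq> 0\<close> a by auto
  have "of_nat (n choose (n - 1)) * (- b) * a = 0"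
    using c[of "n - 1"] assms(2,3) by simp
  moreover have "n choose (n - 1) = n" using assms(2) binomial_symmetric[of 1 n] by simp
  ultimately have "b = 0" using a0 assms(2) by (cases n) (auto simp del: of_nat_Suc)
  with assms(4) obtain k where "k < n" "coeff p k \<noteq> 0" by auto
  with c[of k] \<open>b = 0\<close> show False by simp
qed

text \<open>Minimality of the fraction \<open>j / (n - k)\<close>. Multiplication by \<open>n!\<close>, which all denominators divide,
  turns the fractions into natural numbers.\<close>

lemma minimal_slope:
  fixes S :: "(nat \<times> nat) set"
  assumes "S \<noteq> {}" "\<And>j k. (j, k) \<in> S \<Longrightarrow> k < n"
  obtains j0 k0 where "(j0, k0) \<in> S" "\<And>j k. (j, k) \<in> S \<Longrightarrow> j0 * (n - k) \<le> j * (n - k0)"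
proof -
  define \<mu> where "\<mu> = (\<lambda>(j, k). j * (fact n div (n - k)) :: nat)"
  obtain x where x: "x \<in> S" "\<And>y. y \<in> S \<Longrightarrow> \<mu> x \<le> \<mu> y"
    using ex_has_least_nat[of "\<lambda>x. x \<in> S" _ \<mu>] assms(1) by blast
  obtain j0 k0 where [simp]: "x = (j0, k0)" by force
  have f: "fact n = (n - k) * (fact n div (n - k))" if "(j, k) \<in> S" for j k
  proof -
    have "n - k dvd fact n" using assms(2)[OF that] by (intro dvd_fact) auto
    then show ?thesis by simp
  qed
  show ?thesis
  proof (rule that[of j0 k0])
    show "(j0, k0) \<in> S" using x by simp
    fix j k assume jk: "(j, k) \<in> S"
    define d0 d where "d0 = (fact n div (n - k0) :: nat)" and "d = (fact n div (n - k) :: nat)"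
    have le: "j0 * d0 \<le> j * d" using x(2)[OF jk] by (simp add: \<mu>_def d0_def d_def)
    have 1: "fact n = (n - k0) * d0" "fact n = (n - k) * d"
      using f[of j0 k0] f[OF jk] x unfolding d0_def d_def by auto
    have "(j0 * (n - k)) * fact n = (n - k) * (n - k0) * (j0 * d0)" by (simp add: 1(1))
    also have "\<dots> \<le> (n - k) * (n - k0) * (j * d)" using le by (rule mult_left_mono) simp
    also have "\<dots> = (j * (n - k0)) * fact n" by (simp add: 1(2))
    finally show "j0 * (n - k) \<le> j * (n - k0)" by simp
  qed
qed

text \<open>Blowing up at a root of multiplicity \<open>n\<close> of the edge polynomial yields a function of order \<open>n\<close> in
  \<open>w\<close> at the origin.\<close>

lemma blow_up_row:
  fixes F :: "'a \<times> 'a \<Rightarrow> 'a::{real_normed_field,banach}"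
  assumes "has_dps F c" "0 < q" "0 < u" "\<And>j k. c (j, k) \<noteq> 0 \<Longrightarrow> N \<le> q * j + u * k"
    and p: "edge_poly c q u N \<noteq> 0"
  obtains H D \<rho> where "has_dps H D" "0 < \<rho>"
    "\<And>s w. norm s < \<rho> \<Longrightarrow> norm w < \<rho> \<Longrightarrow> F (s ^ q, s ^ u * (b + w)) = s ^ N * H (s, w)"
    "\<And>k. k < order b (edge_poly c q u N) \<Longrightarrow> D (0, k) = 0"
    "D (0, order b (edge_poly c q u N)) \<noteq> 0"
proof -
  obtain H D \<rho> where H: "has_dps H D" "0 < \<rho>"
    "\<And>s w. norm s < \<rho> \<Longrightarrow> norm w < \<rho> \<Longrightarrow> F (s ^ q, s ^ u * (b + w)) = s ^ N * H (s, w)"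
    "\<And>w. norm w < \<rho> \<Longrightarrow> H (0, w) = poly (edge_poly c q u N) (b + w)"
    by (rule blow_up[OF assms(1-4), of b]) (assumption, rule that)
  have "\<forall>\<^sub>F w in nhds 0. H (0, w) = poly (pcompose (edge_poly c q u N) [:b, 1:]) w"
    using H(2,4) by (auto simp: eventually_nhds_metric poly_pcompose intro!: exI[of _ \<rho>])
  from dps_row_eq_poly[OF H(1) this] show ?thesis
    using that[OF H(1-3)] order_pcompose_shift[OF p] by simp
qed

text \<open>Induction on the order \<open>n\<close> of \<open>F(0, z)\<close>. After a Tschirnhaus transformation either \<open>z = 0\<close> is a
  root, or the edge that descends from the point \<open>(0, n)\<close> has an edge polynomial of degree \<open>n\<close> with a
  further term but no term of degree \<open>n - 1\<close>. Then all its roots have multiplicity less than \<open>n\<close>,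
  and a blow-up at one of them leads to a function of smaller order.\<close>

lemma puiseux_root_exists:
  fixes F :: "complex \<times> complex \<Rightarrow> complex"
  assumes "has_dps F c" "0 < n" "\<And>k. k < n \<Longrightarrow> c (0, k) = 0" "c (0, n) \<noteq> 0"
  shows "\<exists>p A. 0 < p \<and> analytic1 A \<and> A 0 = 0 \<and> (\<forall>\<^sub>F t in nhds 0. F (t ^ p, A t) = 0)"
  using assms
proof (induction n arbitrary: F c rule: less_induct)
  case (less n)
  obtain r c2 where r: "analytic1 r" "r 0 = 0" and F2: "has_dps (\<lambda>(x, z). F (x, z + r x)) c2"
    and sub: "\<And>j. c2 (j, n - 1) = 0" and row: "\<And>k. c2 (0, k) = c (0, k)"
    by (rule tschirnhaus[OF less.prems]) (assumption, rule that)
  show ?case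
  proof (cases "\<forall>j. c2 (j, 0) = 0")
    case True
    then have "dps_slice c2 0 = 0" by (intro fps_ext) (simp add: dps_slice_def)
    with has_fps_expansion_slice(2)[OF F2] have "(\<lambda>x. F (x, r x)) has_fps_expansion 0" by simp
    then have "\<forall>\<^sub>F x in nhds 0. F (x, r x) = 0" by (auto simp: has_fps_expansion_def elim: eventually_mono)
    then show ?thesis using r by (intro exI[of _ 1] exI[of _ r]) simp
  next
    case False
    define S where "S = {(j, k). c2 (j, k) \<noteq> 0 \<and> k < n}"
    have "S \<noteq> {}" using False less.prems(2) by (auto simp: S_def)
    then obtain u k0 where uk: "(u, k0) \<in> S" "\<And>j k. (j, k) \<in> S \<Longrightarrow> u * (n - k) \<le> j * (n - k0)"
      by (rule minimal_slope[of S n]) (auto simp: S_def intro: that)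
    define q where "q = n - k0"
    define N where "N = u * n"
    have k0: "k0 < n" "c2 (u, k0) \<noteq> 0" using uk by (auto simp: S_def)
    have q: "0 < q" using k0 by (simp add: q_def)
    have u: "0 < u" using k0 row[of k0] less.prems(3)[of k0] by (cases u) auto
    have supp: "N \<le> q * j + u * k" if "c2 (j, k) \<noteq> 0" for j k
    proof (cases "k < n")
      case True
      have "u * n = u * (n - k) + u * k" using True by (simp flip: add_mult_distrib2)
      with uk(2)[of j k] that True show ?thesis by (simp add: S_def N_def q_def mult.commute)
    next
      case False
      then have "u * n \<le> u * k" by simp
      then show ?thesis unfolding N_def by (rule trans_le_add2)
    qed
    define p where "p = edge_poly c2 q u N"
    have pn: "coeff p n \<noteq> 0"
      using coeff_edge_poly(1)[OF q u, of 0 n N c2] row less.prems(4) by (simp add: p_def N_def)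
    have phi: "coeff p k = 0" if "n < k" for k
      unfolding p_def
    proof (rule coeff_edge_poly(2)[OF q u])
      fix j have "u * n < u * k" using that u by simp
      then show "q * j + u * k \<noteq> N" unfolding N_def by linarith
    qed
    have deg: "degree p = n"
      by (rule antisym[OF degree_le le_degree]) (use phi pn in auto)
    have psub: "coeff p (n - 1) = 0"
      using coeff_edge_poly[OF q u] sub unfolding p_def by metis
    have pk0: "coeff p k0 \<noteq> 0"
    proof -
      have "q * u + u * k0 = N" using k0 by (simp add: q_def N_def mult.commute[of "n - k0"] flip: add_mult_distrib2)
      from coeff_edge_poly(1)[OF q u this, of c2] k0 show ?thesis by (simp add: p_def)
    qed
    have p0: "p \<noteq> 0" using pn by auto
    have "\<not> constant (poly p)" using deg less.prems(2) by (simp add: constant_degree)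
    then obtain b where b: "poly p b = 0" using fundamental_theorem_of_algebra by blast
    define n' where "n' = order b p"
    have n': "0 < n'" "n' < n"
      using b p0 order_root[of p b] order_less_degree[OF deg less.prems(2) psub, of b] pk0 k0
      by (auto simp: n'_def)
    obtain H D \<rho> where H: "has_dps H D" "0 < \<rho>"
      "\<And>s w. norm s < \<rho> \<Longrightarrow> norm w < \<rho> \<Longrightarrow>
         (\<lambda>(x, z). F (x, z + r x)) (s ^ q, s ^ u * (b + w)) = s ^ N * H (s, w)"
      "\<And>k. k < n' \<Longrightarrow> D (0, k) = 0" "D (0, n') \<noteq> 0"
      using blow_up_row[OF F2 q u supp p0[unfolded p_def], of b, folded p_def n'_def] by blast
    obtain p' A' where A': "0 < p'" "analytic1 A'" "A' 0 = 0"
      and ev: "\<forall>\<^sub>F t in nhds 0. H (t ^ p', A' t) = 0"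
      using less.IH[OF n'(2) H(1) n'(1) H(4,5)] by blast
    define A where "A t = (t ^ p') ^ u * (b + A' t) + r ((t ^ p') ^ q)" for t
    have "analytic1 (\<lambda>t. r ((t ^ p') ^ q))"
      by (rule analytic1_compose[OF r(1)]) (use A'(1) q in \<open>auto intro!: analytic_intros\<close>)
    then have A: "analytic1 A" "A 0 = 0"
      unfolding A_def using A' u q r by (auto intro!: analytic_intros simp: zero_power)
    have "\<forall>\<^sub>F t in nhds (0 :: complex). norm (t ^ p') < \<rho>"
      using eventually_analytic1_norm_less[of "\<lambda>t. t ^ p'" \<rho>, OF analytic1_power[OF analytic1_id]] A'(1) H(2)
      by (simp add: zero_power)
    moreover have "\<forall>\<^sub>F t in nhds 0. norm (A' t) < \<rho>"
      using eventually_analytic1_norm_less[of A' \<rho>] A' H(2) by auto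
    ultimately have "\<forall>\<^sub>F t in nhds 0. F (t ^ (p' * q), A t) = 0"
      using ev
    proof eventually_elim
      case (elim t)
      with H(3)[of "t ^ p'" "A' t"] show ?case by (simp add: A_def power_mult)
    qed
    then show ?thesis using A A'(1) q by (intro exI[of _ "p' * q"] exI[of _ A]) simp
  qed
qed

section \<open>Leading forms\<close>

definition edge_form :: "(nat \<times> nat \<Rightarrow> real) \<Rightarrow> nat \<Rightarrow> nat \<Rightarrow> nat \<Rightarrow> real \<Rightarrow> real \<Rightarrow> real" where
  "edge_form c q u N y1 y2 = (\<Sum>(j, k)\<in>{(j, k). q * j + u * k = N}. c (j, k) * y1 ^ j * y2 ^ k)"

lemma edge_form_1: "edge_form c q u N 1 w = poly (edge_poly c q u N) w"
  by (simp add: edge_form_def poly_edge_poly)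

lemma edge_form_scale: "edge_form c q u N (s ^ q * y1) (s ^ u * y2) = s ^ N * edge_form c q u N y1 y2"
proof -
  have "s ^ (q * j) * s ^ (u * k) = s ^ N" if "q * j + u * k = N" for j k
    using that by (metis power_add)
  then show ?thesis
    by (auto simp: edge_form_def sum_distrib_left power_mult_distrib power_mult[symmetric] mult_ac intro!: sum.cong)
qed

lemma edge_form_eq_0D:
  assumes "0 < q" "0 < u" "\<And>y1 y2. edge_form c q u N y1 y2 = 0" "q * j + u * k = N"
  shows "c (j, k) = 0"
proof -
  have "\<forall>w. poly (edge_poly c q u N) w = 0" using assms(3) by (simp flip: edge_form_1)
  then have "edge_poly c q u N = 0" by (simp add: poly_all_0_iff_0)
  with coeff_edge_poly(1)[OF assms(1,2,4), of c] show ?thesis by simp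
qed

text \<open>On bounded sets the terms of weight greater than \<open>N\<close> contribute at most a constant times
  \<open>s^(N+1)\<close>, because the weights are integers.\<close>

lemma leading_limit:
  fixes f :: "real \<times> real \<Rightarrow> real"
  assumes f: "has_dps f c" and qu: "0 < q" "0 < u"
    and supp: "\<And>j k. c (j, k) \<noteq> 0 \<Longrightarrow> N \<le> q * j + u * k"
    and Y: "(Y1 \<longlongrightarrow> y1) (at_right 0)" "(Y2 \<longlongrightarrow> y2) (at_right 0)"
  shows "((\<lambda>s. f (s ^ q * Y1 s, s ^ u * Y2 s) / s ^ N) \<longlongrightarrow> edge_form c q u N y1 y2) (at_right 0)"
proof -
  obtain r B where r: "0 < r" "dps_norm_le r c B"
      "\<And>x z. norm x \<le> r \<Longrightarrow> norm z \<le> r \<Longrightarrow> f (x, z) = dps_eval c x z"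
    by (rule has_dpsE[OF f]) (rule that)
  define K where "K = 1 + max \<bar>y1\<bar> \<bar>y2\<bar>"
  have K: "1 \<le> K" "\<bar>y1\<bar> < K" "\<bar>y2\<bar> < K" by (auto simp: K_def)
  define s0 where "s0 = min 1 (r / K)"
  have "s0 * K \<le> r / K * K" using K by (intro mult_right_mono) (auto simp: s0_def)
  then have s0: "0 < s0" "s0 \<le> 1" "s0 * K \<le> r" using r K by (auto simp: s0_def)
  define c' where "c' = (\<lambda>(j, k). if q * j + u * k = N then 0 else c (j, k))"
  define C where "C = B / s0 ^ Suc N"
  have B0: "0 \<le> B" using dps_norm_le_nonneg[OF r(2)] .
  have key: "\<bar>f (s ^ q * a, s ^ u * b) / s ^ N - edge_form c q u N a b\<bar> \<le> C * s"
    if s: "0 < s" "s < s0" and ab: "\<bar>a\<bar> \<le> K" "\<bar>b\<bar> \<le> K" for s a b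
  proof -
    define x z where "x = s ^ q * a" and "z = s ^ u * b"
    have pw: "s ^ n \<le> s0" if "0 < n" for n
      using power_decreasing[of 1 n s] that s s0 by simp
    have xz: "norm x \<le> r" "norm z \<le> r"
      using pw[OF qu(1)] pw[OF qu(2)] s ab s0 K mult_mono[of "s ^ q" s0 "\<bar>a\<bar>" K] mult_mono[of "s ^ u" s0 "\<bar>b\<bar>" K]
      by (auto simp: x_def z_def abs_mult)
    have "((\<lambda>(j, k). c (j, k) * x ^ j * z ^ k) has_sum f (x, z)) UNIV"
      using dps_eval_has_sum[OF r(2) xz] r(3)[OF xz] by simp
    moreover have "((\<lambda>(j, k). if q * j + u * k = N then c (j, k) * x ^ j * z ^ k else 0) has_sum edge_form c q u N x z) UNIV"
      unfolding edge_form_def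
      by (rule has_sum_finite_neutralI[OF finite_edge[OF qu, of N]]) (auto intro!: sum.cong)
    ultimately have "((\<lambda>p. (case p of (j, k) \<Rightarrow> c (j, k) * x ^ j * z ^ k) +
         - (case p of (j, k) \<Rightarrow> if q * j + u * k = N then c (j, k) * x ^ j * z ^ k else 0))
        has_sum (f (x, z) + - edge_form c q u N x z)) UNIV"
      by (intro has_sum_add has_sum_uminusI)
    moreover have "(\<lambda>p. (case p of (j, k) \<Rightarrow> c (j, k) * x ^ j * z ^ k) +
         - (case p of (j, k) \<Rightarrow> if q * j + u * k = N then c (j, k) * x ^ j * z ^ k else 0))
        = (\<lambda>(j, k). c' (j, k) * x ^ j * z ^ k)"
      by (auto simp: c'_def fun_eq_iff)
    ultimately have hs: "((\<lambda>(j, k). c' (j, k) * x ^ j * z ^ k) has_sum (f (x, z) - edge_form c q u N x z)) UNIV"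
      by simp
    define M where "M = (\<lambda>(j, k). s ^ Suc N / s0 ^ Suc N * (norm (c (j, k)) * r ^ (j + k)))"
    have sM: "M summable_on UNIV"
      using r(2) unfolding M_def dps_norm_le_def case_prod_unfold by (intro summable_on_cmult_right) auto
    have bd: "norm (case p of (j, k) \<Rightarrow> c' (j, k) * x ^ j * z ^ k) \<le> M p" for p
    proof -
      obtain j k where p: "p = (j, k)" by force
      show ?thesis
      proof (cases "c' (j, k) = 0")
        case True then show ?thesis using s s0 r by (simp add: p M_def)
      next
        case False
        define e where "e = q * j + u * k"
        have e: "Suc N \<le> e" using supp[of j k] False by (auto simp: c'_def e_def split: if_splits)
        have jk: "j + k \<le> e" unfolding e_def using qu by (intro add_mono) auto
        have eq: "norm (c' (j, k) * x ^ j * z ^ k) = norm (c (j, k)) * (s ^ e * (\<bar>a\<bar> ^ j * \<bar>b\<bar> ^ k))"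
        proof -
          have "x ^ j = s ^ (q * j) * a ^ j" "z ^ k = s ^ (u * k) * b ^ k"
            by (simp_all add: x_def z_def power_mult_distrib power_mult)
          then show ?thesis
            using s False by (simp add: c'_def e_def abs_mult power_abs power_add mult_ac split: if_splits)
        qed
        have "s ^ e * (\<bar>a\<bar> ^ j * \<bar>b\<bar> ^ k) \<le> (s ^ Suc N / s0 ^ Suc N) * (s0 ^ e) * (K ^ j * K ^ k)"
        proof (intro mult_mono)
          have "s ^ e = s ^ Suc N * s ^ (e - Suc N)" using e by (metis le_add_diff_inverse power_add)
          also have "\<dots> \<le> s ^ Suc N * s0 ^ (e - Suc N)"
            using s by (intro mult_left_mono power_mono) auto
          also have "\<dots> = s ^ Suc N / s0 ^ Suc N * s0 ^ e"
            using s0 e by (simp add: power_diff)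
          finally show "s ^ e \<le> s ^ Suc N / s0 ^ Suc N * s0 ^ e" .
        qed (use s s0 K ab in \<open>auto intro!: power_mono\<close>)
        also have "\<dots> \<le> (s ^ Suc N / s0 ^ Suc N) * (s0 ^ (j + k)) * (K ^ j * K ^ k)"
          using s s0 K jk by (intro mult_right_mono mult_left_mono power_decreasing) auto
        also have "\<dots> = (s ^ Suc N / s0 ^ Suc N) * (s0 * K) ^ (j + k)"
          by (simp add: power_add power_mult_distrib)
        also have "\<dots> \<le> (s ^ Suc N / s0 ^ Suc N) * r ^ (j + k)"
          using s s0 K by (intro mult_left_mono power_mono) auto
        finally have "norm (c (j, k)) * (s ^ e * (\<bar>a\<bar> ^ j * \<bar>b\<bar> ^ k))
            \<le> norm (c (j, k)) * ((s ^ Suc N / s0 ^ Suc N) * r ^ (j + k))"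
          by (rule mult_left_mono) simp
        then show ?thesis unfolding p prod.case eq M_def by (simp only: mult_ac)
      qed
    qed
    have ns: "(\<lambda>p. norm (case p of (j, k) \<Rightarrow> c' (j, k) * x ^ j * z ^ k)) summable_on UNIV"
      by (rule Infinite_Sum.abs_summable_on_comparison_test'[OF sM]) (use bd in auto)
    have "norm (f (x, z) - edge_form c q u N x z) \<le> (\<Sum>\<^sub>\<infinity>p. norm (case p of (j, k) \<Rightarrow> c' (j, k) * x ^ j * z ^ k))"
      by (rule norm_has_sum_bound[OF has_sum_infsum[OF ns] hs])
    also have "\<dots> \<le> infsum M UNIV" by (rule infsum_mono[OF ns sM]) (use bd in auto)
    also have "\<dots> = s ^ Suc N / s0 ^ Suc N * (\<Sum>\<^sub>\<infinity>(j, k). norm (c (j, k)) * r ^ (j + k))"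
      unfolding M_def case_prod_unfold by (rule infsum_cmult_right')
    also have "\<dots> \<le> s ^ Suc N / s0 ^ Suc N * B"
      using r(2) s s0 by (intro mult_left_mono) (auto simp: dps_norm_le_def)
    also have "\<dots> = s ^ N * (C * s)" by (simp add: C_def)
    finally have le: "\<bar>f (x, z) - s ^ N * edge_form c q u N a b\<bar> \<le> s ^ N * (C * s)"
      by (simp add: x_def z_def edge_form_scale)
    have "f (x, z) / s ^ N - edge_form c q u N a b = (f (x, z) - s ^ N * edge_form c q u N a b) / s ^ N"
      using s by (simp add: field_simps)
    then have "\<bar>f (x, z) / s ^ N - edge_form c q u N a b\<bar> = \<bar>f (x, z) - s ^ N * edge_form c q u N a b\<bar> / s ^ N"
      using s by (simp add: abs_divide)
    also have "\<dots> \<le> C * s" using le s by (simp add: divide_le_eq mult_ac)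
    finally show ?thesis by (simp add: x_def z_def)
  qed
  have "\<forall>\<^sub>F s in at_right 0. \<bar>Y1 s\<bar> < K" "\<forall>\<^sub>F s in at_right 0. \<bar>Y2 s\<bar> < K"
    using order_tendstoD(2)[OF tendsto_rabs[OF Y(1)] K(2)] order_tendstoD(2)[OF tendsto_rabs[OF Y(2)] K(3)] by auto
  moreover have "\<forall>\<^sub>F s in at_right 0. 0 < s \<and> s < s0"
    using s0 by (auto simp: eventually_at_right_field intro!: exI[of _ s0])
  ultimately have ev: "\<forall>\<^sub>F s in at_right 0.
      norm (f (s ^ q * Y1 s, s ^ u * Y2 s) / s ^ N - edge_form c q u N (Y1 s) (Y2 s)) \<le> C * s"
    by eventually_elim (use key in auto)
  have "((\<lambda>s. C * s) \<longlongrightarrow> C * 0) (at_right 0)" by (intro tendsto_intros)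
  then have "((\<lambda>s. f (s ^ q * Y1 s, s ^ u * Y2 s) / s ^ N - edge_form c q u N (Y1 s) (Y2 s)) \<longlongrightarrow> 0) (at_right 0)"
    by (intro Lim_null_comparison[OF ev]) simp
  moreover have "((\<lambda>s. edge_form c q u N (Y1 s) (Y2 s)) \<longlongrightarrow> edge_form c q u N y1 y2) (at_right 0)"
    unfolding edge_form_def case_prod_unfold by (intro tendsto_intros Y)
  ultimately have "((\<lambda>s. (f (s ^ q * Y1 s, s ^ u * Y2 s) / s ^ N - edge_form c q u N (Y1 s) (Y2 s))
     + edge_form c q u N (Y1 s) (Y2 s)) \<longlongrightarrow> 0 + edge_form c q u N y1 y2) (at_right 0)"
    by (rule tendsto_add)
  then show ?thesis by simp
qed

text \<open>By \<open>leading_limit\<close> for \<open>f\<close>, the quotient of \<open>g\<close> by \<open>s^N\<close> has a limit at every point. A term of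
  smaller weight \<open>M\<close> in \<open>g\<close> would contribute a non-zero polynomial to the limit of the quotient by
  \<open>s^M\<close>, which is \<open>0\<close>.\<close>

lemma leading_transfer:
  fixes f g :: "real \<times> real \<Rightarrow> real"
  assumes f: "has_dps f c" and g: "has_dps g e" and qu: "0 < q" "0 < u"
    and supp: "\<And>j k. c (j, k) \<noteq> 0 \<Longrightarrow> N \<le> q * j + u * k"
    and sub: "\<And>y1 y2. \<forall>\<^sub>F s in at_right 0. g (s ^ q * y1, s ^ u * y2) = f (s ^ q * Y1 y1 y2 s, s ^ u * Y2 y1 y2 s)"
    and Y: "\<And>y1 y2. (Y1 y1 y2 \<longlongrightarrow> Z1 y1 y2) (at_right 0)" "\<And>y1 y2. (Y2 y1 y2 \<longlongrightarrow> Z2 y1 y2) (at_right 0)"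
  shows "\<And>j k. e (j, k) \<noteq> 0 \<Longrightarrow> N \<le> q * j + u * k"
    and "\<And>y1 y2. edge_form e q u N y1 y2 = edge_form c q u N (Z1 y1 y2) (Z2 y1 y2)"
proof -
  have lim: "((\<lambda>s. g (s ^ q * y1, s ^ u * y2) / s ^ N) \<longlongrightarrow> edge_form c q u N (Z1 y1 y2) (Z2 y1 y2)) (at_right 0)" for y1 y2
  proof (rule Lim_transform_eventually[OF leading_limit[OF f qu supp Y(1)[of y1 y2] Y(2)[of y1 y2]]])
    show "\<forall>\<^sub>F s in at_right 0. f (s ^ q * Y1 y1 y2 s, s ^ u * Y2 y1 y2 s) / s ^ N = g (s ^ q * y1, s ^ u * y2) / s ^ N"
      using sub[of y1 y2] by eventually_elim simp
  qed
  have triv: "trivial_limit (at_right (0::real)) = False" by simp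
  show supp_e: "N \<le> q * j + u * k" if e: "e (j, k) \<noteq> 0" for j k
  proof (rule ccontr)
    assume "\<not> N \<le> q * j + u * k"
    define P where "P M \<longleftrightarrow> (\<exists>j k. e (j, k) \<noteq> 0 \<and> q * j + u * k = M)" for M
    define M where "M = (LEAST M. P M)"
    have P: "P (q * j + u * k)" using e by (auto simp: P_def)
    have PM: "P M" unfolding M_def by (rule LeastI[of P, OF P])
    have MN: "M < N" using Least_le[of P, OF P] \<open>\<not> N \<le> _\<close> by (simp add: M_def)
    have sM: "M \<le> q * j + u * k" if "e (j, k) \<noteq> 0" for j k
      unfolding M_def by (rule Least_le) (use that in \<open>auto simp: P_def\<close>)
    have "edge_form e q u M y1 y2 = 0" for y1 y2
    proof -
      have l1: "((\<lambda>s. g (s ^ q * y1, s ^ u * y2) / s ^ M) \<longlongrightarrow> edge_form e q u M y1 y2) (at_right 0)"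
        by (rule leading_limit[OF g qu sM]) auto
      have "((\<lambda>s. s ^ (N - M) * (g (s ^ q * y1, s ^ u * y2) / s ^ N)) \<longlongrightarrow>
          0 ^ (N - M) * edge_form c q u N (Z1 y1 y2) (Z2 y1 y2)) (at_right 0)"
        by (intro tendsto_mult lim tendsto_power tendsto_ident_at)
      moreover have "\<forall>\<^sub>F s in at_right 0. s ^ (N - M) * (g (s ^ q * y1, s ^ u * y2) / s ^ N) = g (s ^ q * y1, s ^ u * y2) / s ^ M"
      proof -
        have "\<forall>\<^sub>F s in at_right (0::real). 0 < s" by (simp add: eventually_at_right_less)
        then show ?thesis
        proof eventually_elim
          case (elim s)
          have "s ^ N = s ^ (N - M) * s ^ M" using MN by (simp flip: power_add)
          then show ?case using elim by simp
        qed
      qed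
      ultimately have "((\<lambda>s. g (s ^ q * y1, s ^ u * y2) / s ^ M) \<longlongrightarrow>
          0 ^ (N - M) * edge_form c q u N (Z1 y1 y2) (Z2 y1 y2)) (at_right 0)"
        by (rule Lim_transform_eventually)
      from tendsto_unique[OF _ l1 this] MN show ?thesis by (simp add: zero_power)
    qed
    with PM edge_form_eq_0D[OF qu, of e M] show False by (auto simp: P_def)
  qed
  show "edge_form e q u N y1 y2 = edge_form c q u N (Z1 y1 y2) (Z2 y1 y2)" for y1 y2
  proof -
    have "((\<lambda>s. g (s ^ q * y1, s ^ u * y2) / s ^ N) \<longlongrightarrow> edge_form e q u N y1 y2) (at_right 0)"
      by (rule leading_limit[OF g qu supp_e]) auto
    from tendsto_unique[OF _ this lim] show ?thesis by simp
  qed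
qed

section \<open>The Newton polyhedron\<close>

lemma taylor_coeff_eq:
  assumes "has_dps f c" shows "taylor_coeff f = c"
  unfolding taylor_coeff_def has_power_series2_iff_has_dps
  by (rule the_equality) (use assms has_dps_unique' in auto)

definition newton_set :: "(nat \<times> nat \<Rightarrow> real) \<Rightarrow> (real \<times> real) set" where
  "newton_set c = convex hull (\<Union>(j, k)\<in>{(j, k). c (j, k) \<noteq> 0}. {(t1, t2). real j \<le> t1 \<and> real k \<le> t2})"

lemma newton_polyhedron_eq: "has_dps f c \<Longrightarrow> newton_polyhedron f = newton_set c"
  by (simp add: newton_polyhedron_def newton_set_def taylor_support_def taylor_coeff_eq)

definition supports :: "(nat \<times> nat \<Rightarrow> real) \<Rightarrow> real \<Rightarrow> real \<Rightarrow> real \<Rightarrow> bool" where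
  "supports c w1 w2 m \<longleftrightarrow> (\<forall>j k. c (j, k) \<noteq> 0 \<longrightarrow> m \<le> w1 * real j + w2 * real k)"

lemma newton_set_halfspace:
  assumes "supports c w1 w2 m" "0 \<le> w1" "0 \<le> w2" "(t1, t2) \<in> newton_set c"
  shows "m \<le> w1 * t1 + w2 * t2"
proof -
  have "newton_set c \<subseteq> {x. m \<le> inner (w1, w2) x}"
    unfolding newton_set_def
  proof (rule hull_minimal)
    show "convex {x. m \<le> inner (w1, w2) x}" by (rule convex_halfspace_ge)
    show "(\<Union>(j, k)\<in>{(j, k). c (j, k) \<noteq> 0}. {(t1, t2). real j \<le> t1 \<and> real k \<le> t2}) \<subseteq> {x. m \<le> inner (w1, w2) x}"
    proof clarsimp
      fix t1 t2 j k assume *: "c (j, k) \<noteq> 0" "real j \<le> t1" "real k \<le> t2"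
      have "m \<le> w1 * real j + w2 * real k" using assms(1) * by (simp add: supports_def)
      also have "\<dots> \<le> w1 * t1 + w2 * t2" using assms(2,3) * by (intro add_mono mult_left_mono) auto
      finally show "m \<le> w1 * t1 + w2 * t2" .
    qed
  qed
  then show ?thesis using assms(4) by auto
qed

lemma newton_set_closure_halfspace:
  assumes "supports c w1 w2 m" "0 \<le> w1" "0 \<le> w2" "(t1, t2) \<in> closure (newton_set c)"
  shows "m \<le> w1 * t1 + w2 * t2"
proof -
  have "closure (newton_set c) \<subseteq> {x. m \<le> inner (w1, w2) x}"
    by (rule closure_minimal[OF _ closed_halfspace_ge]) (use newton_set_halfspace[OF assms(1-3)] in auto)
  then show ?thesis using assms(4) by auto
qed

lemma newton_set_quadrant:
  assumes "c (j, k) \<noteq> 0" "real j \<le> t1" "real k \<le> t2"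
  shows "(t1, t2) \<in> newton_set c"
  unfolding newton_set_def by (rule hull_inc) (use assms in auto)

text \<open>The weights of a supporting line are non-negative because the polyhedron contains a quadrant.\<close>

lemma newton_set_supporting:
  assumes "c \<noteq> (\<lambda>_. 0)" "(d1, d2) \<in> frontier (newton_set c)"
  obtains w1 w2 where "0 \<le> w1" "0 \<le> w2" "0 < w1 + w2" "supports c w1 w2 (w1 * d1 + w2 * d2)"
proof -
  obtain j k where jk: "c (j, k) \<noteq> 0" using assms(1) by fastforce
  have "{x. real j < fst x} \<inter> {x. real k < snd x} \<subseteq> newton_set c"
    using newton_set_quadrant[of c j k, OF jk] by (auto intro: less_imp_le)
  moreover have "open ({x::real \<times> real. real j < fst x} \<inter> {x. real k < snd x})"
    by (intro open_Int open_Collect_less continuous_intros)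
  moreover have "(real j + 1, real k + 1) \<in> {x. real j < fst x} \<inter> {x. real k < snd x}" by simp
  ultimately have "(real j + 1, real k + 1) \<in> interior (newton_set c)"
    using interior_maximal by blast
  then have "interior (newton_set c) \<noteq> {}" by blast
  then have ri: "rel_interior (newton_set c) = interior (newton_set c)"
    by (rule rel_interior_nonempty_interior)
  have cvx: "convex (newton_set c)" by (simp add: newton_set_def)
  obtain a where a: "a \<noteq> 0" "\<And>y. y \<in> closure (newton_set c) \<Longrightarrow> a \<bullet> (d1, d2) \<le> a \<bullet> y"
    by (rule supporting_hyperplane_relative_frontier[OF cvx, of "(d1, d2)"])
       (use assms(2) ri in \<open>auto simp: frontier_def\<close>)
  obtain w1 w2 where [simp]: "a = (w1, w2)" by force
  have sup: "w1 * d1 + w2 * d2 \<le> w1 * t1 + w2 * t2" if "(t1, t2) \<in> newton_set c" for t1 t2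
    using a(2)[of "(t1, t2)"] that closure_subset by fastforce
  have pos: "0 \<le> w1" "0 \<le> w2"
  proof -
    define \<Delta> where "\<Delta> = w1 * j + w2 * k - (w1 * d1 + w2 * d2)"
    show "0 \<le> w1"
    proof (rule ccontr)
      assume w: "\<not> 0 \<le> w1"
      define t where "t = (\<bar>\<Delta>\<bar> + 1) / (- w1)"
      have t: "t \<ge> 0" "w1 * t = - (\<bar>\<Delta>\<bar> + 1)" using w by (auto simp: t_def field_simps)
      have "(real j + t, real k) \<in> newton_set c" using newton_set_quadrant[of c j k, OF jk] t by auto
      from sup[OF this] t show False by (simp add: \<Delta>_def algebra_simps abs_if split: if_splits)
    qed
    show "0 \<le> w2"
    proof (rule ccontr)
      assume w: "\<not> 0 \<le> w2"
      define t where "t = (\<bar>\<Delta>\<bar> + 1) / (- w2)"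
      have t: "t \<ge> 0" "w2 * t = - (\<bar>\<Delta>\<bar> + 1)" using w by (auto simp: t_def field_simps)
      have "(real j, real k + t) \<in> newton_set c" using newton_set_quadrant[of c j k, OF jk] t by auto
      from sup[OF this] t show False by (simp add: \<Delta>_def algebra_simps abs_if split: if_splits)
    qed
  qed
  have "w1 + w2 \<noteq> 0" using pos a(1) by (auto simp: zero_prod_def)
  then have "0 < w1 + w2" using pos by simp
  then show ?thesis
  proof (rule that[OF pos])
    show "supports c w1 w2 (w1 * d1 + w2 * d2)"
      unfolding supports_def using sup newton_set_quadrant by blast
  qed
qed

text \<open>The first clause says that \<open>d\<close> bounds all normalized weighted orders, the second that the bound is
  attained. In this form the distance needs no convex geometry.\<close>

definition is_distance :: "(nat \<times> nat \<Rightarrow> real) \<Rightarrow> real \<Rightarrow> bool" where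
  "is_distance c d \<longleftrightarrow>
     (\<forall>w1 w2 m. 0 \<le> w1 \<longrightarrow> 0 \<le> w2 \<longrightarrow> supports c w1 w2 m \<longrightarrow> m \<le> (w1 + w2) * d) \<and>
     (\<exists>w1 w2. 0 \<le> w1 \<and> 0 \<le> w2 \<and> 0 < w1 + w2 \<and> supports c w1 w2 ((w1 + w2) * d))"

lemma is_distance_le: "is_distance c d \<Longrightarrow> 0 \<le> w1 \<Longrightarrow> 0 \<le> w2 \<Longrightarrow> supports c w1 w2 m \<Longrightarrow> m \<le> (w1 + w2) * d"
  by (simp add: is_distance_def)

lemma is_distanceE:
  assumes "is_distance c d"
  obtains w1 w2 where "0 \<le> w1" "0 \<le> w2" "0 < w1 + w2" "supports c w1 w2 ((w1 + w2) * d)"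
  using assms by (auto simp: is_distance_def)

lemma is_distance_mono:
  assumes "is_distance c d" "is_distance c d'" shows "d \<le> d'"
proof -
  obtain w1 w2 where w: "0 \<le> w1" "0 \<le> w2" "0 < w1 + w2" "supports c w1 w2 ((w1 + w2) * d)"
    by (rule is_distanceE[OF assms(1)])
  from is_distance_le[OF assms(2) w(1,2,4)] w(3) show ?thesis by simp
qed

lemma is_distance_unique: "is_distance c d \<Longrightarrow> is_distance c d' \<Longrightarrow> d = d'"
  using is_distance_mono by (meson antisym)

lemma frontier_is_distance:
  assumes "c \<noteq> (\<lambda>_. 0)" "(d, d) \<in> frontier (newton_set c)"
  shows "is_distance c d"
  unfolding is_distance_def
proof (intro conjI allI impI)
  fix w1 w2 m assume "0 \<le> w1" "0 \<le> w2" "supports c w1 w2 m"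
  then show "m \<le> (w1 + w2) * d"
    using newton_set_closure_halfspace[of c w1 w2 m d d] assms(2) by (simp add: frontier_def distrib_right)
next
  show "\<exists>w1 w2. 0 \<le> w1 \<and> 0 \<le> w2 \<and> 0 < w1 + w2 \<and> supports c w1 w2 ((w1 + w2) * d)"
    using newton_set_supporting[OF assms] by (metis distrib_right)
qed

text \<open>The lower end of the intersection of the polyhedron with the diagonal.\<close>

lemma frontier_exists:
  assumes "c \<noteq> (\<lambda>_. 0)"
  obtains d where "(d, d) \<in> frontier (newton_set c)"
proof -
  obtain j k where jk: "c (j, k) \<noteq> 0" using assms by fastforce
  define D where "D = {d. (d, d) \<in> newton_set c}"
  have ne: "max (real j) (real k) \<in> D" unfolding D_def using newton_set_quadrant[of c j k, OF jk] by simp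
  have "0 \<le> d" if "d \<in> D" for d
    using newton_set_halfspace[of c 1 0 0 d d] that by (simp add: supports_def D_def)
  then have bdd: "bdd_below D" by (rule bdd_belowI)
  define d where "d = Inf D"
  have "(d, d) \<in> closure (newton_set c)"
    unfolding closure_approachable
  proof (intro allI impI)
    fix e :: real assume e: "e > 0"
    obtain d' where d': "d' \<in> D" "d' < d + e / 2"
      using cInf_lessD[of D "d + e / 2"] ne e by (auto simp: d_def)
    have "d \<le> d'" unfolding d_def by (rule cInf_lower[OF d'(1) bdd])
    have "dist (d', d') (d, d) \<le> norm (d' - d) + norm (d' - d)"
      using norm_Pair_le[of "d' - d" "d' - d"] by (simp add: dist_norm)
    also have "\<dots> < e" using d' \<open>d \<le> d'\<close> by simp
    finally show "\<exists>y\<in>newton_set c. dist y (d, d) < e" using d'(1) by (auto simp: D_def)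
  qed
  moreover have "(d, d) \<notin> interior (newton_set c)"
  proof
    assume "(d, d) \<in> interior (newton_set c)"
    then obtain e where e: "e > 0" "ball (d, d) e \<subseteq> newton_set c" by (auto simp: mem_interior)
    have "dist (d, d) (d - e / 4, d - e / 4) \<le> norm (e / 4) + norm (e / 4)"
      using norm_Pair_le[of "e / 4" "e / 4"] by (simp add: dist_norm)
    also have "\<dots> < e" using e by simp
    finally have "d - e / 4 \<in> D" using e(2) by (auto simp: D_def)
    then have "d \<le> d - e / 4" unfolding d_def by (rule cInf_lower[OF _ bdd])
    with e show False by simp
  qed
  ultimately show ?thesis using that by (simp add: frontier_def)
qed

lemma newton_distance:
  assumes "has_dps f c" "c \<noteq> (\<lambda>_. 0)"
  shows "is_distance c (newton_distance f)"
proof -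
  obtain d where d: "(d, d) \<in> frontier (newton_set c)" by (rule frontier_exists[OF assms(2)])
  have "newton_distance f = d"
    unfolding newton_distance_def newton_polyhedron_eq[OF assms(1)]
    by (rule the_equality[where P = "\<lambda>d. (d, d) \<in> frontier (newton_set c)" and a = d, OF d], rule is_distance_unique[OF frontier_is_distance[OF assms(2)]
        frontier_is_distance[OF assms(2) d]])
  with frontier_is_distance[OF assms(2) d] show ?thesis by simp
qed

lemma newton_distance_eqI: "has_dps f c \<Longrightarrow> c \<noteq> (\<lambda>_. 0) \<Longrightarrow> is_distance c d \<Longrightarrow> newton_distance f = d"
  using newton_distance is_distance_unique by blast

text \<open>A face that contains \<open>(d, d)\<close> contains \<open>A\<close> and \<open>B\<close> too, so \<open>(d, d)\<close> is not a vertex, and any edge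
  through it is the intersection of the polyhedron with the line through \<open>A\<close> and \<open>B\<close>. Hence the
  principal face is unique and equal to this intersection.\<close>

lemma principal_edge:
  assumes f: "has_dps f c" and w: "0 \<le> w1" "0 \<le> w2" "0 < w1 + w2"
    and d: "d = newton_distance f" and sup: "supports c w1 w2 ((w1 + w2) * d)"
    and A: "A \<in> newton_set c" "w1 * fst A + w2 * snd A = (w1 + w2) * d"
    and B: "B \<in> newton_set c" "w1 * fst B + w2 * snd B = (w1 + w2) * d"
    and P: "(d, d) \<in> open_segment A B"
  shows "A \<in> principal_face f" "B \<in> principal_face f" "(d, d) \<in> principal_face f"
proof -
  define N where "N = newton_set c"
  define a where "a = (w1, w2)"
  define b where "b = (w1 + w2) * d"
  define E where "E = N \<inter> {x. a \<bullet> x = b}"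
  have cvx: "convex N" by (simp add: N_def newton_set_def)
  have AB: "A \<noteq> B" using P by auto
  have a0: "a \<noteq> 0" using w by (auto simp: a_def zero_prod_def)
  have ge: "b \<le> a \<bullet> x" if "x \<in> N" for x
    using newton_set_halfspace[OF sup w(1,2), of "fst x" "snd x"] that by (cases x) (simp add: N_def a_def b_def)
  have face: "E face_of N" unfolding E_def by (rule face_of_Int_supporting_hyperplane_ge[OF cvx ge])
  have ABE: "A \<in> E" "B \<in> E" using A B by (cases A; cases B; simp add: E_def N_def a_def b_def)+
  have "convex E" using face by (rule face_of_imp_convex)
  have PE: "(d, d) \<in> E"
    using P ABE \<open>convex E\<close> convex_contains_open_segment by blast
  have "aff_dim E \<le> aff_dim {x. a \<bullet> x = b}" by (rule aff_dim_subset) (auto simp: E_def)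
  also have "\<dots> = 1" using aff_dim_hyperplane[OF a0] by simp
  finally have "aff_dim E \<le> 1" .
  moreover have "aff_dim {A, B} \<le> aff_dim E" by (rule aff_dim_subset) (use ABE in auto)
  ultimately have "aff_dim E = 1" using AB by simp
  with face have edge: "E edge_of N" by (simp add: edge_of_def)
  have sub: "G = N \<inter> affine hull {A, B}" if G: "G edge_of N" "(d, d) \<in> G" for G
  proof -
    have Gf: "G face_of N" and G1: "aff_dim G = 1" using G(1) by (auto simp: edge_of_def)
    have ABG: "A \<in> G" "B \<in> G" using face_ofD[OF Gf P _ _ G(2)] A B by (auto simp: N_def)
    have "affine hull {A, B} = affine hull G"
    proof (rule affine_dim_equal)
      show "affine hull {A, B} \<noteq> {}" by simp
      show "affine hull {A, B} \<subseteq> affine hull G" using ABG by (intro hull_mono) auto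
      show "aff_dim (affine hull {A, B}) = aff_dim (affine hull G)" using AB G1 by (simp add: aff_dim_affine_hull)
    qed (auto simp: affine_affine_hull)
    then have 1: "G \<subseteq> N \<inter> affine hull {A, B}"
      using hull_subset[of G affine] face_of_imp_subset[OF Gf] by auto
    moreover have "x \<in> G" if x: "x \<in> N" "x \<in> affine hull {A, B}" for x
    proof -
      obtain s t where st: "x = s *\<^sub>R A + t *\<^sub>R B" "s + t = 1"
        using x(2) unfolding affine_hull_2 by blast
      then have "s = 1 - t" by simp
      with st(1) have t: "x = (1 - t) *\<^sub>R A + t *\<^sub>R B" by simp
      obtain \<tau> where \<tau>: "0 < \<tau>" "\<tau> < 1" "(d, d) = (1 - \<tau>) *\<^sub>R A + \<tau> *\<^sub>R B"
        using P by (auto simp: in_segment)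
      consider "t < \<tau>" | "t = \<tau>" | "\<tau> < t" by linarith
      then show ?thesis
      proof cases
        case 1
        define l where "l = (\<tau> - t) / (1 - t)"
        have l: "0 < l" "l < 1" "l * (1 - t) = \<tau> - t" using 1 \<tau> by (auto simp: l_def field_simps)
        have e1: "(1 - l) * (1 - t) = 1 - \<tau>" and e2: "(1 - l) * t + l = \<tau>" using l(3) by (auto simp: algebra_simps)
        have "(1 - l) *\<^sub>R x + l *\<^sub>R B = ((1 - l) * (1 - t)) *\<^sub>R A + ((1 - l) * t + l) *\<^sub>R B"
          by (simp add: t scaleR_add_right scaleR_add_left)
        also have "\<dots> = (d, d)" by (simp only: e1 e2 \<tau>(3))
        finally have eq: "(d, d) = (1 - l) *\<^sub>R x + l *\<^sub>R B" by simp
        have "x \<noteq> B"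
        proof
          assume "x = B"
          then have "(1 - t) *\<^sub>R (A - B) = 0" using t by (simp add: algebra_simps)
          with 1 \<tau> AB show False by simp
        qed
        with l eq have "(d, d) \<in> open_segment x B" by (auto simp: in_segment)
        from face_ofD[OF Gf this x(1) _ G(2)] B show ?thesis by (auto simp: N_def)
      next
        case 2
        then show ?thesis using t \<tau>(3) G(2) by simp
      next
        case 3
        define l where "l = \<tau> / t"
        have l: "0 < l" "l < 1" "l * t = \<tau>" using 3 \<tau> by (auto simp: l_def field_simps)
        have e1: "(1 - l) + l * (1 - t) = 1 - \<tau>" using l(3) by (auto simp: algebra_simps)
        have "(1 - l) *\<^sub>R A + l *\<^sub>R x = ((1 - l) + l * (1 - t)) *\<^sub>R A + (l * t) *\<^sub>R B"
          by (simp add: t scaleR_add_right scaleR_add_left)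
        also have "\<dots> = (d, d)" by (simp only: e1 l(3) \<tau>(3))
        finally have eq: "(d, d) = (1 - l) *\<^sub>R A + l *\<^sub>R x" by simp
        have "A \<noteq> x"
        proof
          assume "A = x"
          then have "t *\<^sub>R (A - B) = 0" using t by (simp add: algebra_simps)
          with 3 \<tau> AB show False by simp
        qed
        with l eq have "(d, d) \<in> open_segment A x" by (auto simp: in_segment)
        from face_ofD[OF Gf this _ x(1) G(2)] A show ?thesis by (auto simp: N_def)
      qed
    qed
    ultimately show ?thesis by auto
  qed
  have Nf: "newton_polyhedron f = N" using newton_polyhedron_eq[OF f] by (simp add: N_def)
  have gface: "G edge_of N" if "newton_face f G" "(d, d) \<in> G" for G
  proof -
    have "\<not> v extreme_point_of N" if "v = (d, d)" for v
      using P A(1) B(1) that unfolding extreme_point_of_def N_def by blast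
    then show ?thesis using that unfolding newton_face_def Nf by blast
  qed
  have "principal_face f = E"
    unfolding principal_face_def Let_def d[symmetric]
  proof (rule the_equality)
    show "newton_face f E \<and> (d, d) \<in> E \<and> (\<forall>G. newton_face f G \<and> (d, d) \<in> G \<longrightarrow> aff_dim E \<le> aff_dim G)"
    proof (intro conjI allI impI)
      show "newton_face f E" unfolding newton_face_def Nf using edge by simp
      fix G assume "newton_face f G \<and> (d, d) \<in> G"
      then show "aff_dim E \<le> aff_dim G" using gface[of G] edge by (simp add: edge_of_def)
    qed (rule PE)
    fix G assume G: "newton_face f G \<and> (d, d) \<in> G \<and> (\<forall>G'. newton_face f G' \<and> (d, d) \<in> G' \<longrightarrow> aff_dim G \<le> aff_dim G')"
    then show "G = E" using sub[OF gface] sub[OF edge PE] by blast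
  qed
  then show "A \<in> principal_face f" "B \<in> principal_face f" "(d, d) \<in> principal_face f" using ABE PE by auto
qed

section \<open>Multiplicities of roots of edge polynomials\<close>

text \<open>Here \<open>N\<close> is the order of the series for the weight \<open>(1, k)\<close>: it is a lower bound for the weights of
  all terms, and it is attained because the edge polynomial does not vanish.\<close>

definition edge_condition :: "(nat \<times> nat \<Rightarrow> real) \<Rightarrow> real \<Rightarrow> nat \<Rightarrow> bool" where
  "edge_condition c d k \<longleftrightarrow>
     (\<forall>N b. (\<forall>j l. c (j, l) \<noteq> 0 \<longrightarrow> N \<le> 1 * j + k * l) \<longrightarrow> edge_poly c 1 k N \<noteq> 0 \<longrightarrow> b \<noteq> 0 \<longrightarrow>
        real (order b (edge_poly c 1 k N)) \<le> d)"

lemma order_add_order_0_le_degree: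
  fixes p :: "'a::field poly"
  assumes "p \<noteq> 0" "b \<noteq> 0"
  shows "order b p + order 0 p \<le> degree p"
proof -
  define n where "n = order 0 p"
  obtain r where r: "p = [:- 0, 1:] ^ n * r"
    using order_decomp[OF assms(1), of 0] unfolding n_def by blast
  have r0: "r \<noteq> 0" using r assms(1) by auto
  have "order b ([:- 0, 1:] ^ n) = 0" by (rule order_0I) (use assms(2) in simp)
  then have "order b p = order b r" using order_mult[of "[:- 0, 1:] ^ n" r b] r assms(1) by simp
  moreover have "order b r \<le> degree r" by (rule order_degree[OF r0])
  moreover have "degree p = n + degree r" unfolding r using r0 by (simp add: degree_mult_eq degree_linear_power)
  ultimately show ?thesis by (simp add: n_def)
qed

text \<open>The multiplicity of a non-zero root is at most the degree of the polynomial. It is also at most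
  the difference of the degree and the order at \<open>0\<close>, and \<open>k\<close> times this difference is at most the
  largest exponent of the first variable on the edge.\<close>

lemma edge_order_le:
  fixes c :: "nat \<times> nat \<Rightarrow> real"
  assumes p: "p = edge_poly c 1 k N" "p \<noteq> 0" and k: "0 < k" and b: "b \<noteq> 0"
    and one_side: "(\<forall>j l. c (j, l) \<noteq> 0 \<longrightarrow> 1 * j + k * l = N \<longrightarrow> real l \<le> d) \<or>
      (\<forall>j l. c (j, l) \<noteq> 0 \<longrightarrow> 1 * j + k * l = N \<longrightarrow> real j \<le> d)"
  shows "real (order b p) \<le> d"
proof -
  have point: "\<exists>j. 1 * j + k * l = N \<and> c (j, l) \<noteq> 0" if "coeff p l \<noteq> 0" for l
    using coeff_edge_poly[OF zero_less_one k] that unfolding p(1) by metis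
  have "coeff p (degree p) \<noteq> 0" using p(2) by simp
  then obtain jt where jt: "1 * jt + k * degree p = N" "c (jt, degree p) \<noteq> 0" using point by blast
  have "coeff p (order 0 p) \<noteq> 0"
    using order_pcompose_shift(2)[OF p(2), of 0] by (simp add: pcompose_idR)
  then obtain j0 where j0: "1 * j0 + k * order 0 p = N" "c (j0, order 0 p) \<noteq> 0" using point by blast
  show ?thesis
    using one_side
  proof
    assume "\<forall>j l. c (j, l) \<noteq> 0 \<longrightarrow> 1 * j + k * l = N \<longrightarrow> real l \<le> d"
    then have "real (degree p) \<le> d" using jt by blast
    then show ?thesis using order_degree[OF p(2), of b] by linarith
  next
    assume "\<forall>j l. c (j, l) \<noteq> 0 \<longrightarrow> 1 * j + k * l = N \<longrightarrow> real j \<le> d"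
    then have "real j0 \<le> d" using j0 by blast
    have "order b p \<le> degree p - order 0 p"
      using order_add_order_0_le_degree[OF p(2) b] by simp
    also have "\<dots> \<le> k * (degree p - order 0 p)" using k by simp
    also have "\<dots> \<le> j0" using jt(1) j0(1) by (simp add: diff_mult_distrib2)
    finally show ?thesis using \<open>real j0 \<le> d\<close> by linarith
  qed
qed

lemma is_distance_weight_le:
  assumes "is_distance c d" "\<And>j k. c (j, k) \<noteq> 0 \<Longrightarrow> N \<le> q * j + u * k"
  shows "real N \<le> (real q + real u) * d"
proof (rule is_distance_le[OF assms(1)])
  show "supports c (real q) (real u) (real N)"
    unfolding supports_def using assms(2) by (metis of_nat_add of_nat_le_iff of_nat_mult)
qed auto

text \<open>All terms lie above the line of weight \<open>w\<close> through \<open>(d, d)\<close>, while the edge of weight \<open>(1, k)\<close> lies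
  on or below the line of its own weight through \<open>(d, d)\<close>. If the two lines are different, the edge is
  confined to one side of \<open>(d, d)\<close>.\<close>

lemma edge_condition_auto:
  assumes D: "is_distance c d" and w: "0 \<le> w1" "0 \<le> w2" "supports c w1 w2 ((w1 + w2) * d)"
    and k: "0 < k" "w2 \<noteq> real k * w1"
  shows "edge_condition c d k"
  unfolding edge_condition_def
proof (intro allI impI)
  fix N b assume N: "\<forall>j l. c (j, l) \<noteq> 0 \<longrightarrow> N \<le> 1 * j + k * l"
    and p: "edge_poly c 1 k N \<noteq> 0" and b: "(b::real) \<noteq> 0"
  have Nd: "real N \<le> (1 + real k) * d"
    using is_distance_weight_le[OF D, of N 1 k] N by simp
  have sup: "(w1 + w2) * d \<le> w1 * real j + w2 * real l" if "c (j, l) \<noteq> 0" for j l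
    using w(3) that by (simp add: supports_def)
  have prod: "0 \<le> (w2 - real k * w1) * (real l - d)"
    and le: "(real j - d) + real k * (real l - d) \<le> 0"
    if "c (j, l) \<noteq> 0" "1 * j + k * l = N" for j l
  proof -
    have "real j + real k * real l = real N" using that(2) by (metis mult_1 of_nat_add of_nat_mult)
    then show 1: "(real j - d) + real k * (real l - d) \<le> 0" using Nd by (simp add: algebra_simps)
    have "w1 * ((real j - d) + real k * (real l - d)) \<le> 0"
      using 1 w(1) by (simp add: mult_nonneg_nonpos)
    with sup[OF that(1)] show "0 \<le> (w2 - real k * w1) * (real l - d)"
      by (simp add: algebra_simps)
  qed
  show "real (order b (edge_poly c 1 k N)) \<le> d"
  proof (rule edge_order_le[OF refl p k(1) b])
    consider "w2 < real k * w1" | "real k * w1 < w2" using k(2) by linarith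
    then show "(\<forall>j l. c (j, l) \<noteq> 0 \<longrightarrow> 1 * j + k * l = N \<longrightarrow> real l \<le> d) \<or>
      (\<forall>j l. c (j, l) \<noteq> 0 \<longrightarrow> 1 * j + k * l = N \<longrightarrow> real j \<le> d)"
    proof cases
      case 1
      have "real l \<le> d" if "c (j, l) \<noteq> 0" "1 * j + k * l = N" for j l
        using prod[OF that] 1 by (simp add: zero_le_mult_iff)
      then show ?thesis by blast
    next
      case 2
      have "real j \<le> d" if "c (j, l) \<noteq> 0" "1 * j + k * l = N" for j l
      proof -
        have "d \<le> real l" using prod[OF that] 2 by (simp add: zero_le_mult_iff)
        then have "0 \<le> real k * (real l - d)" by simp
        with le[OF that] show ?thesis by linarith
      qed
      then show ?thesis by blast
    qed
  qed
qed

text \<open>A large multiple \<open>n w\<close> is rounded up in the first entry and down in the second (but to at least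
  \<open>1\<close>), so that the slope
  does not exceed any integer bound for the slope of \<open>w\<close>. The relative error \<open>\<epsilon>\<close> is paid for by the
  gap between \<open>d'\<close> and \<open>d\<close>.\<close>

lemma rational_weight:
  assumes w: "0 \<le> w1" "0 \<le> w2" "0 < w1 + w2" and sup: "supports c w1 w2 ((w1 + w2) * d)"
    and d: "0 \<le> d'" "d' < d"
  obtains q u :: nat where "0 < q" "0 < u"
    "\<And>j k. c (j, k) \<noteq> 0 \<Longrightarrow> (real q + real u) * d' < real (q * j + u * k)"
    "\<And>K::nat. 0 < K \<Longrightarrow> w2 \<le> real K * w1 \<Longrightarrow> u \<le> K * q"
proof -
  define W where "W = w1 + w2"
  define \<epsilon> where "\<epsilon> = (d - d') / (2 * d)"
  have d0: "0 < d" and W: "0 < W" using d w by (auto simp: W_def)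
  have \<epsilon>: "0 < \<epsilon>" "\<epsilon> < 1" "(1 - \<epsilon>) * d = (d + d') / 2"
    using d d0 by (auto simp: \<epsilon>_def field_simps)
  define n where "n = max (if w2 = 0 then 1 else 1 / (\<epsilon> * w2)) (4 * d' / (W * (d - d')) + 1)"
  have n1: "n * W * (d - d') > 4 * d'"
  proof -
    have "4 * d' / (W * (d - d')) < n" by (simp add: n_def)
    then show ?thesis using W d by (simp add: divide_less_eq mult_ac)
  qed
  have n0: "0 < n"
  proof -
    have "0 \<le> 4 * d' / (W * (d - d'))" using W d by simp
    then show ?thesis by (simp add: n_def less_max_iff_disj)
  qed
  define q where "q = nat \<lfloor>n * w1\<rfloor> + 1"
  define u where "u = max 1 (nat \<lfloor>n * w2\<rfloor>)"
  have nw: "0 \<le> n * w1" "0 \<le> n * w2" using n0 w by auto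
  have q: "n * w1 \<le> real q" "real q \<le> n * w1 + 1"
  proof -
    have "real q = real_of_int \<lfloor>n * w1\<rfloor> + 1" using nw(1) by (simp add: q_def)
    then show "n * w1 \<le> real q" "real q \<le> n * w1 + 1" using floor_correct[of "n * w1"] by linarith+
  qed
  have u1: "real u \<le> n * w2 + 1"
  proof -
    have "real u = max 1 (real (nat \<lfloor>n * w2\<rfloor>))" by (simp add: u_def of_nat_max)
    then show ?thesis using nw(2) of_int_floor_le[of "n * w2"] by simp linarith
  qed
  have u2: "(1 - \<epsilon>) * (n * w2) \<le> real u"
  proof (cases "w2 = 0")
    case True then show ?thesis by (simp add: u_def)
  next
    case False
    then have w2: "0 < w2" using w by simp
    have "1 / (\<epsilon> * w2) \<le> n" using False by (simp add: n_def)
    then have "1 \<le> \<epsilon> * (n * w2)" using \<epsilon> w2 by (simp add: divide_le_eq mult_ac)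
    moreover have "n * w2 - 1 \<le> real u"
    proof -
      have "real (nat \<lfloor>n * w2\<rfloor>) = real_of_int \<lfloor>n * w2\<rfloor>" using nw(2) by simp
      moreover have "real (nat \<lfloor>n * w2\<rfloor>) \<le> real u" unfolding u_def by simp
      ultimately show ?thesis using floor_correct[of "n * w2"] by linarith
    qed
    ultimately show ?thesis by (simp add: algebra_simps)
  qed
  show ?thesis
  proof (rule that[of q u])
    show "0 < q" "0 < u" by (auto simp: q_def u_def)
    fix j k assume "c (j, k) \<noteq> 0"
    then have s: "W * d \<le> w1 * real j + w2 * real k" using sup by (simp add: supports_def W_def)
    have "(1 - \<epsilon>) * (n * w1) \<le> real q" using q(1) nw(1) \<epsilon> by (smt (verit) mult_left_le_one_le)
    then have "(1 - \<epsilon>) * (n * w1) * real j + (1 - \<epsilon>) * (n * w2) * real k \<le> real q * real j + real u * real k"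
      using u2 by (intro add_mono mult_right_mono) auto
    then have "(1 - \<epsilon>) * n * (w1 * real j + w2 * real k) \<le> real (q * j + u * k)"
      by (simp add: algebra_simps)
    moreover have "(1 - \<epsilon>) * n * (W * d) \<le> (1 - \<epsilon>) * n * (w1 * real j + w2 * real k)"
      using s \<epsilon> n0 by (intro mult_left_mono) auto
    moreover have "(1 - \<epsilon>) * n * (W * d) = n * W * ((1 - \<epsilon>) * d)" by simp
    ultimately have "n * W * ((d + d') / 2) \<le> real (q * j + u * k)" unfolding \<epsilon>(3) by linarith
    moreover have "(real q + real u) * d' \<le> (n * W + 2) * d'"
      using q(2) u1 d by (intro mult_right_mono) (auto simp: W_def algebra_simps)
    moreover have "(n * W + 2) * d' < n * W * ((d + d') / 2)"
      using n1 by (simp add: algebra_simps)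
    ultimately show "(real q + real u) * d' < real (q * j + u * k)" by linarith
  next
    fix K :: nat assume K: "0 < K" "w2 \<le> real K * w1"
    have "n * w2 \<le> real K * (n * w1)" using K(2) n0 by (simp add: mult.left_commute)
    also have "\<dots> \<le> real K * real q" using q(1) by (intro mult_left_mono) auto
    finally have "real (nat \<lfloor>n * w2\<rfloor>) \<le> real (K * q)"
      using nw(2) of_int_floor_le[of "n * w2"] by simp linarith
    then have "nat \<lfloor>n * w2\<rfloor> \<le> K * q" by (simp only: of_nat_le_iff)
    then show "u \<le> K * q" using K(1) by (simp add: u_def q_def)
  qed
qed

section \<open>Adapted coordinates maximize the distance\<close>

lemma minimal_weight:
  fixes c :: "nat \<times> nat \<Rightarrow> real"
  assumes "c \<noteq> (\<lambda>_. 0)"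
  obtains N where "\<And>j k. c (j, k) \<noteq> 0 \<Longrightarrow> N \<le> q * j + u * k" "\<exists>j k. c (j, k) \<noteq> 0 \<and> q * j + u * k = N"
proof -
  define P where "P N \<longleftrightarrow> (\<exists>j k. c (j, k) \<noteq> 0 \<and> q * j + u * k = N)" for N
  have "\<exists>N. P N" using assms by (auto simp: P_def fun_eq_iff)
  then have "P (LEAST N. P N)" by (rule LeastI_ex)
  moreover have "(LEAST N. P N) \<le> q * j + u * k" if "c (j, k) \<noteq> 0" for j k
    by (rule Least_le) (use that in \<open>auto simp: P_def\<close>)
  ultimately show ?thesis using that[of "LEAST N. P N"] by (auto simp: P_def)
qed

lemma linear_edge_form: "0 < q \<Longrightarrow> edge_form c q q q y1 y2 = c (1, 0) * y1 + c (0, 1) * y2"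
proof -
  assume q: "0 < q"
  have "{(j, k). q * j + q * k = q} = {(1, 0), (0, 1 :: nat)}"
  proof -
    have "q * j + q * k = q \<longleftrightarrow> j + k = 1" for j k
      using q by (simp flip: add_mult_distrib2)
    then show ?thesis by auto
  qed
  then show ?thesis by (simp add: edge_form_def)
qed

lemma leading_quotient:
  fixes f :: "real \<times> real \<Rightarrow> real"
  assumes "has_dps f c" "0 < q" "0 < u" "\<And>j k. c (j, k) \<noteq> 0 \<Longrightarrow> N \<le> q * j + u * k"
  shows "((\<lambda>s. f (s ^ q * y1, s ^ u * y2) / s ^ N) \<longlongrightarrow> edge_form c q u N y1 y2) (at_right 0)"
  by (rule leading_limit[OF assms]) auto

text \<open>For coordinates whose components have orders at least \<open>q\<close> and \<open>u\<close>, the leading form is composed with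
  their leading parts.\<close>

lemma leading_transfer_coordinates:
  fixes f \<phi>1 \<phi>2 :: "real \<times> real \<Rightarrow> real"
  assumes f: "has_dps f c" and a: "has_dps \<phi>1 a" and b: "has_dps \<phi>2 b"
    and g: "has_dps g e" "\<forall>\<^sub>F y in nhds (0, 0). g y = f (\<phi>1 y, \<phi>2 y)"
    and qu: "0 < q" "0 < u" and supp: "\<And>j k. c (j, k) \<noteq> 0 \<Longrightarrow> N \<le> q * j + u * k"
    and sa: "\<And>j k. a (j, k) \<noteq> 0 \<Longrightarrow> q \<le> q * j + u * k" and sb: "\<And>j k. b (j, k) \<noteq> 0 \<Longrightarrow> u \<le> q * j + u * k"
  shows "\<And>j k. e (j, k) \<noteq> 0 \<Longrightarrow> N \<le> q * j + u * k"
    and "\<And>y1 y2. edge_form e q u N y1 y2 = edge_form c q u N (edge_form a q u q y1 y2) (edge_form b q u u y1 y2)"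
proof -
  have sub: "\<forall>\<^sub>F s in at_right 0. g (s ^ q * y1, s ^ u * y2)
      = f (s ^ q * (\<phi>1 (s ^ q * y1, s ^ u * y2) / s ^ q), s ^ u * (\<phi>2 (s ^ q * y1, s ^ u * y2) / s ^ u))" for y1 y2
  proof -
    have "((\<lambda>s. (s ^ q * y1, s ^ u * y2)) \<longlongrightarrow> (0 ^ q * y1, 0 ^ u * y2)) (at_right 0)"
      by (intro tendsto_intros)
    then have "filterlim (\<lambda>s. (s ^ q * y1, s ^ u * y2)) (nhds (0, 0)) (at_right 0)"
      using qu by (simp add: zero_power)
    from eventually_compose_filterlim[OF g(2) this]
    have "\<forall>\<^sub>F s in at_right 0. g (s ^ q * y1, s ^ u * y2)
      = f (\<phi>1 (s ^ q * y1, s ^ u * y2), \<phi>2 (s ^ q * y1, s ^ u * y2))" .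
    moreover have "\<forall>\<^sub>F s in at_right (0::real). 0 < s" by (simp add: eventually_at_right_less)
    ultimately show ?thesis by eventually_elim simp
  qed
  note tr = leading_transfer[where ?Y1.0 = "\<lambda>y1 y2 s. \<phi>1 (s ^ q * y1, s ^ u * y2) / s ^ q"
      and ?Y2.0 = "\<lambda>y1 y2 s. \<phi>2 (s ^ q * y1, s ^ u * y2) / s ^ u", OF f g(1) qu supp sub
      leading_quotient[OF a qu sa] leading_quotient[OF b qu sb]]
  show "\<And>j k. e (j, k) \<noteq> 0 \<Longrightarrow> N \<le> q * j + u * k" by (rule tr(1))
  show "\<And>y1 y2. edge_form e q u N y1 y2 = edge_form c q u N (edge_form a q u q y1 y2) (edge_form b q u u y1 y2)"
    by (rule tr(2))
qed

text \<open>The first coordinate function has a non-zero derivative in \<open>y1\<close>, so the axis \<open>y2 = 0\<close> becomes the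
  graph of a function of \<open>x1\<close> in the old coordinates; \<open>k\<close> is the order of the second coordinate
  function on this axis. If \<open>k\<close> is at least the slope \<open>u / q\<close>, the leading parts form an invertible
  map and preserve the order. Otherwise the weight \<open>(1, k)\<close> sees the graph as a point \<open>b0\<close> of the
  line \<open>x1 = 1\<close>. The new edge polynomial vanishes at \<open>0\<close> of the order \<open>n \<le> d\<close> of the old one at
  \<open>b0\<close>, so there is a term of weight \<open>N \<le> (1 + k) d\<close> for \<open>(1, k)\<close> and of degree \<open>n\<close> in \<open>y2\<close>. Its
  weight for \<open>(q, u)\<close> is \<open>q N + (u - q k) n \<le> (q + u) d\<close>.\<close>

lemma weighted_order_le_transversal:
  fixes f \<phi>1 \<phi>2 :: "real \<times> real \<Rightarrow> real"
  assumes f: "has_dps f c" and D: "is_distance c d" and c0: "c \<noteq> (\<lambda>_. 0)"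
    and a: "has_dps \<phi>1 a" "a (0, 0) = 0" and b: "has_dps \<phi>2 b" "b (0, 0) = 0"
    and a1: "a (1, 0) \<noteq> 0" and jac: "a (1, 0) * b (0, 1) - a (0, 1) * b (1, 0) \<noteq> 0"
    and e: "has_dps (\<lambda>y. f (\<phi>1 y, \<phi>2 y)) e"
    and qu: "0 < q" "0 < u" "q \<le> u"
    and cond: "\<And>k. 0 < k \<Longrightarrow> b (k, 0) \<noteq> 0 \<Longrightarrow> edge_condition c d k"
  shows "\<exists>j k. e (j, k) \<noteq> 0 \<and> real (q * j + u * k) \<le> (real q + real u) * d"
proof (rule ccontr)
  assume "\<not> ?thesis"
  then have sup: "(real q + real u) * d < real (q * j + u * k)" if "e (j, k) \<noteq> 0" for j k
    using that by (meson not_le)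
  have ev: "\<forall>\<^sub>F y in nhds (0, 0). f (\<phi>1 y, \<phi>2 y) = f (\<phi>1 y, \<phi>2 y)" by simp
  show False
  proof (cases "\<forall>i. b (i, 0) \<noteq> 0 \<longrightarrow> u \<le> q * i")
    case True
    have sa: "q \<le> q * j + u * k" if "a (j, k) \<noteq> 0" for j k
    proof (cases j)
      case 0
      then have "1 \<le> k" using that a(2) by (cases k) auto
      then have "u * 1 \<le> u * k" by (rule mult_le_mono2)
      then show ?thesis using qu(3) by linarith
    qed simp
    have sb: "u \<le> q * j + u * k" if "b (j, k) \<noteq> 0" for j k
      using True that by (cases k) auto
    obtain N where N: "\<And>j k. c (j, k) \<noteq> 0 \<Longrightarrow> N \<le> q * j + u * k"
      and att: "\<exists>j k. c (j, k) \<noteq> 0 \<and> q * j + u * k = N"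
      using minimal_weight[OF c0] by blast
    define Z1 Z2 where "Z1 = edge_form a q u q" and "Z2 = edge_form b q u u"
    note tr = leading_transfer_coordinates[OF f a(1) b(1) e ev qu(1,2) N sa sb, folded Z1_def Z2_def]
    have Nd: "real N \<le> (real q + real u) * d" by (rule is_distance_weight_le[OF D N])
    have "edge_form e q u N y1 y2 = 0" for y1 y2
      unfolding edge_form_def
    proof (rule sum.neutral, clarify)
      fix j k assume "N = q * j + u * k"
      then have "e (j, k) = 0" using sup[of j k] Nd by force
      then show "e (j, k) * y1 ^ j * y2 ^ k = 0" by simp
    qed
    then have Z: "edge_form c q u N (Z1 y1 y2) (Z2 y1 y2) = 0" for y1 y2
      using tr(2)[of y1 y2] by simp
    \<comment> \<open>The leading parts form a surjective map, so the leading form of \<open>f\<close> would vanish everywhere.\<close>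
    have surj: "\<exists>y1 y2. Z1 y1 y2 = X1 \<and> Z2 y1 y2 = X2" for X1 X2
    proof (cases "u = q")
      case True
      define J where "J = a (1, 0) * b (0, 1) - a (0, 1) * b (1, 0)"
      define y1 where "y1 = (X1 * b (0, 1) - a (0, 1) * X2) / J"
      define y2 where "y2 = (a (1, 0) * X2 - X1 * b (1, 0)) / J"
      have J: "J \<noteq> 0" using jac by (simp add: J_def)
      have "a (1, 0) * y1 + a (0, 1) * y2 =
          (a (1, 0) * (X1 * b (0, 1) - a (0, 1) * X2) + a (0, 1) * (a (1, 0) * X2 - X1 * b (1, 0))) / J"
        unfolding y1_def y2_def by (simp only: times_divide_eq_right add_divide_distrib)
      also have "\<dots> = X1 * J / J" by (rule arg_cong[of _ _ "\<lambda>x. x / J"]) (simp add: J_def algebra_simps)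
      finally have "a (1, 0) * y1 + a (0, 1) * y2 = X1 * J / J" .
      moreover have "b (1, 0) * y1 + b (0, 1) * y2 =
          (b (1, 0) * (X1 * b (0, 1) - a (0, 1) * X2) + b (0, 1) * (a (1, 0) * X2 - X1 * b (1, 0))) / J"
        unfolding y1_def y2_def by (simp only: times_divide_eq_right add_divide_distrib)
      moreover have "\<dots> = X2 * J / J" by (rule arg_cong[of _ _ "\<lambda>x. x / J"]) (simp add: J_def algebra_simps)
      ultimately have "Z1 y1 y2 = X1 \<and> Z2 y1 y2 = X2"
        using J by (simp add: Z1_def Z2_def True linear_edge_form[OF qu(1)])
      then show ?thesis by blast
    next
      case False
      then have qu': "q < u" using qu by simp
      have "b (1, 0) = 0" using \<open>\<forall>i. b (i, 0) \<noteq> 0 \<longrightarrow> u \<le> q * i\<close> qu' by force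
      then have b01: "b (0, 1) \<noteq> 0" using jac by auto
      have "{(j, k). q * j + u * k = q} = {(1, 0)}"
      proof -
        have "j = 1 \<and> k = 0" if "q * j + u * k = q" for j k
        proof -
          have "k = 0"
          proof (rule ccontr)
            assume "k \<noteq> 0"
            then have "u * 1 \<le> u * k" by (intro mult_le_mono2) simp
            then show False using that qu' by linarith
          qed
          then show ?thesis using that qu(1) by simp
        qed
        then show ?thesis by auto
      qed
      then have Z1: "Z1 y1 y2 = a (1, 0) * y1" for y1 y2 by (simp add: Z1_def edge_form_def)
      define J where "J = {(j, k). q * j + u * k = u \<and> k = 0}"
      have finJ: "finite J" unfolding J_def by (rule finite_subset[OF _ finite_edge[OF qu(1,2), of u]]) auto
      have "{(j, k). q * j + u * k = u} = insert (0, 1) J"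
      proof -
        have "j = 0 \<and> k = 1" if "q * j + u * k = u" "k \<noteq> 0" for j k
        proof -
          have "u * 1 \<le> u * k" using that(2) by (intro mult_le_mono2) simp
          then have "q * j = 0" "u * k = u" using that(1) by linarith+
          then show ?thesis using qu by simp
        qed
        then show ?thesis by (auto simp: J_def)
      qed
      moreover have "(0, 1) \<notin> J" by (simp add: J_def)
      ultimately have Z2: "Z2 y1 y2 = b (0, 1) * y2 + (\<Sum>(j, k)\<in>J. b (j, k) * y1 ^ j)" for y1 y2
        using finJ by (auto simp: Z2_def edge_form_def J_def intro!: sum.cong)
      define y1 where "y1 = X1 / a (1, 0)"
      define y2 where "y2 = (X2 - (\<Sum>(j, k)\<in>J. b (j, k) * y1 ^ j)) / b (0, 1)"
      have "Z1 y1 y2 = X1 \<and> Z2 y1 y2 = X2"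
        using a1 b01 by (simp add: Z1 Z2 y1_def y2_def)
      then show ?thesis by blast
    qed
    have "edge_form c q u N X1 X2 = 0" for X1 X2 using surj[of X1 X2] Z by metis
    with att edge_form_eq_0D[OF qu(1,2), of c N] show False by blast
  next
    case False
    define k where "k = (LEAST i. b (i, 0) \<noteq> 0)"
    obtain i where i: "b (i, 0) \<noteq> 0" "q * i < u" using False by (auto simp: not_le)
    have bk: "b (k, 0) \<noteq> 0" unfolding k_def by (rule LeastI[of _ i]) (rule i)
    have bl: "b (i, 0) = 0" if "i < k" for i using not_less_Least[of i] that unfolding k_def by blast
    have "k \<le> i" unfolding k_def by (rule Least_le) (rule i)
    then have "q * k \<le> q * i" by simp
    then have qk: "q * k < u" using i(2) by linarith
    have k: "0 < k" using bk b(2) by (cases k) auto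
    have sa: "1 \<le> 1 * j + k * l" if "a (j, l) \<noteq> 0" for j l
      using that a(2) k by (cases j; cases l) auto
    have sb: "k \<le> 1 * j + k * l" if "b (j, l) \<noteq> 0" for j l
      using that bl[of j] by (cases "j < k"; cases l) auto
    obtain N where N: "\<And>j l. c (j, l) \<noteq> 0 \<Longrightarrow> N \<le> 1 * j + k * l"
      and att: "\<exists>j l. c (j, l) \<noteq> 0 \<and> 1 * j + k * l = N"
      using minimal_weight[OF c0] by blast
    note tr = leading_transfer_coordinates[OF f a(1) b(1) e ev zero_less_one k N sa sb]
    have Nd: "real N \<le> (1 + real k) * d" using is_distance_weight_le[OF D N] by simp
    define p where "p = edge_poly c 1 k N"
    have p0: "p \<noteq> 0"
    proof
      assume "p = 0"
      then show False using att coeff_edge_poly(1)[OF zero_less_one k, of _ _ N c] unfolding p_def by force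
    qed
    define \<alpha> \<alpha>' \<beta> \<gamma> where "\<alpha> = a (1, 0)" and "\<alpha>' = (if k = 1 then a (0, 1) else 0)"
      and "\<beta> = b (k, 0)" and "\<gamma> = b (0, 1)"
    define \<Delta> where "\<Delta> = \<alpha> * \<gamma> - \<alpha>' * \<beta>"
    have \<Delta>: "\<Delta> \<noteq> 0"
      using jac bl[of 1] k by (cases "k = 1") (auto simp: \<Delta>_def \<alpha>_def \<alpha>'_def \<beta>_def \<gamma>_def)
    have Z1: "edge_form a 1 k 1 1 v = \<alpha> + \<alpha>' * v" for v
    proof (cases "k = 1")
      case True
      then show ?thesis using linear_edge_form[of 1 a 1 v] by (simp add: \<alpha>_def \<alpha>'_def)
    next
      case False
      then have "{(j, l). 1 * j + k * l = 1} = {(1, 0)}" using k by (auto simp: add_is_1)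
      then show ?thesis using False by (simp add: edge_form_def \<alpha>_def \<alpha>'_def)
    qed
    have Z2: "edge_form b 1 k k 1 v = \<beta> + \<gamma> * v" for v
    proof -
      have "j = k \<and> l = 0 \<or> j = 0 \<and> l = 1" if "1 * j + k * l = k" for j l
      proof (cases l)
        case (Suc l')
        then show ?thesis using that k by simp
      qed (use that in simp)
      then have "{(j, l). 1 * j + k * l = k} = {(k, 0), (0, 1)}" by auto
      then show ?thesis using k by (simp add: edge_form_def \<beta>_def \<gamma>_def)
    qed
    define b0 where "b0 = \<beta> / \<alpha> ^ k"
    define n where "n = order b0 p"
    have \<alpha>0: "\<alpha> \<noteq> 0" using a1 by (simp add: \<alpha>_def)
    have "b0 \<noteq> 0" using bk \<alpha>0 by (simp add: b0_def \<beta>_def)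
    then have nd: "real n \<le> d"
      using cond[OF k bk] N p0 unfolding edge_condition_def n_def p_def by blast
    define A where "A v = \<alpha> + \<alpha>' * v" for v
    define z where "z v = (\<beta> + \<gamma> * v) / A v ^ k" for v
    \<comment> \<open>\<open>P\<close> is computed in two ways: from the given series \<open>e\<close>, whose terms of small degree vanish, and
      from the edge polynomial \<open>p\<close> of \<open>f\<close> along the curve \<open>z\<close>.\<close>
    define P where "P = edge_poly e 1 k N"
    have PA: "poly P v = A v ^ N * poly p (z v)" if "A v \<noteq> 0" for v
    proof -
      have "poly P v = edge_form c 1 k N (A v) (\<beta> + \<gamma> * v)"
        using tr(2)[of 1 v] unfolding P_def edge_form_1[symmetric] A_def Z1 Z2 .
      also have "\<dots> = edge_form c 1 k N (A v ^ 1 * 1) (A v ^ k * z v)" using that by (simp add: z_def)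
      also have "\<dots> = A v ^ N * poly p (z v)" by (simp only: edge_form_scale edge_form_1 p_def)
      finally show ?thesis .
    qed
    obtain G where G: "p = [:- b0, 1:] ^ n * G" "\<not> [:- b0, 1:] dvd G"
      using order_decomp[OF p0, of b0] unfolding n_def by blast
    have Gb: "poly G b0 \<noteq> 0" using G(2) by (simp add: poly_eq_0_iff_dvd)
    have zb: "z v - b0 = v * (\<Delta> / (\<alpha> * A v ^ k))" if Av: "A v \<noteq> 0" for v
    proof (cases "k = 1")
      case True
      have "(\<beta> + \<gamma> * v) / A v - \<beta> / \<alpha> = (\<alpha> * (\<beta> + \<gamma> * v) - \<beta> * A v) / (\<alpha> * A v)"
        using \<alpha>0 Av by (simp add: field_simps)
      also have "\<alpha> * (\<beta> + \<gamma> * v) - \<beta> * A v = v * \<Delta>" by (simp add: \<Delta>_def A_def algebra_simps)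
      finally show ?thesis by (simp add: z_def b0_def True)
    next
      case False
      then have "\<alpha>' = 0" by (simp add: \<alpha>'_def)
      then show ?thesis using \<alpha>0 by (simp add: z_def b0_def A_def \<Delta>_def field_simps)
    qed
    have coeffP: "coeff P l = 0" if "l \<le> n" for l
    proof (rule ccontr)
      assume "coeff P l \<noteq> 0"
      then obtain j where j: "1 * j + k * l = N" "e (j, l) \<noteq> 0"
        using coeff_edge_poly[OF zero_less_one k] unfolding P_def by metis
      have "(real q + real u) * d < real (q * j + u * l)" by (rule sup[OF j(2)])
      also have "real (q * j + u * l) = real q * real N + (real u - real q * real k) * real l"
        using j(1) by (auto simp: algebra_simps)
      also have "\<dots> \<le> real q * ((1 + real k) * d) + (real u - real q * real k) * real l"
        using Nd by (intro add_right_mono mult_left_mono) auto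
      finally have "0 < (real u - real q * real k) * (real l - d)" by (simp add: algebra_simps)
      moreover have "real l \<le> d" using that nd by linarith
      moreover have "0 < real u - real q * real k"
        using qk by (metis diff_gt_0_iff_gt of_nat_less_iff of_nat_mult)
      ultimately show False by (simp add: zero_less_mult_iff)
    qed
    \<comment> \<open>Dividing by \<open>v^n\<close>, one expression for \<open>P\<close> tends to \<open>0\<close> and the other to a non-zero number.\<close>
    define R where "R = poly_shift (Suc n) P"
    have PR: "P = monom 1 (Suc n) * R"
      by (rule poly_eqI) (use coeffP in \<open>auto simp: coeff_monom_mult R_def coeff_poly_shift\<close>)
    have tA: "(A \<longlongrightarrow> \<alpha>) (at 0)"
    proof -
      have "(A \<longlongrightarrow> \<alpha> + \<alpha>' * 0) (at 0)" unfolding A_def by (intro tendsto_intros)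
      then show ?thesis by simp
    qed
    have tz: "(z \<longlongrightarrow> b0) (at 0)"
    proof -
      have "(z \<longlongrightarrow> (\<beta> + \<gamma> * 0) / \<alpha> ^ k) (at 0)" unfolding z_def by (intro tendsto_intros tA) (use \<alpha>0 in simp)
      then show ?thesis by (simp add: b0_def)
    qed
    have tG: "((\<lambda>v. poly G (z v)) \<longlongrightarrow> poly G b0) (at 0)"
      by (rule isCont_tendsto_compose[OF _ tz]) simp
    have lim1: "((\<lambda>v. A v ^ N * ((\<Delta> / (\<alpha> * A v ^ k)) ^ n * poly G (z v))) \<longlongrightarrow>
        \<alpha> ^ N * ((\<Delta> / (\<alpha> * \<alpha> ^ k)) ^ n * poly G b0)) (at 0)"
      by (intro tendsto_intros tA tG) (use \<alpha>0 in simp)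
    have "((\<lambda>v. v * poly R v) \<longlongrightarrow> 0 * poly R 0) (at 0)"
      by (intro tendsto_mult tendsto_ident_at isCont_tendsto_compose[OF _ tendsto_ident_at]) simp
    moreover have "\<forall>\<^sub>F v in at 0. v * poly R v = A v ^ N * ((\<Delta> / (\<alpha> * A v ^ k)) ^ n * poly G (z v))"
    proof -
      have "\<forall>\<^sub>F v in at 0. A v \<noteq> 0" using tendsto_imp_eventually_ne[OF tA \<alpha>0] .
      moreover have "\<forall>\<^sub>F v in at (0::real). v \<noteq> 0" by (simp add: eventually_at_filter)
      ultimately show ?thesis
      proof eventually_elim
        case (elim v)
        have "v ^ Suc n * poly R v = poly P v" by (simp add: PR poly_monom)
        also have "\<dots> = A v ^ N * ((z v - b0) ^ n * poly G (z v))"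
          by (simp add: PA[OF elim(1)] G(1) )
        also have "\<dots> = v ^ n * (A v ^ N * ((\<Delta> / (\<alpha> * A v ^ k)) ^ n * poly G (z v)))"
          unfolding zb[OF elim(1)] power_mult_distrib by (simp only: mult_ac)
        finally have "v ^ n * (v * poly R v) = v ^ n * (A v ^ N * ((\<Delta> / (\<alpha> * A v ^ k)) ^ n * poly G (z v)))"
          by (simp only: power_Suc mult_ac)
        then show ?case using elim(2) by (simp only: mult_cancel_left power_eq_0_iff) auto
      qed
    qed
    ultimately have "((\<lambda>v. A v ^ N * ((\<Delta> / (\<alpha> * A v ^ k)) ^ n * poly G (z v))) \<longlongrightarrow> 0 * poly R 0) (at 0)"
      by (rule Lim_transform_eventually)
    from tendsto_unique[OF _ lim1 this] \<alpha>0 \<Delta> Gb show False by simp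
  qed
qed

lemma real_analytic2_iff: "real_analytic2 f \<longleftrightarrow> analytic2 f"
  by (simp add: real_analytic2_def analytic2_def has_power_series2_iff_has_dps)

lemma real_analytic1_iff: "real_analytic1 g \<longleftrightarrow> analytic1 g"
  by (simp add: real_analytic1_def analytic1_def)

definition swap_coeffs :: "(nat \<times> nat \<Rightarrow> 'a) \<Rightarrow> nat \<times> nat \<Rightarrow> 'a" where
  "swap_coeffs c = (\<lambda>(j, k). c (k, j))"

lemma swap_coeffs_apply [simp]: "swap_coeffs c (j, k) = c (k, j)"
  by (simp add: swap_coeffs_def)

lemma has_dps_swap': "has_dps f c \<Longrightarrow> has_dps (\<lambda>(x, z). f (z, x)) (swap_coeffs c)"
  unfolding swap_coeffs_def by (rule has_dps_swap)

lemma supports_swap: "supports (swap_coeffs c) w1 w2 m \<longleftrightarrow> supports c w2 w1 m"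
  by (auto simp: supports_def add.commute)

lemma is_distance_swap: "is_distance c d \<Longrightarrow> is_distance (swap_coeffs c) d"
  unfolding is_distance_def supports_swap by (metis add.commute)

lemma swap_coeffs_nonzero: "c \<noteq> (\<lambda>_. 0) \<Longrightarrow> swap_coeffs c \<noteq> (\<lambda>_. 0)"
  unfolding fun_eq_iff by (metis swap_coeffs_apply surj_pair)

text \<open>For the weight \<open>(1, 1)\<close> the leading parts are linear, and that of the inverse map is a left
  inverse of that of \<open>\<phi>\<close>.\<close>

lemma analytic_coordinatesD:
  assumes "analytic_coordinates \<phi>"
  obtains a b where "has_dps (\<lambda>y. fst (\<phi> y)) a" "has_dps (\<lambda>y. snd (\<phi> y)) b" "a (0, 0) = 0" "b (0, 0) = 0"
    "a (1, 0) * b (0, 1) - a (0, 1) * b (1, 0) \<noteq> 0"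
proof -
  obtain \<eta> where \<phi>: "real_analytic_map \<phi>" "\<phi> (0, 0) = (0, 0)" and \<eta>: "real_analytic_map \<eta>"
    and inv: "\<forall>\<^sub>F y in nhds (0, 0). \<eta> (\<phi> y) = y"
    using assms unfolding analytic_coordinates_def by blast
  obtain a b where a: "has_dps (\<lambda>y. fst (\<phi> y)) a" and b: "has_dps (\<lambda>y. snd (\<phi> y)) b"
    using \<phi>(1) by (auto simp: real_analytic_map_def real_analytic2_iff analytic2_def o_def)
  obtain h1 h2 where h1: "has_dps (\<lambda>y. fst (\<eta> y)) h1" and h2: "has_dps (\<lambda>y. snd (\<eta> y)) h2"
    using \<eta> by (auto simp: real_analytic_map_def real_analytic2_iff analytic2_def o_def)
  have "\<eta> (0, 0) = (0, 0)" using eventually_nhds_x_imp_x[OF inv] \<phi>(2) by simp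
  then have 0: "a (0, 0) = 0" "b (0, 0) = 0" "h1 (0, 0) = 0" "h2 (0, 0) = 0"
    using has_dps_at_0[OF a] has_dps_at_0[OF b] has_dps_at_0[OF h1] has_dps_at_0[OF h2] \<phi>(2) by auto
  have supp: "1 \<le> 1 * j + 1 * k" if "e (j, k) \<noteq> 0" "e (0, 0) = 0" for e :: "nat \<times> nat \<Rightarrow> real" and j k
    using that by (cases j; cases k) auto
  have sa: "1 \<le> 1 * j + 1 * k" if "a (j, k) \<noteq> 0" for j k using supp[of a, OF that 0(1)] .
  have sb: "1 \<le> 1 * j + 1 * k" if "b (j, k) \<noteq> 0" for j k using supp[of b, OF that 0(2)] .
  have s1: "1 \<le> 1 * j + 1 * k" if "h1 (j, k) \<noteq> 0" for j k using supp[of h1, OF that 0(3)] .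
  have s2: "1 \<le> 1 * j + 1 * k" if "h2 (j, k) \<noteq> 0" for j k using supp[of h2, OF that 0(4)] .
  have ev1: "\<forall>\<^sub>F y in nhds (0, 0). fst y = fst (\<eta> (fst (\<phi> y), snd (\<phi> y)))"
    and ev2: "\<forall>\<^sub>F y in nhds (0, 0). snd y = snd (\<eta> (fst (\<phi> y), snd (\<phi> y)))"
    using inv by (auto elim: eventually_mono)
  define Z1 Z2 where "Z1 y1 y2 = a (1, 0) * y1 + a (0, 1) * y2"
    and "Z2 y1 y2 = b (1, 0) * y1 + b (0, 1) * y2" for y1 y2
  note lin = linear_edge_form[OF zero_less_one]
  have e1: "y1 = h1 (1, 0) * Z1 y1 y2 + h1 (0, 1) * Z2 y1 y2" for y1 y2
    using leading_transfer_coordinates(2)[OF h1 a b has_dps_X ev1 zero_less_one zero_less_one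
        s1 sa sb, of y1 y2]
    unfolding lin Z1_def Z2_def by simp
  have e2: "y2 = h2 (1, 0) * Z1 y1 y2 + h2 (0, 1) * Z2 y1 y2" for y1 y2
    using leading_transfer_coordinates(2)[OF h2 a b has_dps_Z ev2 zero_less_one zero_less_one
        s2 sa sb, of y1 y2]
    unfolding lin Z1_def Z2_def by simp
  have "a (1, 0) * b (0, 1) - a (0, 1) * b (1, 0) \<noteq> 0"
  proof
    assume J: "a (1, 0) * b (0, 1) - a (0, 1) * b (1, 0) = 0"
    have z: "Z1 (a (0, 1)) (- a (1, 0)) = 0" "Z2 (a (0, 1)) (- a (1, 0)) = 0"
      "Z1 (b (0, 1)) (- b (1, 0)) = 0" "Z2 (b (0, 1)) (- b (1, 0)) = 0"
      using J by (auto simp: Z1_def Z2_def algebra_simps)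
    have "a (0, 1) = 0" "a (1, 0) = 0" "b (0, 1) = 0" "b (1, 0) = 0"
      using e1[of "a (0, 1)" "- a (1, 0)"] e2[of "- a (1, 0)" "a (0, 1)"]
        e1[of "b (0, 1)" "- b (1, 0)"] e2[of "- b (1, 0)" "b (0, 1)"] z by simp_all
    then have "Z1 1 0 = 0" "Z2 1 0 = 0" by (simp_all add: Z1_def Z2_def)
    with e1[of 1 0] show False by simp
  qed
  then show ?thesis using that a b 0 by blast
qed

lemma dps_nonzero:
  assumes "has_dps f c" "\<not> (\<forall>\<^sub>F y in nhds (0, 0). f y = 0)"
  shows "c \<noteq> (\<lambda>_. 0)"
proof
  assume "c = (\<lambda>_. 0)"
  obtain r B where r: "0 < r" "\<And>x z. norm x \<le> r \<Longrightarrow> norm z \<le> r \<Longrightarrow> f (x, z) = dps_eval c x z"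
    by (rule has_dpsE[OF assms(1)]) (rule that)
  have "f (x, z) = 0" if "norm x < r" "norm z < r" for x z
    using r(2)[of x z] that by (simp add: \<open>c = _\<close> dps_eval_def case_prod_unfold)
  then have "\<forall>\<^sub>F y in nhds (0, 0). f y = 0"
    unfolding eventually_nhds_00 using r(1) by blast
  with assms(2) show False by simp
qed

lemma dps_nonzero_iff:
  assumes "has_dps f c"
  shows "c \<noteq> (\<lambda>_. 0) \<longleftrightarrow> \<not> (\<forall>\<^sub>F y in nhds (0, 0). f y = 0)"
proof -
  have "has_dps (\<lambda>_. 0) (\<lambda>_. 0 :: 'a)" unfolding has_dps_def by (intro exI[of _ 1]) (simp add: case_prod_unfold)
  then show ?thesis using dps_nonzero[OF assms] has_dps_unique[OF assms] by blast
qed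

text \<open>The clause for exchanged variables starts at \<open>2\<close>: for slope \<open>1\<close> the exchange replaces the non-zero
  roots by their reciprocals, with the same multiplicities.\<close>

definition edge_conditions :: "(nat \<times> nat \<Rightarrow> real) \<Rightarrow> real \<Rightarrow> bool" where
  "edge_conditions c d \<longleftrightarrow>
     (\<forall>k>0. edge_condition c d k) \<and> (\<forall>k\<ge>2. edge_condition (swap_coeffs c) d k)"

text \<open>If the first coordinate function has vanishing derivative in \<open>y1\<close>, the second one does not, and the
  old variables are exchanged. The order \<open>k\<close> of the graph is then at least \<open>2\<close>.\<close>

lemma weighted_order_le_oriented:
  fixes f \<phi>1 \<phi>2 :: "real \<times> real \<Rightarrow> real"
  assumes f: "has_dps f c" and D: "is_distance c d" and c0: "c \<noteq> (\<lambda>_. 0)" and cond: "edge_conditions c d"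
    and a: "has_dps \<phi>1 a" "a (0, 0) = 0" and b: "has_dps \<phi>2 b" "b (0, 0) = 0"
    and jac: "a (1, 0) * b (0, 1) - a (0, 1) * b (1, 0) \<noteq> 0"
    and e: "has_dps (\<lambda>y. f (\<phi>1 y, \<phi>2 y)) e"
    and qu: "0 < q" "0 < u" "q \<le> u"
  shows "\<exists>j k. e (j, k) \<noteq> 0 \<and> real (q * j + u * k) \<le> (real q + real u) * d"
proof (cases "a (1, 0) = 0")
  case False
  show ?thesis
    by (rule weighted_order_le_transversal[OF f D c0 a b False jac e qu]) (use cond in \<open>auto simp: edge_conditions_def\<close>)
next
  case True
  then have b1: "b (1, 0) \<noteq> 0" using jac by auto
  have jac': "b (1, 0) * a (0, 1) - b (0, 1) * a (1, 0) \<noteq> 0" using jac by (simp add: mult.commute)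
  have e': "has_dps (\<lambda>y. (\<lambda>(x, z). f (z, x)) (\<phi>2 y, \<phi>1 y)) e" using e by simp
  have "edge_condition (swap_coeffs c) d k" if "0 < k" "a (k, 0) \<noteq> 0" for k
  proof -
    have "k \<noteq> 1" using that True by auto
    then show ?thesis using that cond by (auto simp: edge_conditions_def)
  qed
  then show ?thesis
    by (rule weighted_order_le_transversal[OF has_dps_swap'[OF f] is_distance_swap[OF D] swap_coeffs_nonzero[OF c0]
        b a b1 jac' e' qu])
qed

text \<open>A larger distance in the new coordinates would be witnessed by an integral weight \<open>(q, u)\<close>.
  Exchanging the new variables if necessary makes \<open>q \<le> u\<close>.\<close>

theorem newton_distance_le:
  fixes f :: "real \<times> real \<Rightarrow> real"
  assumes f: "has_dps f c" and D: "is_distance c d" and c0: "c \<noteq> (\<lambda>_. 0)" and cond: "edge_conditions c d"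
    and \<phi>: "analytic_coordinates \<phi>"
  shows "newton_distance (f \<circ> \<phi>) \<le> d"
proof (rule ccontr)
  assume "\<not> ?thesis"
  then have gt: "d < newton_distance (f \<circ> \<phi>)" by simp
  obtain a b where a: "has_dps (\<lambda>y. fst (\<phi> y)) a" "a (0, 0) = 0" and b: "has_dps (\<lambda>y. snd (\<phi> y)) b" "b (0, 0) = 0"
    and jac: "a (1, 0) * b (0, 1) - a (0, 1) * b (1, 0) \<noteq> 0"
    using analytic_coordinatesD[OF \<phi>] by metis
  have \<phi>0: "\<phi> (0, 0) = (0, 0)" using \<phi> by (simp add: analytic_coordinates_def)
  have "analytic2 (\<lambda>y. f (fst (\<phi> y), snd (\<phi> y)))"
    by (rule analytic2_compose) (use f a b \<phi>0 in \<open>auto simp: analytic2_def\<close>)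
  then obtain e where e: "has_dps (\<lambda>y. f (fst (\<phi> y), snd (\<phi> y))) e" by (auto simp: analytic2_def)
  then have e': "has_dps (f \<circ> \<phi>) e" by (simp add: o_def)
  have e0: "e \<noteq> (\<lambda>_. 0)"
  proof
    assume "e = (\<lambda>_. 0)"
    then have z: "\<forall>\<^sub>F y in nhds (0, 0). (f \<circ> \<phi>) y = 0" using dps_nonzero_iff[OF e'] by simp
    obtain \<eta> where \<eta>: "real_analytic_map \<eta>" "\<forall>\<^sub>F y in nhds (0, 0). \<eta> (\<phi> y) = y" "\<forall>\<^sub>F x in nhds (0, 0). \<phi> (\<eta> x) = x"
      using \<phi> unfolding analytic_coordinates_def by blast
    have \<eta>0: "\<eta> (0, 0) = (0, 0)" using eventually_nhds_x_imp_x[OF \<eta>(2)] \<phi>0 by simp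
    have "\<forall>\<^sub>F (y1, y2) in nhds (0, 0). f (\<phi> (y1, y2)) = 0" using z by (simp add: case_prod_unfold)
    then have "\<forall>\<^sub>F x in nhds (0, 0). f (\<phi> (fst (\<eta> x), snd (\<eta> x))) = 0"
      by (rule eventually_analytic2_pair[rotated 4])
         (use \<eta>(1) \<eta>0 in \<open>auto simp: real_analytic_map_def real_analytic2_iff o_def\<close>)
    with \<eta>(3) have "\<forall>\<^sub>F x in nhds (0, 0). f x = 0" by eventually_elim simp
    with dps_nonzero_iff[OF f] c0 show False by simp
  qed
  note De = newton_distance[OF e' e0]
  obtain w1 w2 where w: "0 \<le> w1" "0 \<le> w2" "0 < w1 + w2"
    and sup: "supports e w1 w2 ((w1 + w2) * newton_distance (f \<circ> \<phi>))"
    by (rule is_distanceE[OF De])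
  have d0: "0 \<le> d" using is_distance_le[OF D, of 1 0 0] by (simp add: supports_def)
  obtain q u :: nat where qu: "0 < q" "0 < u"
    and big: "\<And>j k. e (j, k) \<noteq> 0 \<Longrightarrow> (real q + real u) * d < real (q * j + u * k)"
    using rational_weight[OF w sup d0 gt] by metis
  show False
  proof (cases "q \<le> u")
    case True
    from weighted_order_le_oriented[OF f D c0 cond a b jac e qu True] big show False by fastforce
  next
    case False
    then have "u \<le> q" by simp
    have jac': "swap_coeffs a (1, 0) * swap_coeffs b (0, 1) - swap_coeffs a (0, 1) * swap_coeffs b (1, 0) \<noteq> 0"
      using jac by (simp add: mult.commute)
    have es: "has_dps (\<lambda>y. f ((\<lambda>(x, z). fst (\<phi> (z, x))) y, (\<lambda>(x, z). snd (\<phi> (z, x))) y)) (swap_coeffs e)"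
      using has_dps_swap'[OF e] by (simp add: case_prod_unfold)
    from weighted_order_le_oriented[OF f D c0 cond has_dps_swap'[OF a(1)] _ has_dps_swap'[OF b(1)] _ jac' es qu(2,1) \<open>u \<le> q\<close>]
      a b obtain j k where jk: "e (k, j) \<noteq> 0" "real (u * j + q * k) \<le> (real u + real q) * d" by auto
    with big[OF jk(1)] show False by (simp add: add.commute)
  qed
qed

section \<open>Construction of the shift\<close>

lemma analytic2_shift:
  assumes "analytic2 f" "analytic1 \<psi>" "\<psi> 0 = 0"
  shows "analytic2 (\<lambda>(x, z). f (x, z + \<psi> x))"
proof -
  have "analytic2 (\<lambda>y. f (fst y, snd y + \<psi> (fst y)))"
    by (rule analytic2_compose[OF assms(1)]) (use assms in \<open>auto intro!: analytic_intros\<close>)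
  then show ?thesis by (simp add: case_prod_unfold)
qed

lemma tendsto_at_right_scaled:
  fixes h :: "real \<Rightarrow> real"
  assumes "analytic1 h" "0 < q"
  shows "((\<lambda>s. h (s ^ q * y)) \<longlongrightarrow> h 0) (at_right 0)"
proof -
  have "((\<lambda>s. s ^ q * y) \<longlongrightarrow> 0 ^ q * y) (at_right 0)" by (intro tendsto_intros)
  then have "filterlim (\<lambda>s. s ^ q * y) (nhds 0) (at_right 0)" using assms(2) by (simp add: zero_power)
  from filterlim_compose[OF analytic1_tendsto[OF assms(1)] this] show ?thesis .
qed

text \<open>For fixed small \<open>x > 0\<close> both sides are power series in \<open>w\<close>; the coefficients of \<open>w^m\<close> are
  compared.\<close>

lemma shifted_vanishing_slice:
  fixes f H :: "real \<times> real \<Rightarrow> real"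
  assumes g: "has_dps g c" and H: "has_dps H e" and m: "\<And>j. e (j, m) = 0"
    and eq: "\<forall>\<^sub>F (x, w) in nhds (0, 0). g (x, x ^ k * w) = x ^ N * H (x, w)"
  shows "c (j, m) = 0"
proof -
  obtain r where r: "r > 0" and eq': "\<And>x w. norm x < r \<Longrightarrow> norm w < r \<Longrightarrow> g (x, x ^ k * w) = x ^ N * H (x, w)"
    using eq unfolding eventually_nhds_00 by auto
  obtain s1 where s1: "s1 > 0"
    and c1: "\<And>k x. norm x < s1 \<Longrightarrow> (\<lambda>j. c (j, k) * x ^ j) sums eval_fps (dps_slice c k) x"
    and c2: "\<And>x z. norm x < s1 \<Longrightarrow> norm z < s1 \<Longrightarrow> ((\<lambda>k. eval_fps (dps_slice c k) x * z ^ k) has_sum g (x, z)) UNIV"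
    by (rule has_dps_slices[OF g]) (rule that)
  obtain s2 where s2: "s2 > 0"
    and e2: "\<And>x z. norm x < s2 \<Longrightarrow> norm z < s2 \<Longrightarrow> ((\<lambda>k. eval_fps (dps_slice e k) x * z ^ k) has_sum H (x, z)) UNIV"
    by (rule has_dps_slices[OF H]) (rule that)
  have em: "dps_slice e m = 0" by (rule fps_ext) (simp add: dps_slice_def m)
  define \<rho> where "\<rho> = min (min r 1) (min s1 s2)"
  have \<rho>: "\<rho> > 0" using r s1 s2 by (simp add: \<rho>_def)
  have z: "eval_fps (dps_slice c m) x = 0" if x: "0 < x" "x < \<rho>" for x
  proof -
    have "(eval_fps (dps_slice c m) x * (x ^ k) ^ m - x ^ N * eval_fps (dps_slice e m) x) = 0"
    proof (rule powser_eq_0_on_reals[OF \<rho>, of "\<lambda>l. eval_fps (dps_slice c l) x * (x ^ k) ^ l - x ^ N * eval_fps (dps_slice e l) x"])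
      fix w :: real assume w: "0 < w" "w < \<rho>"
      have "x ^ k \<le> 1" using x by (intro power_le_one) (auto simp: \<rho>_def)
      then have "x ^ k * w \<le> 1 * w" using w by (intro mult_right_mono) auto
      moreover have "norm (x ^ k * w) = x ^ k * w" using w x by (simp add: abs_mult)
      moreover have "w < s1" using w by (simp add: \<rho>_def)
      ultimately have nz: "norm (x ^ k * w) < s1" by linarith
      have 1: "((\<lambda>l. eval_fps (dps_slice c l) x * (x ^ k * w) ^ l) has_sum g (x, x ^ k * w)) UNIV"
        by (rule c2[OF _ nz]) (use x in \<open>simp add: \<rho>_def\<close>)
      have 2: "((\<lambda>l. x ^ N * (eval_fps (dps_slice e l) x * w ^ l)) has_sum x ^ N * H (x, w)) UNIV"
        by (rule has_sum_cmult_right[OF e2]) (use x w in \<open>auto simp: \<rho>_def\<close>)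
      have 3: "g (x, x ^ k * w) = x ^ N * H (x, w)" by (rule eq') (use x w in \<open>auto simp: \<rho>_def\<close>)
      have 4: "(\<lambda>l. (eval_fps (dps_slice c l) x * (x ^ k) ^ l - x ^ N * eval_fps (dps_slice e l) x) * of_real w ^ l)
        = (\<lambda>l. eval_fps (dps_slice c l) x * (x ^ k * w) ^ l + - (x ^ N * (eval_fps (dps_slice e l) x * w ^ l)))"
        by (simp add: power_mult_distrib algebra_simps)
      show "(\<lambda>l. (eval_fps (dps_slice c l) x * (x ^ k) ^ l - x ^ N * eval_fps (dps_slice e l) x) * of_real w ^ l) sums 0"
        unfolding 4 using has_sum_imp_sums[OF has_sum_add[OF 1 has_sum_uminusI[OF 2]]] by (simp only: 3 add.right_inverse)
    qed
    then show ?thesis using x by (simp add: em)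
  qed
  show ?thesis
  proof (rule powser_eq_0_on_reals[OF \<rho>, of "\<lambda>j. c (j, m)"])
    fix x :: real assume x: "0 < x" "x < \<rho>"
    then show "(\<lambda>j. c (j, m) * of_real x ^ j) sums 0"
      using c1[of x m] z[OF x] by (simp add: \<rho>_def)
  qed
qed

text \<open>By \<open>edge_condition_auto\<close> the failing weight is proportional to that of the supporting line.\<close>

lemma edge_condition_fails:
  assumes D: "is_distance c d" and w: "0 \<le> w1" "0 \<le> w2" "0 < w1 + w2" "supports c w1 w2 ((w1 + w2) * d)"
    and k: "0 < k" and fail: "\<not> edge_condition c d k"
  obtains N b where "w2 = real k * w1" "0 < w1" "supports c 1 (real k) ((1 + real k) * d)"
    "\<And>j l. c (j, l) \<noteq> 0 \<Longrightarrow> N \<le> 1 * j + k * l" "edge_poly c 1 k N \<noteq> 0" "b \<noteq> 0"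
    "d < real (order b (edge_poly c 1 k N))" "real N = (1 + real k) * d"
proof -
  have w2: "w2 = real k * w1" using edge_condition_auto[OF D w(1,2,4) k] fail by blast
  have w1: "0 < w1" using w w2 by (cases "w1 = 0") auto
  have sup: "supports c 1 (real k) ((1 + real k) * d)"
    unfolding supports_def
  proof (intro allI impI)
    fix j l assume "c (j, l) \<noteq> 0"
    then have "(w1 + w2) * d \<le> w1 * real j + w2 * real l" using w(4) by (simp add: supports_def)
    then have "w1 * ((1 + real k) * d) \<le> w1 * (1 * real j + real k * real l)"
      by (simp add: w2 algebra_simps)
    then show "(1 + real k) * d \<le> 1 * real j + real k * real l" using w1 by simp
  qed
  obtain N b where N: "\<And>j l. c (j, l) \<noteq> 0 \<Longrightarrow> N \<le> 1 * j + k * l"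
    and p: "edge_poly c 1 k N \<noteq> 0" "b \<noteq> 0" "d < real (order b (edge_poly c 1 k N))"
    using fail unfolding edge_condition_def by (auto simp: not_le)
  have "real N \<le> (1 + real k) * d" using is_distance_weight_le[OF D N] by simp
  moreover have "(1 + real k) * d \<le> real N"
  proof -
    have "coeff (edge_poly c 1 k N) (degree (edge_poly c 1 k N)) \<noteq> 0" using p(1) by simp
    then obtain j where j: "1 * j + k * degree (edge_poly c 1 k N) = N" "c (j, degree (edge_poly c 1 k N)) \<noteq> 0"
      using coeff_edge_poly[OF zero_less_one k] by metis
    then have "(1 + real k) * d \<le> real j + real k * real (degree (edge_poly c 1 k N))"
      using sup by (simp add: supports_def)
    also have "\<dots> = real (1 * j + k * degree (edge_poly c 1 k N))" by simp
    also have "\<dots> = real N" by (simp only: j(1))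
    finally show ?thesis .
  qed
  ultimately show ?thesis using that[OF w2 w1 sup N p] by simp
qed

text \<open>Induction on the multiplicity \<open>n\<close> of the offending root \<open>b\<close>. The blow-up at \<open>b\<close> has order \<open>n\<close>; its
  Tschirnhaus transformation provides \<open>r\<close>, and the shift by \<open>x^k (b + r(x))\<close> keeps the weight \<open>N\<close> for
  \<open>(1, k)\<close> but leaves only terms of degree at least \<open>n > d\<close> on the edge. Thus \<open>(d, d)\<close> is separated from
  the new polyhedron, and supporting lines at its diagonal point have weights steeper than \<open>(1, k)\<close>. If the
  condition fails for the new function, its edge polynomial at the steeper weight has degree at
  most \<open>n\<close> and no term of degree \<open>n - 1\<close>, so that the new multiplicity is smaller than \<open>n\<close>.\<close>

lemma adapted_shift_exists:
  fixes f :: "real \<times> real \<Rightarrow> real"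
  assumes "has_dps f c" "is_distance c d" "0 < k" "supports c 1 (real k) ((1 + real k) * d)"
    "\<And>j l. c (j, l) \<noteq> 0 \<Longrightarrow> N \<le> 1 * j + k * l" "edge_poly c 1 k N \<noteq> 0" "b \<noteq> 0"
    "n = order b (edge_poly c 1 k N)" "d < real n" "real N = (1 + real k) * d"
  shows "\<exists>\<psi> c' d' w1 w2. analytic1 \<psi> \<and> \<psi> 0 = 0 \<and> has_dps (\<lambda>(x, z). f (x, z + \<psi> x)) c' \<and> c' \<noteq> (\<lambda>_. 0) \<and>
    is_distance c' d' \<and> edge_conditions c' d' \<and> 0 \<le> w1 \<and> w1 < w2 \<and> supports c' w1 w2 ((w1 + w2) * d')"
  using assms
proof (induction n arbitrary: f c d k N b rule: less_induct)
  case (less n)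
  note f = less.prems(1) and D = less.prems(2) and k = less.prems(3) and sup = less.prems(4)
    and N = less.prems(5) and p0 = less.prems(6) and b = less.prems(7) and n = less.prems(8)
    and dn = less.prems(9) and Nd = less.prems(10)
  define p where "p = edge_poly c 1 k N"
  have d0: "0 \<le> d" using is_distance_le[OF D, of 1 0 0] by (simp add: supports_def)
  have n0: "0 < n" using dn d0 by linarith
  obtain H E \<rho> where H: "has_dps H E" "0 < \<rho>"
    and Heq: "\<And>s w. norm s < \<rho> \<Longrightarrow> norm w < \<rho> \<Longrightarrow> f (s ^ 1, s ^ k * (b + w)) = s ^ N * H (s, w)"
    and E: "\<And>l. l < n \<Longrightarrow> E (0, l) = 0" "E (0, n) \<noteq> 0"
    by (rule blow_up_row[OF f zero_less_one k N p0, of b, folded n]) (assumption, rule that)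
  obtain r e1 where r: "analytic1 r" "r 0 = 0" and e1: "has_dps (\<lambda>(x, z). H (x, z + r x)) e1"
    and e1n: "\<And>j. e1 (j, n - 1) = 0"
    by (rule tschirnhaus[OF H(1) n0 E]) (assumption, rule that)
  define \<psi>0 where "\<psi>0 x = x ^ k * (b + r x)" for x
  have \<psi>0: "analytic1 \<psi>0" "\<psi>0 0 = 0" unfolding \<psi>0_def using r k by (auto intro!: analytic_intros simp: zero_power)
  define g where "g = (\<lambda>(x, z). f (x, z + \<psi>0 x))"
  have "analytic2 g" unfolding g_def by (rule analytic2_shift) (use f \<psi>0 in \<open>auto simp: analytic2_def\<close>)
  then obtain c1 where c1: "has_dps g c1" by (auto simp: analytic2_def)
  have lim: "((\<lambda>s. y2 + y1 ^ k * (b + r (s ^ 1 * y1))) \<longlongrightarrow> y2 + b * y1 ^ k) (at_right 0)" for y1 y2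
    using tendsto_add[OF tendsto_const tendsto_mult[OF tendsto_const tendsto_add[OF tendsto_const tendsto_at_right_scaled[OF r(1) zero_less_one]]], of y2 "y1 ^ k" b y1]
    by (simp add: r(2) mult.commute)
  have sub: "\<forall>\<^sub>F s in at_right 0. g (s ^ 1 * y1, s ^ k * y2) = f (s ^ 1 * y1, s ^ k * (y2 + y1 ^ k * (b + r (s ^ 1 * y1))))" for y1 y2
    by (rule always_eventually) (simp add: g_def \<psi>0_def power_mult_distrib algebra_simps)
  note tr = leading_transfer[where ?Y1.0 = "\<lambda>y1 y2 s. y1" and ?Z1.0 = "\<lambda>y1 y2. y1"
     and ?Y2.0 = "\<lambda>y1 y2 s. y2 + y1 ^ k * (b + r (s ^ 1 * y1))" and ?Z2.0 = "\<lambda>y1 y2. y2 + b * y1 ^ k",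
     OF f c1 zero_less_one k N sub tendsto_const lim]
  have supp1: "N \<le> 1 * j + k * l" if "c1 (j, l) \<noteq> 0" for j l
    by (rule tr(1)[OF _ that]) assumption
  define p1 where "p1 = edge_poly c1 1 k N"
  have "poly p1 w = poly (pcompose p [:b, 1:]) w" for w
    using tr(2)[of 1 w] by (simp add: edge_form_1 p1_def p_def poly_pcompose add.commute)
  then have p1: "p1 = pcompose p [:b, 1:]" by (intro poly_eqI_degree_lead_coeff poly_ext) auto
  have p1c: "\<And>l. l < n \<Longrightarrow> coeff p1 l = 0" "coeff p1 n \<noteq> 0"
    using order_pcompose_shift(1)[OF p0] order_pcompose_shift(2)[OF p0] unfolding p1 p_def n by auto
  obtain j1 where j1: "1 * j1 + k * n = N" "c1 (j1, n) \<noteq> 0"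
    using p1c(2) coeff_edge_poly[OF zero_less_one k] unfolding p1_def by metis
  have online: "n \<le> l" if "c1 (j, l) \<noteq> 0" "1 * j + k * l = N" for j l
    using p1c(1)[of l] coeff_edge_poly(1)[OF zero_less_one k that(2), of c1] that(1) unfolding p1_def by (cases "l < n") auto
  have c10: "c1 \<noteq> (\<lambda>_. 0)" using j1(2) by auto
  define d1 where "d1 = newton_distance g"
  have D1: "is_distance c1 d1" unfolding d1_def by (rule newton_distance[OF c1 c10])
  have dd1: "d < d1"
  proof (rule ccontr)
    assume "\<not> d < d1"
    then have le: "d1 \<le> d" by simp
    \<comment> \<open>Tilting the weight \<open>(1, k)\<close> by \<open>\<epsilon>\<close> raises the terms on the edge by at least \<open>\<epsilon> n = 1\<close>, as much as
      the gap to the terms off the edge.\<close>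
    define \<epsilon> where "\<epsilon> = 1 / real n"
    have \<epsilon>: "0 < \<epsilon>" "\<epsilon> * real n = 1" using n0 by (auto simp: \<epsilon>_def)
    have "supports c1 1 (real k + \<epsilon>) (real N + 1)"
      unfolding supports_def
    proof (intro allI impI)
      fix j l assume jl: "c1 (j, l) \<noteq> 0"
      have "N \<le> 1 * j + k * l" by (rule supp1[OF jl])
      then consider "1 * j + k * l = N" | "N + 1 \<le> 1 * j + k * l" by linarith
      then show "real N + 1 \<le> 1 * real j + (real k + \<epsilon>) * real l"
      proof cases
        case 1
        then have "real N = real j + real k * real l" by (metis mult_1 of_nat_add of_nat_mult)
        moreover have "\<epsilon> * real n \<le> \<epsilon> * real l" using online[OF jl 1] \<epsilon> by (intro mult_left_mono) auto
        ultimately show ?thesis using \<epsilon> by (simp add: algebra_simps)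
      next
        case 2
        then have "real (N + 1) \<le> real (1 * j + k * l)" by (simp only: of_nat_le_iff)
        moreover have "0 \<le> \<epsilon> * real l" using \<epsilon> by simp
        ultimately show ?thesis by (simp add: algebra_simps)
      qed
    qed
    from is_distance_le[OF D1 _ _ this] \<epsilon> have "real N + 1 \<le> (1 + (real k + \<epsilon>)) * d1" by simp
    also have "\<dots> \<le> (1 + (real k + \<epsilon>)) * d" using le \<epsilon> by (intro mult_left_mono) auto
    finally have "1 \<le> \<epsilon> * d" unfolding Nd by (simp add: algebra_simps)
    moreover have "\<epsilon> * d < \<epsilon> * real n" using dn \<epsilon>(1) by (rule mult_strict_left_mono)
    ultimately show False using \<epsilon> by simp
  qed
  obtain w1 w2 where w: "0 \<le> w1" "0 \<le> w2" "0 < w1 + w2" "supports c1 w1 w2 ((w1 + w2) * d1)"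
    by (rule is_distanceE[OF D1])
  have j1r: "real j1 + real k * real n = (1 + real k) * d"
    using j1(1) Nd by (metis mult_1 of_nat_add of_nat_mult)
  have wk: "real k * w1 < w2"
  proof (rule ccontr)
    assume "\<not> real k * w1 < w2"
    then have "(real k * w1 - w2) * (d - real n) \<le> 0"
      using dn by (intro mult_nonneg_nonpos) auto
    moreover have "(w1 + w2) * d1 \<le> w1 * real j1 + w2 * real n"
      using w(4) j1(2) by (simp add: supports_def)
    moreover have "w1 * real j1 + w2 * real n = (w1 + w2) * d + (real k * w1 - w2) * (d - real n)"
    proof -
      have e: "real j1 = (1 + real k) * d - real k * real n" using j1r by simp
      show ?thesis by (subst e) (simp add: algebra_simps)
    qed
    ultimately have "(w1 + w2) * d1 \<le> (w1 + w2) * d" by simp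
    with w(3) dd1 show False by simp
  qed
  have w12: "w1 < w2"
  proof -
    have "w1 * 1 \<le> w1 * real k" using w(1) k by (intro mult_left_mono) auto
    then show ?thesis using wk by (simp add: mult.commute)
  qed
  have w2pos: "0 < w2" using w12 w(1) by simp
  show ?case
  proof (cases "edge_conditions c1 d1")
    case True
    show ?thesis
      by (intro exI[of _ \<psi>0] exI[of _ c1] exI[of _ d1] exI[of _ w1] exI[of _ w2] conjI)
         (fact \<psi>0 c1[unfolded g_def] c10 D1 True w w12)+
  next
    case False
    have "edge_condition (swap_coeffs c1) d1 k'" if k': "2 \<le> k'" for k'
    proof (rule edge_condition_auto[OF is_distance_swap[OF D1] w(2,1)])
      show "supports (swap_coeffs c1) w2 w1 ((w2 + w1) * d1)" using w(4) by (simp add: supports_swap add.commute)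
      have "w2 * 1 \<le> w2 * real k'" using w2pos k' by (intro mult_left_mono) auto
      then show "w1 \<noteq> real k' * w2" using w12 by (simp add: mult.commute)
    qed (use k' in simp)
    then obtain k' where k': "0 < k'" "\<not> edge_condition c1 d1 k'"
      using False by (auto simp: edge_conditions_def)
    obtain N' b' where k'w: "w2 = real k' * w1" "0 < w1" and sup': "supports c1 1 (real k') ((1 + real k') * d1)"
      and N': "\<And>j l. c1 (j, l) \<noteq> 0 \<Longrightarrow> N' \<le> 1 * j + k' * l" and p': "edge_poly c1 1 k' N' \<noteq> 0" "b' \<noteq> 0"
      and ord': "d1 < real (order b' (edge_poly c1 1 k' N'))" and Nd': "real N' = (1 + real k') * d1"
      using edge_condition_fails[OF D1 w k'] by metis
    have kk': "k < k'" using wk k'w by simp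
    define n' where "n' = order b' (edge_poly c1 1 k' N')"
    have deg: "l \<le> n" if lz: "coeff (edge_poly c1 1 k' N') l \<noteq> 0" for l
    proof -
      obtain j where j: "1 * j + k' * l = N'" "c1 (j, l) \<noteq> 0"
        using lz coeff_edge_poly[OF zero_less_one k'(1)] by metis
      have 1: "N \<le> 1 * j + k * l" by (rule supp1[OF j(2)])
      have 2: "N' \<le> 1 * j1 + k' * n" by (rule N'[OF j1(2)])
      \<comment> \<open>Compare a term \<open>(j, l)\<close> on the new edge with \<open>(j1, n)\<close> in both weights.\<close>
      obtain m where m: "k' = k + m" "0 < m" using kk' less_imp_add_positive by blast
      have "m * l \<le> m * n" using 1 2 j(1) j1(1) unfolding m(1) distrib_right by linarith
      then show ?thesis using m(2) by simp
    qed
    have degree: "degree (edge_poly c1 1 k' N') \<le> n"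
      using deg[of "degree (edge_poly c1 1 k' N')"] p'(1) by simp
    have sub0: "c1 (j, n - 1) = 0" for j
    proof (rule shifted_vanishing_slice[OF c1 e1 e1n])
      have "\<forall>\<^sub>F (x, w) in nhds (0, 0). norm x < \<rho> \<and> norm (w + r x) < \<rho>"
      proof -
        have "analytic2 (\<lambda>y. snd y + r (fst y))" using r by (intro analytic_intros)
        from tendstoD[OF analytic2_tendsto[OF this] H(2)] tendstoD[OF analytic2_tendsto[OF analytic2_fst] H(2)]
        show ?thesis by eventually_elim (auto simp: r(2) dist_norm)
      qed
      then show "\<forall>\<^sub>F (x, w) in nhds (0, 0). g (x, x ^ k * w) = x ^ N * (case (x, w) of (x, z) \<Rightarrow> H (x, z + r x))"
      proof (rule eventually_mono, clarsimp)
        fix x w assume "\<bar>x\<bar> < \<rho>" "\<bar>w + r x\<bar> < \<rho>"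
        with Heq[of x "w + r x"] show "g (x, x ^ k * w) = x ^ N * H (x, w + r x)"
          by (simp add: g_def \<psi>0_def algebra_simps)
      qed
    qed
    have "n' < n"
    proof (cases "degree (edge_poly c1 1 k' N') = n")
      case True
      have "coeff (edge_poly c1 1 k' N') (n - 1) = 0"
        using coeff_edge_poly[OF zero_less_one k'(1)] sub0 by metis
      from order_less_degree[OF True n0 this] p'(2) show ?thesis by (simp add: n'_def)
    next
      case False
      then show ?thesis using degree order_degree[OF p'(1), of b'] by (simp add: n'_def)
    qed
    from less.IH[OF this c1 D1 k'(1) sup' N' p' n'_def ord'[folded n'_def] Nd']
    obtain \<psi>1 c2 d2 v1 v2 where 2: "analytic1 \<psi>1" "\<psi>1 0 = 0" "has_dps (\<lambda>(x, z). g (x, z + \<psi>1 x)) c2" "c2 \<noteq> (\<lambda>_. 0)"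
      "is_distance c2 d2" "edge_conditions c2 d2" "0 \<le> v1" "v1 < v2" "supports c2 v1 v2 ((v1 + v2) * d2)"
      by blast
    define \<psi> where "\<psi> x = \<psi>1 x + \<psi>0 x" for x
    have "(\<lambda>(x, z). g (x, z + \<psi>1 x)) = (\<lambda>(x, z). f (x, z + \<psi> x))"
      by (auto simp: g_def \<psi>_def add.assoc)
    then have 3: "has_dps (\<lambda>(x, z). f (x, z + \<psi> x)) c2" using 2(3) by simp
    have 4: "analytic1 \<psi>" "\<psi> 0 = 0" unfolding \<psi>_def using \<psi>0 2(1,2) by (auto intro!: analytic_intros)
    show ?thesis
      by (intro exI[of _ \<psi>] exI[of _ c2] exI[of _ d2] exI[of _ v1] exI[of _ v2] conjI) (fact 2 3 4)+
  qed
qed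

section \<open>Roots and leading partial sums\<close>

text \<open>Roots are complex, but the Weierstrass form of \<open>f\<close> lives at real points. The series with the same
  coefficients extend it; identities between such extensions follow from those at real points.\<close>

definition complex_coeffs :: "(nat \<times> nat \<Rightarrow> real) \<Rightarrow> nat \<times> nat \<Rightarrow> complex" where
  "complex_coeffs c n = of_real (c n)"

lemma complexify2:
  fixes f :: "real \<times> real \<Rightarrow> real"
  assumes "has_dps f c"
  obtains F r where "has_dps F (complex_coeffs c)" "0 < r"
    "\<And>s t. \<bar>s\<bar> < r \<Longrightarrow> \<bar>t\<bar> < r \<Longrightarrow> F (of_real s, of_real t) = of_real (f (s, t))"
proof -
  obtain r B where r: "0 < r" "dps_norm_le r c B"
      "\<And>x z. norm x \<le> r \<Longrightarrow> norm z \<le> r \<Longrightarrow> f (x, z) = dps_eval c x z"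
    by (rule has_dpsE[OF assms(1)]) (rule that)
  have n: "dps_norm_le r (complex_coeffs c) B"
    using r(2) by (simp add: dps_norm_le_def complex_coeffs_def)
  define F where "F = (\<lambda>(x, z). dps_eval (complex_coeffs c) x z)"
  show ?thesis
  proof (rule that[of F r])
    show "has_dps F (complex_coeffs c)" by (rule has_dpsI[OF n r(1)]) (simp add: F_def)
    fix s t :: real assume st: "\<bar>s\<bar> < r" "\<bar>t\<bar> < r"
    have "((\<lambda>(j, k). c (j, k) * s ^ j * t ^ k) has_sum f (s, t)) UNIV"
      using dps_eval_has_sum[OF r(2), of s t] r(3)[of s t] st by simp
    from has_sum_of_real[OF this, where ?'a = complex]
    have "((\<lambda>(j, k). complex_coeffs c (j, k) * of_real s ^ j * of_real t ^ k) has_sum of_real (f (s, t))) UNIV"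
      by (simp add: case_prod_unfold complex_coeffs_def)
    from infsumI[OF this] show "F (of_real s, of_real t) = of_real (f (s, t))" by (simp add: F_def dps_eval_def)
  qed (rule r(1))
qed

lemma complexify1:
  fixes g :: "real \<Rightarrow> real"
  assumes "analytic1 g"
  obtains G r where "analytic1 G" "0 < r" "\<And>s. \<bar>s\<bar> < r \<Longrightarrow> G (of_real s :: complex) = of_real (g s)"
proof -
  obtain c where c: "has_dps (\<lambda>y. g (fst y)) c" using analytic2_fst'[OF assms] by (auto simp: analytic2_def)
  obtain F r where F: "has_dps F (complex_coeffs c)" "0 < r"
    "\<And>s t. \<bar>s\<bar> < r \<Longrightarrow> \<bar>t\<bar> < r \<Longrightarrow> F (of_real s, of_real t) = of_real (g (fst (s, t)))"
    by (rule complexify2[OF c]) (rule that)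
  show ?thesis
  proof (rule that[of "\<lambda>x. F (x, 0)" r])
    show "analytic1 (\<lambda>x. F (x, 0))" by (rule analytic1_slice) (use F in \<open>auto simp: analytic2_def\<close>)
    show "F (of_real s, 0) = of_real (g s)" if "\<bar>s\<bar> < r" for s
      using F(3)[OF that, of 0] F(2) by simp
  qed (rule F(2))
qed

lemma analytic2_identity:
  fixes f g :: "complex \<times> complex \<Rightarrow> complex"
  assumes "analytic2 f" "analytic2 g" "0 < r"
    and "\<And>s t. 0 < s \<Longrightarrow> s < r \<Longrightarrow> 0 < t \<Longrightarrow> t < r \<Longrightarrow> f (of_real s, of_real t) = g (of_real s, of_real t)"
  shows "\<forall>\<^sub>F y in nhds (0, 0). f y = g y"
proof -
  obtain a b where a: "has_dps f a" and b: "has_dps g b" using assms by (auto simp: analytic2_def)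
  have ab: "a = b" by (rule has_dps_unique_reals[OF a b assms(3,4)])
  obtain s1 where s1: "0 < s1" "\<And>x z. norm x \<le> s1 \<Longrightarrow> norm z \<le> s1 \<Longrightarrow> f (x, z) = dps_eval a x z"
    by (rule has_dpsE[OF a]) (rule that)
  obtain s2 where s2: "0 < s2" "\<And>x z. norm x \<le> s2 \<Longrightarrow> norm z \<le> s2 \<Longrightarrow> g (x, z) = dps_eval b x z"
    by (rule has_dpsE[OF b]) (rule that)
  show ?thesis
    unfolding eventually_nhds_00 using s1 s2 ab by (intro exI[of _ "min s1 s2"]) auto
qed

text \<open>Preparation is applied after division by the largest monomial that divides \<open>f\<close>. The last coefficient \<open>g_m\<close> does
  not vanish identically because \<open>x2\<close> does not divide the quotient.\<close>

lemma weierstrass_form_exists: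
  fixes f :: "real \<times> real \<Rightarrow> real"
  assumes f: "has_dps f c" and c0: "c \<noteq> (\<lambda>_. 0)"
  obtains U \<nu>1 \<nu>2 m g where "weierstrass_form f U \<nu>1 \<nu>2 m g"
proof -
  obtain \<nu>1 where n1: "\<And>j k. c (j, k) \<noteq> 0 \<Longrightarrow> \<nu>1 \<le> 1 * j + 0 * k" "\<exists>j k. c (j, k) \<noteq> 0 \<and> 1 * j + 0 * k = \<nu>1"
    by (rule minimal_weight[OF c0, of 1 0]) (rule that, assumption+)
  obtain \<nu>2 where n2: "\<And>j k. c (j, k) \<noteq> 0 \<Longrightarrow> \<nu>2 \<le> 0 * j + 1 * k" "\<exists>j k. c (j, k) \<noteq> 0 \<and> 0 * j + 1 * k = \<nu>2"
    by (rule minimal_weight[OF c0, of 0 1]) (rule that, assumption+)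
  have nn: "\<nu>1 \<le> j \<and> \<nu>2 \<le> k" if "c (j, k) \<noteq> 0" for j k using n1(1)[OF that] n2(1)[OF that] by simp
  define c' where "c' = (\<lambda>(j, k). c (j + \<nu>1, k + \<nu>2))"
  obtain F where F: "has_dps F c'"
    and Feq: "\<forall>\<^sub>F (x, z) in nhds (0, 0). f (x, z) = x ^ \<nu>1 * z ^ \<nu>2 * F (x, z)"
    by (rule dps_divide_monomial[OF f nn, folded c'_def]) (assumption, rule that)
  obtain k1 where "c (\<nu>1, k1) \<noteq> 0" using n1(2) by auto
  then have "c' (0, k1 - \<nu>2) \<noteq> 0" using nn[of \<nu>1 k1] by (simp add: c'_def)
  define m where "m = (LEAST k. c' (0, k) \<noteq> 0)"
  have m: "c' (0, m) \<noteq> 0" unfolding m_def by (rule LeastI) fact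
  have mk: "c' (0, k) = 0" if "k < m" for k using not_less_Least[of k] that unfolding m_def by blast
  obtain U g where U: "analytic2 U" "U (0, 0) \<noteq> 0" and g: "\<And>k. k < m \<Longrightarrow> analytic1 (g k)" "\<And>k. k < m \<Longrightarrow> g k 0 = 0"
    and ev: "\<forall>\<^sub>F (x, z) in nhds (0, 0). F (x, z) = U (x, z) * (z ^ m + (\<Sum>k<m. g k x * z ^ k))"
    by (rule weierstrass_preparation[OF F mk m]) (assumption, rule that)
  define h where "h j = g (m - j)" for j
  have P: "weierstrass_poly m h x z = z ^ m + (\<Sum>k<m. g k x * z ^ k)" for x z :: real
  proof -
    have "(\<Sum>j=1..m. of_real (h j x) * z ^ (m - j)) = (\<Sum>k<m. g k x * z ^ k)"
      by (rule sum.reindex_bij_witness[of _ "\<lambda>k. m - k" "\<lambda>j. m - j"]) (auto simp: h_def)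
    then show ?thesis by (simp add: weierstrass_poly_def)
  qed
  have "\<not> (\<forall>\<^sub>F x in nhds 0. h m x = 0)" if "1 \<le> m"
  proof
    assume z: "\<forall>\<^sub>F x in nhds 0. h m x = 0"
    have "analytic1 (\<lambda>_. 0 :: real)" by (rule analytic_intros)
    from eventually_analytic1_tendsto[OF this refl ev]
    have "\<forall>\<^sub>F x in nhds 0. F (x, 0) = U (x, 0) * (0 ^ m + (\<Sum>k<m. g k x * 0 ^ k))" .
    with z have "\<forall>\<^sub>F x in nhds 0. F (x, 0) = 0"
    proof eventually_elim
      case (elim x)
      have "(\<Sum>k<m. g k x * 0 ^ k) = (\<Sum>k<m. if k = 0 then h m x else 0)"
        by (rule sum.cong) (auto simp: h_def zero_power)
      then show ?case using elim that by (simp add: zero_power)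
    qed
    from fps_expansion_unique_eventually[OF has_fps_expansion_slice(2)[OF F] has_fps_expansion_0 this]
    have sl: "dps_slice c' 0 = 0" .
    obtain j2 where "c (j2, \<nu>2) \<noteq> 0" using n2(2) by auto
    then have "c' (j2 - \<nu>1, 0) \<noteq> 0" using nn[of j2 \<nu>2] by (simp add: c'_def)
    moreover have "c' (j2 - \<nu>1, 0) = fps_nth (dps_slice c' 0) (j2 - \<nu>1)" by (simp add: dps_slice_def)
    ultimately show False by (simp add: sl)
  qed
  moreover have "\<forall>\<^sub>F (x1, x2) in nhds (0, 0).
        f (x1, x2) = U (x1, x2) * x1 ^ \<nu>1 * x2 ^ \<nu>2 * weierstrass_poly m h x1 x2"
    using Feq ev by eventually_elim (auto simp: P)
  ultimately have "weierstrass_form f U \<nu>1 \<nu>2 m h"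
    unfolding weierstrass_form_def real_analytic2_iff real_analytic1_iff using U g by (auto simp: h_def)
  then show ?thesis by (rule that)
qed

lemma has_fps_expansion_at_0: "f has_fps_expansion A \<Longrightarrow> fps_nth A 0 = f 0"
  unfolding has_fps_expansion_def
  by (drule conjunct2, drule eventually_nhds_x_imp_x) (simp add: eval_fps_at_0)

text \<open>A non-zero series is a power of \<open>t\<close> times a unit.\<close>

lemma analytic1_eventually_nonzero:
  fixes \<rho> :: "'a::{real_normed_field,banach} \<Rightarrow> 'a"
  assumes "\<rho> has_fps_expansion A" "A \<noteq> 0"
  shows "\<forall>\<^sub>F t in nhds 0. t \<noteq> 0 \<longrightarrow> \<rho> t \<noteq> 0"
proof -
  define n where "n = subdegree A"
  define u where "u = eval_fps (fps_shift n A)"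
  have u: "u has_fps_expansion fps_shift n A"
    unfolding u_def using assms(1) by (intro eval_fps_has_fps_expansion) (auto simp: has_fps_expansion_def)
  have u0: "u 0 \<noteq> 0" using assms(2) by (simp add: u_def eval_fps_at_0 n_def)
  have "(\<lambda>t. t ^ n * u t) has_fps_expansion fps_X ^ n * fps_shift n A"
    by (intro fps_expansion_intros u)
  moreover have "fps_X ^ n * fps_shift n A = A"
    by (rule fps_ext) (auto simp: fps_X_power_mult_nth n_def)
  ultimately have "\<forall>\<^sub>F t in nhds 0. eval_fps A t = t ^ n * u t" by (simp add: has_fps_expansion_def)
  moreover have "\<forall>\<^sub>F t in nhds 0. eval_fps A t = \<rho> t" using assms(1) by (simp add: has_fps_expansion_def)
  moreover have "\<forall>\<^sub>F t in nhds 0. u t \<noteq> 0"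
  proof -
    have "analytic1 u" using u by (auto simp: analytic1_def)
    from tendsto_imp_eventually_ne[OF analytic1_tendsto[OF this], of 0] u0 show ?thesis by simp
  qed
  ultimately show ?thesis by eventually_elim auto
qed

lemma filterlim_root:
  assumes "0 < p"
  shows "filterlim (\<lambda>x. of_real (root p x) :: complex) (nhds 0) (at_right 0)"
proof -
  have "((\<lambda>x. of_real (root p x) :: complex) \<longlongrightarrow> of_real (root p 0)) (at_right 0)"
    by (intro tendsto_intros)
  then show ?thesis by simp
qed

lemma eventually_root:
  assumes "0 < p" "\<forall>\<^sub>F t in nhds (0 :: complex). t \<noteq> 0 \<longrightarrow> P t"
  shows "\<forall>\<^sub>F x in at_right 0. P (of_real (root p x))"
proof -
  have "\<forall>\<^sub>F x in at_right (0::real). 0 < x" by (simp add: eventually_at_right_less)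
  with eventually_compose_filterlim[OF assms(2) filterlim_root[OF assms(1)]] show ?thesis
    by eventually_elim (use assms(1) in auto)
qed

text \<open>If \<open>\<rho>\<close> is not identically \<open>0\<close>, it has no zeros at small \<open>t \<noteq> 0\<close>, and the factor \<open>\<rho>^\<nu>2\<close> cancels.
  If it is, it is the trivial root, or there is no such factor.\<close>

lemma puiseux_rootI:
  assumes W: "weierstrass_form f U \<nu>1 \<nu>2 m g" and p: "0 < p"
    and \<rho>: "\<rho> has_fps_expansion A" "\<rho> 0 = 0"
    and root: "\<forall>\<^sub>F x in at_right 0. \<rho> (of_real (root p x)) ^ \<nu>2 * weierstrass_poly m g x (\<rho> (of_real (root p x))) = 0"
  shows "puiseux_root f p A" "\<forall>\<^sub>F x in at_right 0. puiseux_eval p A x = \<rho> (of_real (root p x))"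
proof -
  have "\<forall>\<^sub>F t in nhds 0. eval_fps A t = \<rho> t" and R: "fps_conv_radius A > 0"
    using \<rho>(1) by (auto simp: has_fps_expansion_def)
  from eventually_compose_filterlim[OF this(1) filterlim_root[OF p]]
  show ev: "\<forall>\<^sub>F x in at_right 0. puiseux_eval p A x = \<rho> (of_real (root p x))"
    by (simp add: puiseux_eval_def)
  have A0: "fps_nth A 0 = 0" using has_fps_expansion_at_0[OF \<rho>(1)] \<rho>(2) by simp
  have "(\<forall>\<^sub>F x in at_right 0. weierstrass_poly m g x (puiseux_eval p A x) = 0) \<or> \<nu>2 \<ge> 1 \<and> A = 0"
  proof (cases "A = 0 \<and> 1 \<le> \<nu>2")
    case False
    have "\<forall>\<^sub>F x in at_right 0. weierstrass_poly m g x (\<rho> (of_real (root p x))) = 0"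
    proof (cases "\<nu>2 = 0")
      case True
      then show ?thesis using root by simp
    next
      case \<nu>: False
      then have "A \<noteq> 0" using False by auto
      from eventually_root[OF p analytic1_eventually_nonzero[OF \<rho>(1) this]] root
      show ?thesis by eventually_elim auto
    qed
    with ev have "\<forall>\<^sub>F x in at_right 0. weierstrass_poly m g x (puiseux_eval p A x) = 0"
      by eventually_elim simp
    then show ?thesis ..
  qed simp
  then show "puiseux_root f p A" unfolding puiseux_root_def using p R A0 W by blast
qed

lemma weierstrass_poly_of_real:
  "weierstrass_poly m g x (of_real z :: complex) = of_real (weierstrass_poly m g x z)"
  by (simp add: weierstrass_poly_def)

lemma exact_root:
  fixes f :: "real \<times> real \<Rightarrow> real"
  assumes f: "has_dps f c" and c0: "c \<noteq> (\<lambda>_. 0)" and \<psi>: "analytic1 \<psi>" "\<psi> 0 = 0"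
    and z: "\<forall>\<^sub>F x in nhds 0. f (x, \<psi> x) = 0"
  shows "root_or_leading_partial_sum f \<psi>"
proof -
  obtain U \<nu>1 \<nu>2 m g where W: "weierstrass_form f U \<nu>1 \<nu>2 m g"
    by (rule weierstrass_form_exists[OF f c0])
  then have U: "analytic2 U" "U (0, 0) \<noteq> 0"
    and ev: "\<forall>\<^sub>F (x, z) in nhds (0, 0). f (x, z) = U (x, z) * x ^ \<nu>1 * z ^ \<nu>2 * weierstrass_poly m g x z"
    by (auto simp: weierstrass_form_def real_analytic2_iff)
  obtain G r where G: "analytic1 G" "0 < r" "\<And>s. \<bar>s\<bar> < r \<Longrightarrow> G (of_real s :: complex) = of_real (\<psi> s)"
    by (rule complexify1[OF \<psi>(1)]) (rule that)
  have G0: "G 0 = 0" using G(3)[of 0] G(2) \<psi>(2) by simp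
  obtain A where A: "G has_fps_expansion A" using G(1) by (auto simp: analytic1_def)
  have Unz: "\<forall>\<^sub>F (x, z) in nhds (0, 0). U (x, z) \<noteq> 0"
    using analytic2_eventually_nonzero[OF U] by (simp add: case_prod_unfold)
  have "\<forall>\<^sub>F x in nhds 0. f (x, \<psi> x) = 0 \<and> U (x, \<psi> x) \<noteq> 0 \<and>
      f (x, \<psi> x) = U (x, \<psi> x) * x ^ \<nu>1 * \<psi> x ^ \<nu>2 * weierstrass_poly m g x (\<psi> x)"
    by (intro eventually_conj z eventually_analytic1_tendsto[OF \<psi> Unz] eventually_analytic1_tendsto[OF \<psi> ev])
  then have "\<forall>\<^sub>F x in at_right 0. f (x, \<psi> x) = 0 \<and> U (x, \<psi> x) \<noteq> 0 \<and>
      f (x, \<psi> x) = U (x, \<psi> x) * x ^ \<nu>1 * \<psi> x ^ \<nu>2 * weierstrass_poly m g x (\<psi> x)"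
    by (rule filter_leD[OF at_within_le_nhds])
  moreover have pos: "\<forall>\<^sub>F x in at_right (0::real). 0 < x" by (simp add: eventually_at_right_less)
  moreover have small: "\<forall>\<^sub>F x in at_right (0::real). \<bar>x\<bar> < r"
    using G(2) by (auto simp: eventually_at_right_field intro!: exI[of _ r])
  ultimately have "\<forall>\<^sub>F x in at_right 0. G (of_real (root 1 x)) ^ \<nu>2 * weierstrass_poly m g x (G (of_real (root 1 x))) = 0"
  proof eventually_elim
    case (elim x)
    then have "\<psi> x ^ \<nu>2 * weierstrass_poly m g x (\<psi> x) = 0" by auto
    moreover have "G (of_real (root 1 x)) = of_real (\<psi> x)" using G(3)[of x] elim by simp
    ultimately show ?case
      by (simp add: weierstrass_poly_of_real del: mult_eq_0_iff power_eq_0_iff flip: of_real_power of_real_mult)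
  qed
  from puiseux_rootI[OF W zero_less_one A G0 this]
  have *: "puiseux_root f 1 A" "\<forall>\<^sub>F x in at_right 0. puiseux_eval 1 A x = G (of_real (root 1 x))" by auto
  from *(2) small have "\<forall>\<^sub>F x in at_right 0. of_real (\<psi> x) = puiseux_eval 1 A x"
    by eventually_elim (use G(3) in simp)
  with *(1) show ?thesis unfolding root_or_leading_partial_sum_def by blast
qed

text \<open>The blow-up \<open>H\<close> along the polynomial has a Puiseux root \<open>w = B(t)\<close>, \<open>s = t^p\<close>, that vanishes at \<open>0\<close>.
  Undoing the blow-up gives a root of \<open>f\<close> that differs from the polynomial in \<open>t^p\<close> by terms of
  order greater than \<open>p K\<close>, so cutting it off there recovers the polynomial. The identity between
  \<open>s^N H\<close> and the Weierstrass form is transferred from real to complex arguments.\<close>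

lemma root_from_blow_up:
  fixes f H :: "real \<times> real \<Rightarrow> real" and a :: "nat \<Rightarrow> real"
  assumes f: "has_dps f c" and c0: "c \<noteq> (\<lambda>_. 0)" and a0: "a 0 = 0"
    and H: "has_dps H D" "D (0, 0) = 0" "D (0, n) \<noteq> 0"
    and eq: "\<forall>\<^sub>F (s, w) in nhds (0, 0). f (s, (\<Sum>i\<le>K. a i * s ^ i) + s ^ K * w) = s ^ N * H (s, w)"
  shows "root_or_leading_partial_sum f (\<lambda>x. \<Sum>i\<le>K. a i * x ^ i)"
proof -
  obtain U \<nu>1 \<nu>2 m g where W: "weierstrass_form f U \<nu>1 \<nu>2 m g"
    by (rule weierstrass_form_exists[OF f c0])
  then have U: "analytic2 U" "U (0, 0) \<noteq> 0" and g: "\<And>j. j \<in> {1..m} \<Longrightarrow> analytic1 (g j)"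
    and ev: "\<forall>\<^sub>F (x, z) in nhds (0, 0). f (x, z) = U (x, z) * x ^ \<nu>1 * z ^ \<nu>2 * weierstrass_poly m g x z"
    by (auto simp: weierstrass_form_def real_analytic2_iff real_analytic1_iff)
  obtain HC rH where HC: "has_dps HC (complex_coeffs D)" "0 < rH"
    "\<And>s t. \<bar>s\<bar> < rH \<Longrightarrow> \<bar>t\<bar> < rH \<Longrightarrow> HC (of_real s, of_real t) = of_real (H (s, t))"
    by (rule complexify2[OF H(1)]) (rule that)
  obtain cU where cU: "has_dps U cU" using U by (auto simp: analytic2_def)
  obtain UC rU where UC: "has_dps UC (complex_coeffs cU)" "0 < rU"
    "\<And>s t. \<bar>s\<bar> < rU \<Longrightarrow> \<bar>t\<bar> < rU \<Longrightarrow> UC (of_real s, of_real t) = of_real (U (s, t))"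
    by (rule complexify2[OF cU]) (rule that)
  have "\<exists>G r. analytic1 G \<and> 0 < r \<and> (\<forall>s. \<bar>s\<bar> < r \<longrightarrow> G (of_real s :: complex) = of_real (g j s))" if "j \<in> {1..m}" for j
    using complexify1[OF g[OF that]] by metis
  then obtain gC rg where gC: "\<And>j. j \<in> {1..m} \<Longrightarrow> analytic1 (gC j)" "\<And>j. j \<in> {1..m} \<Longrightarrow> 0 < rg j"
    "\<And>j s. j \<in> {1..m} \<Longrightarrow> \<bar>s\<bar> < rg j \<Longrightarrow> gC j (of_real s :: complex) = of_real (g j s)"
    by metis
  have "\<exists>rP>0. \<forall>j\<in>{1..m}. rP \<le> rg j"
  proof (cases "m = 0")
    case False
    then show ?thesis using gC(2) by (intro exI[of _ "Min (rg ` {1..m})"]) auto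
  qed (auto intro: exI[of _ 1])
  then obtain rP where rP: "0 < rP" "\<And>j. j \<in> {1..m} \<Longrightarrow> rP \<le> rg j" by blast
  define PC where "PC x z = z ^ m + (\<Sum>j=1..m. gC j x * z ^ (m - j))" for x z :: complex
  have PCr: "PC (of_real s) z = weierstrass_poly m g s z" if "\<bar>s\<bar> < rP" for s z
  proof -
    have "gC j (of_real s) = of_real (g j s)" if j: "j \<in> {1..m}" for j
      by (rule gC(3)[OF j]) (use rP(2)[OF j] \<open>\<bar>s\<bar> < rP\<close> in simp)
    then show ?thesis unfolding PC_def weierstrass_poly_def by simp
  qed
  define \<psi>C :: "complex \<Rightarrow> complex" where "\<psi>C x = (\<Sum>i\<le>K. of_real (a i) * x ^ i)" for x
  define \<zeta> where "\<zeta> y = \<psi>C (fst y) + fst y ^ K * snd y" for y :: "complex \<times> complex"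
  have \<psi>C0: "\<psi>C 0 = 0"
  proof -
    have "of_real (a i) * 0 ^ i = (0 :: complex)" for i by (cases i) (auto simp: a0)
    then show ?thesis by (simp add: \<psi>C_def a0)
  qed
  have a\<psi>: "analytic2 (\<lambda>y. \<psi>C (fst y))" unfolding \<psi>C_def
    by (intro analytic2_sum analytic2_mult analytic2_const analytic2_power analytic2_fst)
  have a\<zeta>: "analytic2 \<zeta>" "\<zeta> (0, 0) = 0"
    unfolding \<zeta>_def by (intro analytic2_add a\<psi> analytic2_mult analytic2_power analytic2_fst analytic2_snd) (simp add: \<psi>C0)
  have aU: "analytic2 (\<lambda>y. UC (fst y, \<zeta> y))"
    by (rule analytic2_compose[OF _ analytic2_fst a\<zeta>(1)]) (use UC(1) a\<zeta>(2) in \<open>auto simp: analytic2_def\<close>)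
  have aP: "analytic2 (\<lambda>y. PC (fst y) (\<zeta> y))"
    unfolding PC_def
    by (intro analytic2_add analytic2_sum analytic2_mult analytic2_power a\<zeta>(1) analytic2_fst' gC(1))
  define L where "L y = fst y ^ N * HC (fst y, snd y)" for y
  define R where "R y = UC (fst y, \<zeta> y) * fst y ^ \<nu>1 * \<zeta> y ^ \<nu>2 * PC (fst y) (\<zeta> y)" for y
  have aL: "analytic2 L" unfolding L_def prod.collapse
    using HC(1) by (intro analytic2_mult analytic2_power analytic2_fst) (auto simp: analytic2_def)
  have aR: "analytic2 R" unfolding R_def
    by (intro analytic2_mult analytic2_power aU aP a\<zeta>(1) analytic2_fst)
  define \<psi> where "\<psi> x = (\<Sum>i\<le>K. a i * x ^ i)" for x
  define \<zeta>r where "\<zeta>r y = \<psi> (fst y) + fst y ^ K * snd y" for y :: "real \<times> real"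
  have a\<zeta>r: "analytic2 \<zeta>r" "\<zeta>r (0, 0) = 0"
  proof -
    show "analytic2 \<zeta>r" unfolding \<zeta>r_def \<psi>_def
      by (intro analytic2_add analytic2_sum analytic2_const analytic2_mult analytic2_power analytic2_fst analytic2_snd)
    have "a i * 0 ^ i = 0" for i by (cases i) (auto simp: a0)
    then have "\<psi> 0 = 0" by (simp add: \<psi>_def a0)
    then have "\<zeta>r (0, 0) = 0 ^ K * 0" by (simp add: \<zeta>r_def)
    then show "\<zeta>r (0, 0) = 0" by simp
  qed
  have \<zeta>of: "\<zeta> (of_real s, of_real t) = of_real (\<zeta>r (s, t))" for s t
    by (simp add: \<zeta>_def \<zeta>r_def \<psi>C_def \<psi>_def)
  have small: "\<forall>\<^sub>F (x, z) in nhds (0, 0). \<bar>x :: real\<bar> < min rU rP \<and> \<bar>z :: real\<bar> < rU \<and>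
      f (x, z) = U (x, z) * x ^ \<nu>1 * z ^ \<nu>2 * weierstrass_poly m g x z"
  proof -
    have "\<forall>\<^sub>F (x, z) in nhds (0, 0). \<bar>x :: real\<bar> < min rU rP \<and> \<bar>z :: real\<bar> < rU"
      unfolding eventually_nhds_00 using UC(2) rP(1) by (intro exI[of _ "min rU rP"]) auto
    with ev show ?thesis by eventually_elim auto
  qed
  have "\<forall>\<^sub>F y in nhds (0, 0). \<bar>fst y\<bar> < min rU rP \<and> \<bar>\<zeta>r y\<bar> < rU \<and>
      f (fst y, \<zeta>r y) = U (fst y, \<zeta>r y) * fst y ^ \<nu>1 * \<zeta>r y ^ \<nu>2 * weierstrass_poly m g (fst y) (\<zeta>r y)"
    by (rule eventually_analytic2_pair[OF analytic2_fst a\<zeta>r(1) _ a\<zeta>r(2) small]) simp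
  moreover have "\<forall>\<^sub>F y in nhds (0, 0). \<bar>fst y\<bar> < rH \<and> \<bar>snd y\<bar> < rH"
    unfolding eventually_nhds_00 using HC(2) by (intro exI[of _ rH]) auto
  ultimately have "\<forall>\<^sub>F y in nhds (0, 0). L (of_real (fst y), of_real (snd y)) = R (of_real (fst y), of_real (snd y))"
    using eq
  proof eventually_elim
    case (elim y)
    obtain s t where y: "y = (s, t)" by force
    have "R (of_real s, of_real t) = of_real (U (s, \<zeta>r y) * s ^ \<nu>1 * \<zeta>r y ^ \<nu>2 * weierstrass_poly m g s (\<zeta>r y))"
      using elim UC(3)[of s "\<zeta>r y"] by (simp add: R_def y \<zeta>of PCr weierstrass_poly_of_real)
    also have "\<dots> = of_real (f (s, \<zeta>r y))" using elim by (simp add: y)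
    also have "f (s, \<zeta>r y) = s ^ N * H (s, t)" using elim by (simp add: y \<zeta>r_def \<psi>_def)
    also have "of_real (s ^ N * H (s, t)) = L (of_real s, of_real t)"
      using elim HC(3)[of s t] by (simp add: L_def y)
    finally show ?case by (simp add: y)
  qed
  then obtain r where r: "0 < r" "\<And>s t. \<bar>s\<bar> < r \<Longrightarrow> \<bar>t\<bar> < r \<Longrightarrow> L (of_real s, of_real t) = R (of_real s, of_real t)"
    unfolding eventually_nhds_00 by auto
  have LR: "\<forall>\<^sub>F y in nhds (0, 0). L y = R y"
    by (rule analytic2_identity[OF aL aR r(1)]) (use r(2) in auto)
  define n' where "n' = (LEAST k. complex_coeffs D (0, k) \<noteq> 0)"
  have n': "complex_coeffs D (0, n') \<noteq> 0"
    unfolding n'_def by (rule LeastI[of _ n]) (use H in \<open>simp add: complex_coeffs_def\<close>)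
  have n'0: "0 < n'" using n' H(2) by (cases n') (auto simp: complex_coeffs_def)
  have n'l: "complex_coeffs D (0, k) = 0" if "k < n'" for k
    using not_less_Least[of k] that unfolding n'_def by blast
  obtain p B where p: "0 < p" and B: "analytic1 B" "B 0 = 0" and HB: "\<forall>\<^sub>F t in nhds 0. HC (t ^ p, B t) = 0"
    using puiseux_root_exists[OF HC(1) n'0 n'l n'] by blast
  have tp: "analytic1 (\<lambda>t :: complex. t ^ p)" "(0 :: complex) ^ p = 0" using p by (auto intro!: analytic_intros simp: zero_power)
  define \<rho> where "\<rho> t = \<psi>C (t ^ p) + (t ^ p) ^ K * B t" for t
  have \<rho>: "\<rho> t = \<zeta> (t ^ p, B t)" for t by (simp add: \<rho>_def \<zeta>_def)
  have \<rho>analytic_intros: "analytic1 \<rho>" "\<rho> 0 = 0"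
    unfolding \<rho> using analytic1_compose2[OF a\<zeta>(1) tp(1) B(1) tp(2) B(2)] a\<zeta>(2) p B(2) by (auto simp: zero_power)
  obtain A where A: "\<rho> has_fps_expansion A" using \<rho>analytic_intros(1) by (auto simp: analytic1_def)
  have "UC (0, 0) \<noteq> 0" using UC(3)[of 0 0] UC(2) U(2) by simp
  then have Unz: "\<forall>\<^sub>F y in nhds (0, 0). UC (fst y, \<zeta> y) \<noteq> 0"
    using analytic2_eventually_nonzero[OF aU] a\<zeta>(2) by simp
  have "((\<lambda>t. (t ^ p, B t)) \<longlongrightarrow> (0, 0)) (nhds 0)"
    using tendsto_Pair[OF analytic1_tendsto[OF tp(1)] analytic1_tendsto[OF B(1)]] tp(2) B(2) by simp
  from eventually_compose_filterlim[OF eventually_conj[OF LR Unz] this] HB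
  have "\<forall>\<^sub>F t in nhds 0. t \<noteq> 0 \<longrightarrow> \<rho> t ^ \<nu>2 * PC (t ^ p) (\<rho> t) = 0"
  proof eventually_elim
    case (elim t)
    then have "R (t ^ p, B t) = 0" by (simp add: L_def)
    then show ?case using elim by (auto simp: R_def \<rho>)
  qed
  from eventually_root[OF p this]
  have ev1: "\<forall>\<^sub>F x in at_right 0. \<rho> (of_real (root p x)) ^ \<nu>2 * PC (of_real (root p x) ^ p) (\<rho> (of_real (root p x))) = 0" .
  have pos: "\<forall>\<^sub>F x in at_right (0::real). 0 < x \<and> x < rP"
    using rP(1) by (auto simp: eventually_at_right_field intro!: exI[of _ rP])
  have rootp: "(of_real (root p x) :: complex) ^ p = of_real x" if "0 < x" for x
    using that p by (simp flip: of_real_power)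
  from ev1 pos have "\<forall>\<^sub>F x in at_right 0. \<rho> (of_real (root p x)) ^ \<nu>2 * weierstrass_poly m g x (\<rho> (of_real (root p x))) = 0"
    by eventually_elim (simp add: rootp PCr)
  from puiseux_rootI(1)[OF W p A \<rho>analytic_intros(2) this] have root: "puiseux_root f p A" .
  obtain FB where FB: "B has_fps_expansion FB" using B(1) by (auto simp: analytic1_def)
  have FB0: "fps_nth FB 0 = 0" using has_fps_expansion_at_0[OF FB] B(2) by simp
  define Q where "Q = (\<Sum>i\<le>K. monom (of_real (a i) :: complex) (p * i))"
  have Q: "poly Q t = \<psi>C (t ^ p)" for t
    by (simp add: Q_def \<psi>C_def poly_sum poly_monom power_mult)
  have "(\<lambda>t. poly Q t + t ^ (p * K) * B t) has_fps_expansion fps_of_poly Q + fps_X ^ (p * K) * FB"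
    by (intro fps_expansion_intros has_fps_expansion_poly FB)
  moreover have "(\<lambda>t. poly Q t + t ^ (p * K) * B t) = \<rho>" by (simp add: \<rho>_def Q power_mult fun_eq_iff)
  ultimately have AQ: "A = fps_of_poly Q + fps_X ^ (p * K) * FB"
    using fps_expansion_unique_eventually[OF A] by simp
  have "fps_cutoff (Suc (p * K)) A = fps_of_poly Q"
  proof (rule fps_ext)
    fix l
    have "coeff Q l = 0" if "p * K < l"
    proof -
      have "p * i < l" if "i \<le> K" for i using \<open>p * K < l\<close> mult_le_mono2[OF that, of p] by linarith
      then have neq: "p * i \<noteq> l" if "i \<le> K" for i using that by blast
      show ?thesis
        unfolding Q_def coeff_sum
      proof (rule sum.neutral, rule ballI)
        fix i assume "i \<in> {..K}"
        then have "p * i \<noteq> l" using neq by simp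
        then show "coeff (monom (of_real (a i) :: complex) (p * i)) l = 0" by simp
      qed
    qed
    then show "fps_nth (fps_cutoff (Suc (p * K)) A) l = fps_nth (fps_of_poly Q) l"
      using FB0 by (auto simp: AQ fps_X_power_mult_nth not_less)
  qed
  then have "puiseux_eval p (fps_cutoff (Suc (p * K)) A) x = \<psi>C (of_real (root p x) ^ p)" for x
    by (simp add: puiseux_eval_def Q)
  with pos have "\<forall>\<^sub>F x in at_right 0. of_real (\<psi> x) = puiseux_eval p (fps_cutoff (Suc (p * K)) A) x"
    by (auto elim!: eventually_mono simp: rootp \<psi>C_def \<psi>_def)
  with root show ?thesis unfolding root_or_leading_partial_sum_def \<psi>_def by blast
qed

section \<open>The main theorem\<close>

lemma coordinates_after_shift:
  assumes \<phi>: "analytic_coordinates \<phi>" and \<psi>: "analytic1 \<psi>" "\<psi> 0 = 0"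
  shows "analytic_coordinates (\<lambda>y. (fst (\<phi> y), snd (\<phi> y) - \<psi> (fst (\<phi> y))))"
proof -
  obtain \<eta> where a: "analytic2 (\<lambda>y. fst (\<phi> y))" "analytic2 (\<lambda>y. snd (\<phi> y))" and \<phi>0: "\<phi> (0, 0) = (0, 0)"
    and e: "analytic2 (\<lambda>y. fst (\<eta> y))" "analytic2 (\<lambda>y. snd (\<eta> y))"
    and inv: "\<forall>\<^sub>F y in nhds (0, 0). \<eta> (\<phi> y) = y" "\<forall>\<^sub>F x in nhds (0, 0). \<phi> (\<eta> x) = x"
    using \<phi> by (auto simp: analytic_coordinates_def real_analytic_map_def real_analytic2_iff o_def)
  have sh: "analytic2 (\<lambda>y. snd y + \<psi> (fst y))" using \<psi>(1) by (intro analytic_intros)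
  define \<eta>' where "\<eta>' x = \<eta> (fst x, snd x + \<psi> (fst x))" for x
  have "analytic2 (\<lambda>y. \<psi> (fst (fst (\<phi> y), snd (\<phi> y))))"
    by (rule analytic2_compose[OF analytic2_fst'[OF \<psi>(1)] a]) (simp_all add: \<phi>0)
  then have 1: "analytic2 (\<lambda>y. snd (\<phi> y) - \<psi> (fst (\<phi> y)))" using a(2) by (intro analytic2_diff) simp_all
  have 2: "analytic2 (\<lambda>x. fst (\<eta>' x))" "analytic2 (\<lambda>x. snd (\<eta>' x))"
    unfolding \<eta>'_def by (rule analytic2_compose[OF e(1) analytic2_fst sh] analytic2_compose[OF e(2) analytic2_fst sh];
      simp add: \<psi>(2))+
  have 3: "\<forall>\<^sub>F y in nhds (0, 0). \<eta>' (fst (\<phi> y), snd (\<phi> y) - \<psi> (fst (\<phi> y))) = y"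
    using inv(1) by eventually_elim (simp add: \<eta>'_def)
  have "\<forall>\<^sub>F (x, z) in nhds (0, 0). \<phi> (\<eta> (x, z)) = (x, z)" using inv(2) by (simp add: case_prod_unfold)
  from eventually_analytic2_pair[OF analytic2_fst sh _ _ this]
  have "\<forall>\<^sub>F x in nhds (0, 0). \<phi> (\<eta> (fst x, snd x + \<psi> (fst x))) = (fst x, snd x + \<psi> (fst x))"
    by (simp add: \<psi>(2))
  then have 4: "\<forall>\<^sub>F x in nhds (0, 0). (fst (\<phi> (\<eta>' x)), snd (\<phi> (\<eta>' x)) - \<psi> (fst (\<phi> (\<eta>' x)))) = x"
    by eventually_elim (simp add: \<eta>'_def)
  show ?thesis
    unfolding analytic_coordinates_def real_analytic_map_def real_analytic2_iff o_def
    using a(1) 1 2 3 4 by (auto simp: \<phi>0 \<psi>(2) intro!: exI[of _ \<eta>'])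
qed

lemma identity_coordinates: "analytic_coordinates (\<lambda>y. y)"
  unfolding analytic_coordinates_def real_analytic_map_def real_analytic2_iff o_def
  by (auto intro!: analytic_intros exI[of _ "\<lambda>y. y"])

lemma shift_coordinates:
  assumes "analytic1 \<psi>" "\<psi> 0 = 0"
  shows "analytic_coordinates (\<lambda>(y1, y2). (y1, y2 + \<psi> y1))"
  using coordinates_after_shift[OF identity_coordinates, of "\<lambda>x. - \<psi> x"] assms
  by (simp add: case_prod_unfold analytic_intros)

lemma shift_nonzero:
  fixes f :: "real \<times> real \<Rightarrow> real"
  assumes f: "has_dps f c" "c \<noteq> (\<lambda>_. 0)" and \<psi>: "analytic1 \<psi>" "\<psi> 0 = 0"
    and c': "has_dps (\<lambda>(x, z). f (x, z + \<psi> x)) c'"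
  shows "c' \<noteq> (\<lambda>_. 0)"
proof
  assume "c' = (\<lambda>_. 0)"
  then have "\<forall>\<^sub>F (x, z) in nhds (0, 0). f (x, z + \<psi> x) = 0"
    using dps_nonzero_iff[OF c'] by (simp add: case_prod_unfold)
  moreover have "analytic2 (\<lambda>y. snd y - \<psi> (fst y))" using \<psi>(1) by (intro analytic_intros)
  ultimately have "\<forall>\<^sub>F y in nhds (0, 0). f (fst y, snd y - \<psi> (fst y) + \<psi> (fst y)) = 0"
    using eventually_analytic2_pair[OF analytic2_fst, of "\<lambda>y. snd y - \<psi> (fst y)" "\<lambda>x z. f (x, z + \<psi> x) = 0"]
    by (simp add: \<psi>(2))
  then show False using dps_nonzero_iff[OF f(1)] f(2) by simp
qed

text \<open>Coordinates for \<open>f\<close> are coordinates for the shifted function preceded by the inverse shift, so the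
  bound \<open>d\<close> for the latter bounds the height of \<open>f\<close>.\<close>

lemma adapted_shift:
  fixes f :: "real \<times> real \<Rightarrow> real"
  assumes \<psi>: "analytic1 \<psi>" "\<psi> 0 = 0" and c: "has_dps (\<lambda>(x, z). f (x, z + \<psi> x)) c" "c \<noteq> (\<lambda>_. 0)"
    and D: "is_distance c d" and cond: "edge_conditions c d"
    and \<psi>': "analytic1 \<psi>'" "\<psi>' 0 = 0" "d \<le> newton_distance (\<lambda>(x, z). f (x, z + \<psi>' x))"
  shows "adapted_coordinates f (\<lambda>(y1, y2). (y1, y2 + \<psi>' y1))"
proof -
  have ub: "newton_distance (f \<circ> \<phi>) \<le> d" if \<phi>: "analytic_coordinates \<phi>" for \<phi>
  proof -
    have "f \<circ> \<phi> = (\<lambda>(x, z). f (x, z + \<psi> x)) \<circ> (\<lambda>y. (fst (\<phi> y), snd (\<phi> y) - \<psi> (fst (\<phi> y))))"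
      by (simp add: fun_eq_iff)
    with newton_distance_le[OF c(1) D c(2) cond coordinates_after_shift[OF \<phi> \<psi>]] show ?thesis by simp
  qed
  have co: "analytic_coordinates (\<lambda>(y1, y2). (y1, y2 + \<psi>' y1))" by (rule shift_coordinates[OF \<psi>'(1,2)])
  have eq: "f \<circ> (\<lambda>(y1, y2). (y1, y2 + \<psi>' y1)) = (\<lambda>(x, z). f (x, z + \<psi>' x))" by (auto simp: fun_eq_iff)
  have "newton_height f \<le> ereal d"
    unfolding newton_height_def by (rule SUP_least) (use ub in auto)
  also have "\<dots> \<le> ereal (newton_distance (f \<circ> (\<lambda>(y1, y2). (y1, y2 + \<psi>' y1))))"
    using \<psi>'(3) unfolding eq by simp
  finally have "newton_height f \<le> ereal (newton_distance (f \<circ> (\<lambda>(y1, y2). (y1, y2 + \<psi>' y1))))" .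
  moreover have "ereal (newton_distance (f \<circ> (\<lambda>(y1, y2). (y1, y2 + \<psi>' y1)))) \<le> newton_height f"
    unfolding newton_height_def by (rule SUP_upper) (use co in simp)
  ultimately show ?thesis unfolding adapted_coordinates_def using co by simp
qed

text \<open>Both lines contain the segment from \<open>A\<close> to \<open>B\<close>.\<close>

lemma principal_line_parallel:
  fixes f :: "real \<times> real \<Rightarrow> real"
  assumes f: "has_dps f c" and w: "0 \<le> w1" "0 \<le> w2" "0 < w1 + w2"
    and d: "d = newton_distance f" and sup: "supports c w1 w2 ((w1 + w2) * d)"
    and A: "(a1, a2) \<in> newton_set c" "w1 * a1 + w2 * a2 = (w1 + w2) * d"
    and B: "(b1, b2) \<in> newton_set c" "w1 * b1 + w2 * b2 = (w1 + w2) * d"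
    and P: "(d, d) \<in> open_segment (a1, a2) (b1, b2)"
    and \<kappa>: "\<forall>(t1, t2)\<in>principal_face f. \<kappa>1 * t1 + \<kappa>2 * t2 = 1"
  shows "\<kappa>1 * w2 = \<kappa>2 * w1" "(\<kappa>1 + \<kappa>2) * d = 1"
proof -
  have pf: "(a1, a2) \<in> principal_face f" "(b1, b2) \<in> principal_face f" "(d, d) \<in> principal_face f"
    using principal_edge[OF f w d sup A(1) _ B(1) _ P] A B by auto
  then have k: "\<kappa>1 * a1 + \<kappa>2 * a2 = 1" "\<kappa>1 * b1 + \<kappa>2 * b2 = 1" "\<kappa>1 * d + \<kappa>2 * d = 1" using \<kappa> by auto
  then show "(\<kappa>1 + \<kappa>2) * d = 1" by (simp add: algebra_simps)
  define v1 v2 where "v1 = a1 - b1" and "v2 = a2 - b2"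
  have v: "\<kappa>1 * v1 + \<kappa>2 * v2 = 0" "w1 * v1 + w2 * v2 = 0"
    using k A B by (simp_all add: v1_def v2_def algebra_simps)
  have "(\<kappa>1 * w2 - \<kappa>2 * w1) * v1 = w2 * (\<kappa>1 * v1 + \<kappa>2 * v2) - \<kappa>2 * (w1 * v1 + w2 * v2)"
    by (simp add: algebra_simps)
  then have 1: "(\<kappa>1 * w2 - \<kappa>2 * w1) * v1 = 0" by (simp add: v)
  have "(\<kappa>1 * w2 - \<kappa>2 * w1) * v2 = \<kappa>1 * (w1 * v1 + w2 * v2) - w1 * (\<kappa>1 * v1 + \<kappa>2 * v2)"
    by (simp add: algebra_simps)
  then have 2: "(\<kappa>1 * w2 - \<kappa>2 * w1) * v2 = 0" by (simp add: v)
  have "(a1, a2) \<noteq> (b1, b2)" using P by auto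
  then have "v1 \<noteq> 0 \<or> v2 \<noteq> 0" by (auto simp: v1_def v2_def)
  with 1 2 show "\<kappa>1 * w2 = \<kappa>2 * w1" by auto
qed

text \<open>A violation at \<open>(k, 1)\<close> puts points of the supporting edge on both sides of \<open>(d, d)\<close>, by
  \<open>edge_order_le\<close>. Then the principal face lies on this edge, and \<open>\<kappa>1 = k \<kappa>2\<close> contradicts
  \<open>\<kappa>1 \<le> \<kappa>2\<close>.\<close>

lemma swapped_edge_condition:
  fixes f :: "real \<times> real \<Rightarrow> real"
  assumes f: "has_dps f c" and d: "d = newton_distance f" and D: "is_distance c d"
    and \<kappa>: "0 \<le> \<kappa>1" "\<kappa>1 \<le> \<kappa>2" "\<forall>(t1, t2)\<in>principal_face f. \<kappa>1 * t1 + \<kappa>2 * t2 = 1"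
    and k: "2 \<le> k"
  shows "edge_condition (swap_coeffs c) d k"
proof (rule ccontr)
  assume fail: "\<not> edge_condition (swap_coeffs c) d k"
  have k0: "0 < k" using k by simp
  obtain w1 w2 where w: "0 \<le> w1" "0 \<le> w2" "0 < w1 + w2" "supports (swap_coeffs c) w1 w2 ((w1 + w2) * d)"
    by (rule is_distanceE[OF is_distance_swap[OF D]])
  obtain N b where sup: "supports (swap_coeffs c) 1 (real k) ((1 + real k) * d)"
    and p: "edge_poly (swap_coeffs c) 1 k N \<noteq> 0" "b \<noteq> 0" "d < real (order b (edge_poly (swap_coeffs c) 1 k N))"
    and N: "real N = (1 + real k) * d"
    by (rule edge_condition_fails[OF is_distance_swap[OF D] w k0 fail]) (rule that)
  have sup': "supports c (real k) 1 ((real k + 1) * d)" using sup by (simp add: supports_swap add.commute)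
  have "\<not> ((\<forall>j l. swap_coeffs c (j, l) \<noteq> 0 \<longrightarrow> 1 * j + k * l = N \<longrightarrow> real l \<le> d) \<or>
      (\<forall>j l. swap_coeffs c (j, l) \<noteq> 0 \<longrightarrow> 1 * j + k * l = N \<longrightarrow> real j \<le> d))"
    by (rule notI, drule edge_order_le[OF refl p(1) k0 p(2)]) (use p(3) in linarith)
  then obtain j l j' l' where A: "c (l, j) \<noteq> 0" "1 * j + k * l = N" "d < real l"
    and B: "c (l', j') \<noteq> 0" "1 * j' + k * l' = N" "d < real j'"
    by (auto simp: not_le)
  have lA: "real k * real l + 1 * real j = (real k + 1) * d"
    using A(2) N by (metis (no_types, lifting) add.commute mult_1 of_nat_1 of_nat_add of_nat_mult)
  have lB: "real k * real l' + 1 * real j' = (real k + 1) * d"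
    using B(2) N by (metis (no_types, lifting) add.commute mult_1 of_nat_1 of_nat_add of_nat_mult)
  have l'd: "real l' < d"
  proof (rule ccontr)
    assume "\<not> real l' < d"
    then have "real k * d \<le> real k * real l'" by (intro mult_left_mono) auto
    with lB B(3) show False by (simp add: algebra_simps)
  qed
  define t where "t = (real l - d) / (real l - real l')"
  have t: "0 < t" "t < 1" using A(3) l'd by (auto simp: t_def field_simps)
  have tl: "t * (real l - real l') = real l - d" using A(3) l'd by (simp add: t_def)
  have e1: "(1 - t) * real l + t * real l' = d" using tl by (simp add: algebra_simps)
  have e2: "(1 - t) * real j + t * real j' = d"
  proof -
    have ej: "real j = (real k + 1) * d - real k * real l" and ej': "real j' = (real k + 1) * d - real k * real l'"
      using lA lB by simp_all
    have "(1 - t) * real j + t * real j' = (real k + 1) * d - real k * ((1 - t) * real l + t * real l')"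
      unfolding ej ej' by (simp add: algebra_simps)
    then show ?thesis unfolding e1 by (simp add: algebra_simps)
  qed
  have "(d, d) \<in> open_segment (real l, real j) (real l', real j')"
    unfolding in_segment using t e1 e2 A(3) l'd by (auto intro!: exI[of _ t])
  from principal_line_parallel[OF f _ _ _ d sup' newton_set_quadrant[of c l j, OF A(1)] lA
      newton_set_quadrant[of c l' j', OF B(1)] lB this \<kappa>(3)]
  have "\<kappa>1 = \<kappa>2 * real k" and one: "(\<kappa>1 + \<kappa>2) * d = 1" by auto
  moreover have "\<kappa>2 * 2 \<le> \<kappa>2 * real k" using \<kappa> k by (intro mult_left_mono) auto
  ultimately have "\<kappa>2 * 2 \<le> \<kappa>2" using \<kappa>(2) by linarith
  then have "\<kappa>2 = 0" "\<kappa>1 = 0" using \<kappa> by auto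
  with one show False by simp
qed

text \<open>Here \<open>h\<close> is the negative of the tail divided by \<open>x^(K+1)\<close>.\<close>

lemma truncation:
  fixes \<psi> :: "real \<Rightarrow> real"
  assumes "analytic1 \<psi>" "\<psi> 0 = 0"
  obtains a h where "a 0 = 0" "analytic1 h"
    "\<forall>\<^sub>F x in nhds 0. (\<Sum>i\<le>K. a i * x ^ i) = \<psi> x + x ^ Suc K * h x"
proof -
  obtain A where A: "\<psi> has_fps_expansion A" using assms(1) by (auto simp: analytic1_def)
  define a where "a i = fps_nth A i" for i
  define B where "B = fps_shift (Suc K) A"
  define h where "h x = - eval_fps B x" for x
  have B: "eval_fps B has_fps_expansion B"
    using A unfolding B_def by (intro eval_fps_has_fps_expansion) (auto simp: has_fps_expansion_def)
  define Q where "Q = (\<Sum>i\<le>K. monom (a i) i)"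
  have Q: "poly Q x = (\<Sum>i\<le>K. a i * x ^ i)" for x by (simp add: Q_def poly_sum poly_monom)
  have "(\<lambda>x. poly Q x + x ^ Suc K * eval_fps B x) has_fps_expansion fps_of_poly Q + fps_X ^ Suc K * B"
    by (intro fps_expansion_intros has_fps_expansion_poly B)
  moreover have "fps_of_poly Q + fps_X ^ Suc K * B = A"
  proof (rule fps_ext)
    fix n
    have "coeff Q n = (if n \<le> K then a n else 0)"
      by (simp add: Q_def coeff_sum)
    then show "fps_nth (fps_of_poly Q + fps_X ^ Suc K * B) n = fps_nth A n"
      unfolding fps_add_nth fps_X_power_mult_nth by (auto simp: a_def B_def)
  qed
  ultimately have "\<forall>\<^sub>F x in nhds 0. eval_fps A x = poly Q x + x ^ Suc K * eval_fps B x"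
    by (simp add: has_fps_expansion_def)
  moreover have "\<forall>\<^sub>F x in nhds 0. eval_fps A x = \<psi> x" using A by (simp add: has_fps_expansion_def)
  ultimately have ev: "\<forall>\<^sub>F x in nhds 0. (\<Sum>i\<le>K. a i * x ^ i) = \<psi> x + x ^ Suc K * h x"
    by eventually_elim (simp add: h_def Q)
  show ?thesis
  proof (rule that[OF _ _ ev])
    show "a 0 = 0" using has_fps_expansion_at_0[OF A] assms(2) by (simp add: a_def)
    show "analytic1 h" unfolding h_def using B by (intro analytic_intros) (auto simp: analytic1_def)
  qed
qed

theorem theorem4p2:
  fixes f :: "real \<times> real \<Rightarrow> real" and \<kappa>1 \<kappa>2 :: real
  assumes "real_analytic2 f"
    and "\<not> (\<forall>\<^sub>F x in nhds (0, 0). f x = 0)"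
    and "f (0, 0) = 0"
    and "GDERIV f (0, 0) :> (0, 0)"
    and "\<kappa>1 \<ge> 0" and "\<kappa>2 \<ge> 0"
    and "\<forall>(t1, t2)\<in>principal_face f. \<kappa>1 * t1 + \<kappa>2 * t2 = 1"
    and "\<kappa>2 \<ge> \<kappa>1"
  shows "\<exists>\<psi>. real_analytic1 \<psi> \<and> \<psi> 0 = 0 \<and>
           adapted_coordinates f (\<lambda>(y1, y2). (y1, y2 + \<psi> y1)) \<and>
           root_or_leading_partial_sum f \<psi>"
proof -
  obtain c where f: "has_dps f c" using assms(1) by (auto simp: real_analytic2_iff analytic2_def)
  have af: "analytic2 f" using f by (auto simp: analytic2_def)
  have c0: "c \<noteq> (\<lambda>_. 0)" using dps_nonzero_iff[OF f] assms(2) by simp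
  define d where "d = newton_distance f"
  have D: "is_distance c d" unfolding d_def by (rule newton_distance[OF f c0])
  have pos: "0 < d'" if "is_distance c' d'" "c' (0, 0) = 0" for c' d'
  proof -
    have "supports c' 1 1 1"
      unfolding supports_def
    proof (intro allI impI)
      fix j k assume "c' (j, k) \<noteq> 0"
      then have "j + k \<noteq> 0" using that(2) by (cases "j + k = 0") auto
      then have "1 \<le> j + k" by linarith
      then show "1 \<le> 1 * real j + 1 * real k" by linarith
    qed
    from is_distance_le[OF that(1) _ _ this] show ?thesis by simp
  qed
  have c00: "c (0, 0) = 0" using has_dps_at_0[OF f] assms(3) by simp
  have d0: "0 < d" by (rule pos[OF D c00])
  note swapped = swapped_edge_condition[OF f d_def D assms(5,8,7)]
  show ?thesis
  proof (cases "edge_conditions c d")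
    case True
    obtain \<nu>1 where n1: "\<And>j k. c (j, k) \<noteq> 0 \<Longrightarrow> \<nu>1 \<le> 1 * j + 0 * k" "\<exists>j k. c (j, k) \<noteq> 0 \<and> 1 * j + 0 * k = \<nu>1"
      by (rule minimal_weight[OF c0, of 1 0]) (rule that, assumption+)
    have nn: "\<nu>1 \<le> j \<and> 0 \<le> k" if "c (j, k) \<noteq> 0" for j k using n1(1)[OF that] by simp
    define c' where "c' = (\<lambda>(j, k). c (j + \<nu>1, k + 0))"
    obtain F where F: "has_dps F c'"
      and Feq: "\<forall>\<^sub>F (x, z) in nhds (0, 0). f (x, z) = x ^ \<nu>1 * z ^ 0 * F (x, z)"
      by (rule dps_divide_monomial[OF f nn, folded c'_def]) (assumption, rule that)
    obtain n where n: "c' (0, n) \<noteq> 0" using n1(2) by (auto simp: c'_def)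
    \<comment> \<open>Otherwise the polyhedron is a quadrant whose vertical edge is the principal face.\<close>
    have "c (\<nu>1, 0) = 0"
    proof (rule ccontr)
      assume cn: "c (\<nu>1, 0) \<noteq> 0"
      have s: "supports c 1 0 (real \<nu>1)" unfolding supports_def using n1(1) by simp
      have le: "real \<nu>1 \<le> d" using is_distance_le[OF D _ _ s] by simp
      obtain w1 w2 where w: "0 \<le> w1" "0 \<le> w2" "0 < w1 + w2" "supports c w1 w2 ((w1 + w2) * d)"
        by (rule is_distanceE[OF D])
      have "(w1 + w2) * d \<le> w1 * real \<nu>1 + w2 * real 0" using w(4) cn unfolding supports_def by blast
      then have 1: "(w1 + w2) * d \<le> w1 * real \<nu>1" by simp
      also have "\<dots> \<le> w1 * d" using le w(1) by (rule mult_left_mono)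
      finally have "w2 * d \<le> 0" by (simp add: algebra_simps)
      then have "w2 = 0" using w(2) d0 by (simp add: mult_le_0_iff)
      then have d\<nu>: "d = real \<nu>1" using 1 w le by simp
      have sup: "supports c 1 0 ((1 + 0) * d)" using s d\<nu> by simp
      have A: "(real \<nu>1, 0) \<in> newton_set c" and B: "(real \<nu>1, 2 * d) \<in> newton_set c"
        using newton_set_quadrant[of c \<nu>1 0, OF cn] d0 by auto
      have "(d, d) \<in> open_segment (real \<nu>1, 0) (real \<nu>1, 2 * d)"
        unfolding in_segment using d0 by (auto simp: d\<nu> intro!: exI[of _ "1/2"])
      from principal_line_parallel[OF f _ _ _ d_def sup A _ B _ this assms(7)]
      have "\<kappa>2 = 0" "(\<kappa>1 + \<kappa>2) * d = 1" by (auto simp: d\<nu>)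
      with assms(5,8) show False by auto
    qed
    then have F0: "c' (0, 0) = 0" by (simp add: c'_def)
    have id: "(\<lambda>(x, z). f (x, z + (\<lambda>_. 0) x)) = f" by (auto simp: fun_eq_iff)
    have "adapted_coordinates f (\<lambda>(y1, y2). (y1, y2 + (\<lambda>_. 0) y1))"
      by (rule adapted_shift[of "\<lambda>_. 0" f c d "\<lambda>_. 0"])
         (use f c0 D True in \<open>auto simp: d_def id intro!: analytic_intros\<close>)
    moreover have "root_or_leading_partial_sum f (\<lambda>x. \<Sum>i\<le>0. 0 * x ^ i)"
      by (rule root_from_blow_up[OF f c0 refl F F0 n, of 0 \<nu>1])
         (use Feq in \<open>simp add: case_prod_unfold\<close>)
    moreover have "real_analytic1 (\<lambda>_. 0)" unfolding real_analytic1_iff by (rule analytic_intros)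
    ultimately show ?thesis by (intro exI[of _ "\<lambda>_. 0"]) simp
  next
    case False
    then obtain k where k: "0 < k" "\<not> edge_condition c d k"
      using swapped by (auto simp: edge_conditions_def)
    obtain w1 w2 where w: "0 \<le> w1" "0 \<le> w2" "0 < w1 + w2" "supports c w1 w2 ((w1 + w2) * d)"
      by (rule is_distanceE[OF D])
    obtain N b where sup: "supports c 1 (real k) ((1 + real k) * d)"
      and N: "\<And>j l. c (j, l) \<noteq> 0 \<Longrightarrow> N \<le> 1 * j + k * l"
      and p: "edge_poly c 1 k N \<noteq> 0" "b \<noteq> 0" "d < real (order b (edge_poly c 1 k N))"
      and Nd: "real N = (1 + real k) * d"
      by (rule edge_condition_fails[OF D w k]) (rule that)
    have "\<exists>\<psi> c' d' w1 w2. analytic1 \<psi> \<and> \<psi> 0 = 0 \<and> has_dps (\<lambda>(x, z). f (x, z + \<psi> x)) c' \<and> c' \<noteq> (\<lambda>_. 0) \<and>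
        is_distance c' d' \<and> edge_conditions c' d' \<and> 0 \<le> w1 \<and> w1 < w2 \<and> supports c' w1 w2 ((w1 + w2) * d')"
      by (rule adapted_shift_exists[OF f D k(1) sup N p(1,2) refl p(3) Nd]) assumption
    then obtain \<psi> c' d' v1 v2 where \<psi>: "analytic1 \<psi>" "\<psi> 0 = 0"
      and c': "has_dps (\<lambda>(x, z). f (x, z + \<psi> x)) c'" "c' \<noteq> (\<lambda>_. 0)"
      and D': "is_distance c' d'" and cond: "edge_conditions c' d'"
      and v: "0 \<le> v1" "v1 < v2" "supports c' v1 v2 ((v1 + v2) * d')" by (elim exE conjE) (rule that)
    have d'0: "0 < d'" by (rule pos[OF D']) (use has_dps_at_0[OF c'(1)] \<psi>(2) assms(3) in simp)
    note adapt = adapted_shift[OF \<psi> c' D' cond]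
    show ?thesis
    proof (cases "v1 = 0")
      case True
      have "c' (j, 0) = 0" for j
      proof (rule ccontr)
        assume "c' (j, 0) \<noteq> 0"
        then have "(v1 + v2) * d' \<le> v1 * real j + v2 * real 0" using v(3) unfolding supports_def by blast
        then have "v2 * d' \<le> 0" by (simp add: True)
        then show False using v(2) d'0 True by (simp add: mult_le_0_iff)
      qed
      then have "dps_slice c' 0 = 0" by (intro fps_ext) (simp add: dps_slice_def)
      with has_fps_expansion_slice(2)[OF c'(1)] have "\<forall>\<^sub>F x in nhds 0. f (x, \<psi> x) = 0"
        by (auto simp: has_fps_expansion_def elim: eventually_mono)
      from exact_root[OF f c0 \<psi> this] have "root_or_leading_partial_sum f \<psi>" .
      moreover have "adapted_coordinates f (\<lambda>(y1, y2). (y1, y2 + \<psi> y1))"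
        by (rule adapt[OF \<psi>]) (use newton_distance_eqI[OF c' D'] in simp)
      ultimately show ?thesis using \<psi> by (auto simp: real_analytic1_iff)
    next
      case False
      then have v1: "0 < v1" using v(1) by simp
      \<comment> \<open>The largest integer less than the slope of the weight: the terms of \<open>\<psi>\<close> up to order \<open>K\<close> are kept.\<close>
      define K where "K = nat \<lceil>v2 / v1\<rceil> - 1"
      have r1: "1 < v2 / v1" using v(2) v1 by simp
      then have "1 < \<lceil>v2 / v1\<rceil>" by (simp add: less_ceiling_iff)
      then have K: "0 < K" "real (Suc K) = of_int \<lceil>v2 / v1\<rceil>" by (auto simp: K_def)
      have Kv: "real K < v2 / v1" "v2 / v1 \<le> real (Suc K)"
        using K(2) ceiling_correct[of "v2 / v1"] by linarith+
      have Kv': "real K * v1 < v2" "v2 \<le> real (Suc K) * v1"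
        using Kv v1 by (simp_all add: pos_less_divide_eq pos_divide_le_eq)
      obtain a h where a0: "a 0 = 0" and h: "analytic1 h"
        and trunc: "\<forall>\<^sub>F x in nhds 0. (\<Sum>i\<le>K. a i * x ^ i) = \<psi> x + x ^ Suc K * h x"
        by (rule truncation[OF \<psi>, of K]) (rule that)
      define \<psi>' where "\<psi>' x = (\<Sum>i\<le>K. a i * x ^ i)" for x
      have \<psi>': "analytic1 \<psi>'" "\<psi>' 0 = 0"
      proof -
        show "analytic1 \<psi>'" unfolding \<psi>'_def analytic1_iff
          by (intro analytic2_sum analytic2_const analytic2_mult analytic2_power analytic2_fst)
        have "a i * 0 ^ i = 0" for i by (cases i) (auto simp: a0)
        then show "\<psi>' 0 = 0" by (simp add: \<psi>'_def a0)
      qed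
      have "analytic2 (\<lambda>(x, z). f (x, z + \<psi>' x))" by (rule analytic2_shift[OF af \<psi>'])
      then obtain c2 where c2: "has_dps (\<lambda>(x, z). f (x, z + \<psi>' x)) c2" by (auto simp: analytic2_def)
      have c20: "c2 \<noteq> (\<lambda>_. 0)" by (rule shift_nonzero[OF f c0 \<psi>' c2])
      define g where "g = (\<lambda>(x, z). f (x, z + \<psi> x))"
      \<comment> \<open>The discarded tail has order at least \<open>K + 1\<close>. It preserves the order for slopes up to \<open>K + 1\<close>, and
        even the leading form if the slope is smaller.\<close>
      have transfer: "(\<forall>j k. c2 (j, k) \<noteq> 0 \<longrightarrow> M \<le> q * j + u * k) \<and>
          (u < Suc K * q \<longrightarrow> (\<forall>y1 y2. edge_form c2 q u M y1 y2 = edge_form c' q u M y1 y2))"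
        if qu: "0 < q" "0 < u" "u \<le> Suc K * q" and M: "\<And>j k. c' (j, k) \<noteq> 0 \<Longrightarrow> M \<le> q * j + u * k" for q u M
      proof -
        define e where "e = q * Suc K - u"
        have ue: "u + e = q * Suc K" using qu(3) by (simp add: e_def mult.commute)
        define Y2 where "Y2 y1 y2 s = y2 + s ^ e * (y1 ^ Suc K * h (s ^ q * y1))" for y1 y2 s
        define Z2 where "Z2 y1 y2 = y2 + 0 ^ e * (y1 ^ Suc K * h 0)" for y1 y2
        \<comment> \<open>For \<open>e = 0\<close> the power \<open>0 ^ e\<close> is \<open>1\<close>, and the tail contributes to the leading part.\<close>
        have lim: "(Y2 y1 y2 \<longlongrightarrow> Z2 y1 y2) (at_right 0)" for y1 y2
          unfolding Y2_def Z2_def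
          by (intro tendsto_intros tendsto_at_right_scaled[OF h qu(1)])
        have sub: "\<forall>\<^sub>F s in at_right 0. (\<lambda>(x, z). f (x, z + \<psi>' x)) (s ^ q * y1, s ^ u * y2)
            = g (s ^ q * y1, s ^ u * Y2 y1 y2 s)" for y1 y2
        proof -
          have "((\<lambda>s. s ^ q * y1) \<longlongrightarrow> 0 ^ q * y1) (at_right 0)" by (intro tendsto_intros)
          then have "filterlim (\<lambda>s. s ^ q * y1) (nhds 0) (at_right 0)" using qu(1) by (simp add: zero_power)
          from eventually_compose_filterlim[OF trunc this] show ?thesis
          proof eventually_elim
            case (elim s)
            have "s ^ u * Y2 y1 y2 s = s ^ u * y2 + s ^ (u + e) * (y1 ^ Suc K * h (s ^ q * y1))"
              by (simp add: Y2_def power_add algebra_simps)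
            also have "s ^ (u + e) = (s ^ q) ^ Suc K" by (simp only: ue power_mult)
            finally have "s ^ u * Y2 y1 y2 s = s ^ u * y2 + (s ^ q * y1) ^ Suc K * h (s ^ q * y1)"
              by (simp only: power_mult_distrib mult.assoc)
            then show ?case using elim by (simp add: g_def \<psi>'_def algebra_simps)
          qed
        qed
        have c'g: "has_dps g c'" using c'(1) by (simp add: g_def)
        note tr = leading_transfer[where ?Y1.0 = "\<lambda>y1 y2 s. y1" and ?Z1.0 = "\<lambda>y1 y2. y1"
          and ?Y2.0 = Y2 and ?Z2.0 = Z2, OF c'g c2 qu(1,2) M sub tendsto_const lim]
        have 1: "M \<le> q * j + u * k" if "c2 (j, k) \<noteq> 0" for j k by (rule tr(1)[OF _ that]) assumption
        have 2: "edge_form c2 q u M y1 y2 = edge_form c' q u M y1 y2" if "u < Suc K * q" for y1 y2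
        proof -
          have "0 < e" using that by (simp add: e_def mult.commute)
          then have "Z2 y1 y2 = y2" by (simp add: Z2_def zero_power)
          moreover have "edge_form c2 q u M y1 y2 = edge_form c' q u M y1 (Z2 y1 y2)"
            by (rule tr(2)) assumption
          ultimately show ?thesis by simp
        qed
        show ?thesis using 1 2 by blast
      qed
      define d2 where "d2 = newton_distance (\<lambda>(x, z). f (x, z + \<psi>' x))"
      have D2: "is_distance c2 d2" unfolding d2_def by (rule newton_distance[OF c2 c20])
      have "d' \<le> d2"
      proof (rule ccontr)
        assume "\<not> d' \<le> d2"
        then have lt: "d2 < d'" by simp
        have d20: "0 \<le> d2" using is_distance_le[OF D2, of 1 0 0] by (simp add: supports_def)
        have v2: "0 \<le> v2" "0 < v1 + v2" using v by auto
        obtain q u where qu: "0 < q" "0 < u"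
          and big: "\<And>j k. c' (j, k) \<noteq> 0 \<Longrightarrow> (real q + real u) * d2 < real (q * j + u * k)"
          and uq: "\<And>K::nat. 0 < K \<Longrightarrow> v2 \<le> real K * v1 \<Longrightarrow> u \<le> K * q"
          by (rule rational_weight[OF v(1) v2 v(3) d20 lt]) (rule that)
        obtain M where M: "\<And>j k. c' (j, k) \<noteq> 0 \<Longrightarrow> M \<le> q * j + u * k"
          and att: "\<exists>j k. c' (j, k) \<noteq> 0 \<and> q * j + u * k = M"
          by (rule minimal_weight[OF c'(2), of q u]) (rule that, assumption+)
        have "u \<le> Suc K * q" by (rule uq[OF _ Kv'(2)]) simp
        from transfer[OF qu this M] have "\<And>j k. c2 (j, k) \<noteq> 0 \<Longrightarrow> M \<le> q * j + u * k" by blast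
        from is_distance_weight_le[OF D2 this] have "real M \<le> (real q + real u) * d2" .
        with att big show False by fastforce
      qed
      then have ad: "adapted_coordinates f (\<lambda>(y1, y2). (y1, y2 + \<psi>' y1))"
        by (intro adapt[OF \<psi>']) (simp add: d2_def)
      obtain M where M: "\<And>j k. c' (j, k) \<noteq> 0 \<Longrightarrow> M \<le> 1 * j + K * k"
        and att: "\<exists>j k. c' (j, k) \<noteq> 0 \<and> 1 * j + K * k = M"
        by (rule minimal_weight[OF c'(2), of 1 K]) (rule that, assumption+)
      have tK: "(\<forall>j k. c2 (j, k) \<noteq> 0 \<longrightarrow> M \<le> 1 * j + K * k) \<and>
          (K < Suc K * 1 \<longrightarrow> (\<forall>y1 y2. edge_form c2 1 K M y1 y2 = edge_form c' 1 K M y1 y2))"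
        by (rule transfer[OF zero_less_one K(1) _ M]) simp_all
      have "poly (edge_poly c2 1 K M) z = poly (edge_poly c' 1 K M) z" for z
        using tK by (simp flip: edge_form_1)
      then have pp: "edge_poly c2 1 K M = edge_poly c' 1 K M" by (intro poly_ext) auto
      have p0: "edge_poly c' 1 K M \<noteq> 0"
      proof
        assume "edge_poly c' 1 K M = 0"
        then show False using att coeff_edge_poly(1)[OF zero_less_one K(1), of _ _ M c'] by force
      qed
      \<comment> \<open>Since \<open>K\<close> is less than the slope, the edge of weight \<open>(1, K)\<close> does not reach the horizontal axis,
        so that \<open>0\<close> is a root of its edge polynomial.\<close>
      have "c' (M, 0) = 0"
      proof (rule ccontr)
        assume "c' (M, 0) \<noteq> 0"
        then have "(v1 + v2) * d' \<le> v1 * real M + v2 * real 0" using v(3) unfolding supports_def by blast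
        also have "\<dots> \<le> v1 * ((1 + real K) * d')"
          using is_distance_weight_le[OF D' M] v(1) by (simp add: mult_left_mono)
        finally have "(v2 - real K * v1) * d' \<le> 0" by (simp add: algebra_simps)
        with Kv'(1) d'0 show False by (simp add: mult_le_0_iff)
      qed
      then have "coeff (edge_poly c' 1 K M) 0 = 0"
        using coeff_edge_poly(1)[OF zero_less_one K(1), of M 0 M c'] by simp
      then have "poly (edge_poly c' 1 K M) 0 = 0" by (simp add: poly_0_coeff_0)
      then have ord: "0 < order 0 (edge_poly c2 1 K M)"
        using p0 order_root[of "edge_poly c2 1 K M" 0] unfolding pp by simp
      have M2: "M \<le> 1 * j + K * k" if "c2 (j, k) \<noteq> 0" for j k using tK that by blast
      obtain H E \<rho> where H: "has_dps H E" "0 < \<rho>"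
        and Heq: "\<And>s w. norm s < \<rho> \<Longrightarrow> norm w < \<rho> \<Longrightarrow>
          (\<lambda>(x, z). f (x, z + \<psi>' x)) (s ^ 1, s ^ K * (0 + w)) = s ^ M * H (s, w)"
        and E: "\<And>k. k < order 0 (edge_poly c2 1 K M) \<Longrightarrow> E (0, k) = 0" "E (0, order 0 (edge_poly c2 1 K M)) \<noteq> 0"
        by (rule blow_up_row[OF c2 zero_less_one K(1) M2 p0[folded pp], of 0]) (assumption, rule that)
      have "root_or_leading_partial_sum f (\<lambda>x. \<Sum>i\<le>K. a i * x ^ i)"
      proof (rule root_from_blow_up[where a = a and D = E, OF f c0 a0 H(1) E(1)[OF ord] E(2)])
        show "\<forall>\<^sub>F (s, w) in nhds (0, 0). f (s, (\<Sum>i\<le>K. a i * s ^ i) + s ^ K * w) = s ^ M * H (s, w)"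
          unfolding eventually_nhds_00
        proof (intro exI[of _ \<rho>] conjI allI impI)
          fix s w :: real assume "norm s < \<rho>" "norm w < \<rho>"
          from Heq[OF this] show "case (s, w) of (s, w) \<Rightarrow> f (s, (\<Sum>i\<le>K. a i * s ^ i) + s ^ K * w) = s ^ M * H (s, w)"
            by (simp add: \<psi>'_def add.commute)
        qed (rule H(2))
      qed
      then show ?thesis using ad \<psi>' by (auto simp: real_analytic1_iff \<psi>'_def[abs_def])
    qed
  qed
qed

end
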